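(* Let $g=1+\sum_{|\alpha|\ge1}b_\alpha Z_\alpha$ be an admissible free holomorphic function and let ${\bf W}=(W_1,\ldots,W_n)$ be the weighted left creation operators associated with $g$. If the series $\sum_{k=0}^\infty\sum_{|\alpha|=k}a_\alpha W_\alpha W_\alpha^*$ is convergent in the operator norm topology, where $g^{-1}=1+\sum_{|\alpha|\ge1}a_\alpha Z_\alpha$, and $\pi:C^*({\bf W})\to B(\mathcal K)$ is a unital $*$-representation of $C^*({\bf W})$ on a separable Hilbert space $\mathcal K$, then $\pi$ decomposes into a direct sum $$\pi=\pi_0\oplus\pi_1\ \text{ on }\ \mathcal K=\mathcal K_0\oplus\mathcal K_1,$$ where $\pi_0$ and $\pi_1$ are disjoint representations of $C^*({\bf W})$ on the Hilbert spaces $$\mathcal K_0:=\overline{\mathrm{span}}\{\pi(W_\beta)\Delta_{g^{-1}}(\pi({\bf W}),\pi({\bf W})^* )\mathcal K:\ \beta\in\mathbb F_n^+\}\quad\text{and}\quad\mathcal K_1:=\mathcal K\ominus\mathcal K_0,$$ respectively, where $\pi({\bf W}):=(\pi(W_1),\ldots,\pi(W_n))$. Moreover, up to an isomorphism (unitary equivalence), $$\mathcal K_0\simeq F^2(H_n)\otimes\mathcal G,\qquad\pi_0(X)=X\otimes I_{\mathcal G}\quad\text{for }X\in C^*({\bf W}),$$ where $\mathcal G$ is a Hilbert space with $\dim\mathcal G=\dim[\mathrm{range}\,\Delta_{g^{-1}}(\pi({\bf W}),\pi({\bf W})^* )]$, and $\pi_1$ is a $*$-representation which annihilates the compact operators in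 $C^*({\bf W})$ and $\Delta_{g^{-1}}(\pi_1({\bf W}),\pi_1({\bf W})^* )=0$. If $\pi'$ is another unital $*$-representation of $C^*({\bf W})$ on a separable Hilbert space $\mathcal K'$, with corresponding space $\mathcal G'$ and representation $\pi_1'$, then $\pi$ is unitarily equivalent to $\pi'$ if and only if $\dim\mathcal G=\dim\mathcal G'$ and $\pi_1$ is unitarily equivalent to $\pi_1'$.
   Context: $\mathbb F_n^+$ is the unital free semigroup on generators $g_1,\ldots,g_n$ with identity $g_0$, and $|\alpha|$ is the length of $\alpha$. For $\alpha=g_{i_1}\cdots g_{i_k}$, $X_\alpha:=X_{i_1}\cdots X_{i_k}$, $X_{g_0}:=I$. $F^2(H_n)$ is the full Fock space with orthonormal basis $\{e_\alpha\}_{\alpha\in\mathbb F_n^+}$. A formal power series $\sum_\alpha c_\alpha Z_\alpha$ in noncommuting indeterminates is a free holomorphic function in a neighborhood of the origin if there is $\rho>0$ such that $\sum_{k}\sum_{|\alpha|=k}c_\alpha X_\alpha$ converges in norm for every Hilbert space $\mathcal H$ and every $X\in B(\mathcal H)^n$ with $\|\sum_iX_iX_i^*\|^{1/2}\le\rho$; equivalently $\limsup_k(\sum_{|\alpha|=k}|c_\alpha|^2)^{1/2k}<\infty$. $g$ is admissible if: (a) $b_{g_0}=1$, all $b_\alpha>0$, and $\sup_\alpha b_\alpha/b_{g_i\alpha}<\infty$ for each $i$; (b) $g$ is free holomorphic in a neighborhood of the origin; (c) $\sup_{k}\big\|\sum_{p=0}^k\sum_{|\alpha|=p}a_\alpha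 W_\alpha W_\alpha^*\big\|<\infty$, where $g^{-1}=1+\sum_{|\alpha|\ge1}a_\alpha Z_\alpha$ is the inverse power series ($a_{g_0}=1$) and $W_ie_\alpha=\sqrt{b_\alpha/b_{g_i\alpha}}\,e_{g_i\alpha}$ are the weighted left creation operators on $F^2(H_n)$. $C^*({\bf W})$ is the $C^*$-algebra generated by $W_1,\ldots,W_n$ and the identity. For a tuple $X$, $\Delta_{g^{-1}}(X,X^* ):=\sum_{k=0}^\infty\sum_{|\alpha|=k}a_\alpha X_\alpha X_\alpha^*$ (norm convergent for $X=\pi({\bf W})$ under the hypothesis). Two representations are disjoint if they have no unitarily equivalent nonzero subrepresentations. *)

theory Defs
  imports "HOL-Analysis.Analysis" "HOL-Library.Equipollence"
begin

section \<open>Complex Hilbert spaces\<close>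

text \<open>
  The real inner product underlying a complex Hilbert space is the real part of the complex one,
  so norm, metric and topology are those of the library class \<^class>\<open>real_inner\<close>.
  The inner product is linear in its first argument.  The zero space is allowed.
\<close>

class complex_hilbert = real_inner + complete_space +
  fixes scaleC :: "complex \<Rightarrow> 'a \<Rightarrow> 'a" (infixr \<open>*\<^sub>C\<close> 75)
    and cinner :: "'a \<Rightarrow> 'a \<Rightarrow> complex"
  assumes scaleC_add_right: "c *\<^sub>C (x + y) = c *\<^sub>C x + c *\<^sub>C y"
    and scaleC_add_left: "(c + d) *\<^sub>C x = c *\<^sub>C x + d *\<^sub>C x"
    and scaleC_scaleC: "c *\<^sub>C d *\<^sub>C x = (c * d) *\<^sub>C x"
    and scaleC_of_real: "complex_of_real r *\<^sub>C x = r *\<^sub>R x"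
    and cinner_commute: "cinner x y = cnj (cinner y x)"
    and cinner_add_left: "cinner (x + y) z = cinner x z + cinner y z"
    and cinner_scaleC_left: "cinner (c *\<^sub>C x) y = c * cinner x y"
    and Re_cinner: "Re (cinner x y) = inner x y"

lemma cinner_add_right: "cinner z (x + y) = cinner z x + cinner z y"
  for x :: "'a::complex_hilbert"
  by (metis cinner_add_left cinner_commute complex_cnj_add)

lemma cinner_scaleC_right: "cinner x (c *\<^sub>C y) = cnj c * cinner x y"
  for x :: "'a::complex_hilbert"
  by (metis cinner_commute cinner_scaleC_left complex_cnj_mult)

lemma scaleC_one [simp]: "1 *\<^sub>C x = x" for x :: "'a::complex_hilbert"
  by (metis of_real_1 scaleC_of_real scaleR_one)

lemma scaleC_zero_left [simp]: "0 *\<^sub>C x = 0" for x :: "'a::complex_hilbert"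
  by (metis of_real_0 scaleC_of_real scaleR_zero_left)

lemma scaleC_zero_right [simp]: "c *\<^sub>C 0 = (0 :: 'a::complex_hilbert)"
  by (metis add_cancel_right_left scaleC_add_right)

lemma scaleC_minus1: "(-1) *\<^sub>C x = - x" for x :: "'a::complex_hilbert"
  by (metis of_real_1 of_real_minus scaleC_of_real scaleR_minus1_left)

lemma scaleC_scaleR: "c *\<^sub>C r *\<^sub>R x = r *\<^sub>R c *\<^sub>C x" for x :: "'a::complex_hilbert"
  by (metis mult.commute scaleC_of_real scaleC_scaleC)

lemma cinner_zero_left [simp]: "cinner 0 x = 0" for x :: "'a::complex_hilbert"
  by (metis mult_zero_left scaleC_zero_left cinner_scaleC_left)

lemma cinner_zero_right [simp]: "cinner x 0 = 0" for x :: "'a::complex_hilbert"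
  by (metis cinner_commute cinner_zero_left complex_cnj_zero)

lemma cinner_scaleR_left: "cinner (r *\<^sub>R x) y = complex_of_real r * cinner x y"
  for x :: "'a::complex_hilbert"
  by (metis cinner_scaleC_left scaleC_of_real)

lemma cinner_minus_left: "cinner (- x) y = - cinner x y" for x :: "'a::complex_hilbert"
  by (metis cinner_scaleC_left mult_minus1 scaleC_minus1)

lemma cinner_diff_left: "cinner (x - y) z = cinner x z - cinner y z"
  for x :: "'a::complex_hilbert"
  by (metis cinner_add_left cinner_minus_left diff_conv_add_uminus)

lemma cinner_minus_right: "cinner x (- y) = - cinner x y" for x :: "'a::complex_hilbert"
  by (metis cinner_minus_left cinner_commute complex_cnj_minus)

lemma cinner_diff_right: "cinner x (y - z) = cinner x y - cinner x z"
  for x :: "'a::complex_hilbert"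
  by (metis cinner_add_right cinner_minus_right diff_conv_add_uminus)

lemma cinner_self: "cinner x x = complex_of_real ((norm x)\<^sup>2)" for x :: "'a::complex_hilbert"
proof (rule complex_eqI)
  show "Re (cinner x x) = Re (complex_of_real ((norm x)\<^sup>2))"
    by (simp add: Re_cinner power2_norm_eq_inner)
  have "Im (cinner x x) = - Im (cinner x x)"
    by (metis cinner_commute cnj.simps(2))
  then show "Im (cinner x x) = Im (complex_of_real ((norm x)\<^sup>2))" by simp
qed

lemma Im_cinner: "Im (cinner x y) = inner x (\<i> *\<^sub>C y)" for x :: "'a::complex_hilbert"
  by (simp add: Re_cinner [symmetric] cinner_scaleC_right)

lemma norm_scaleC [simp]: "norm (c *\<^sub>C x) = cmod c * norm x" for x :: "'a::complex_hilbert"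
proof -
  have "complex_of_real ((norm (c *\<^sub>C x))\<^sup>2) = c * cnj c * complex_of_real ((norm x)\<^sup>2)"
    by (metis cinner_self cinner_scaleC_left cinner_scaleC_right mult.assoc)
  also have "\<dots> = complex_of_real ((cmod c * norm x)\<^sup>2)"
    by (simp add: complex_norm_square [symmetric] power_mult_distrib)
  finally have "(norm (c *\<^sub>C x))\<^sup>2 = (cmod c * norm x)\<^sup>2"
    by (simp only: of_real_eq_iff)
  then show ?thesis by (simp add: power2_eq_iff_nonneg)
qed

lemma cinner_Cauchy_Schwarz: "cmod (cinner x y) \<le> norm x * norm y"
  for x :: "'a::complex_hilbert"
proof (cases "cinner x y = 0")
  case False
  define u where "u = cnj (sgn (cinner x y))"
  have u: "cmod u = 1" using False by (simp add: u_def norm_sgn)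
  have "u * cinner x y = complex_of_real (cmod (cinner x y))"
    using False
    by (simp add: u_def sgn_div_norm scaleR_conv_of_real mult_ac complex_norm_square [symmetric]
        power2_eq_square divide_simps flip: of_real_mult)
  then have "cmod (cinner x y) = Re (cinner (u *\<^sub>C x) y)"
    by (simp add: cinner_scaleC_left)
  also have "\<dots> \<le> norm (u *\<^sub>C x) * norm y"
    unfolding Re_cinner by (rule norm_cauchy_schwarz)
  finally show ?thesis by (simp add: u)
qed simp

lemma cinner_eqI: "(\<And>y. cinner x y = cinner x' y) \<Longrightarrow> x = x'" for x :: "'a::complex_hilbert"
  by (metis cinner_diff_left cinner_self eq_iff_diff_eq_0 norm_eq_zero of_real_eq_0_iff
      power_eq_0_iff)

instantiation complex :: complex_hilbert
begin
definition "scaleC_complex c (x::complex) = c * x"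
definition "cinner_complex x (y::complex) = x * cnj y"
instance
  by standard (auto simp: scaleC_complex_def cinner_complex_def algebra_simps scaleR_conv_of_real
      inner_complex_def)
end

section \<open>Square-summable families and the full Fock space\<close>

typedef (overloaded) ('a, 'b) ell2 =
  "{f :: 'a \<Rightarrow> 'b::complex_hilbert. (\<lambda>x. (norm (f x))\<^sup>2) summable_on UNIV}"
  morphisms coord Abs_ell2
  by (rule exI [of _ "\<lambda>_. 0"]) simp

setup_lifting type_definition_ell2

lemma ell2_bound:
  fixes f :: "'a \<Rightarrow> 'b::complex_hilbert"
  assumes "\<And>F. finite F \<Longrightarrow> (\<Sum>x\<in>F. (norm (f x))\<^sup>2) \<le> C"
  shows "(\<lambda>x. (norm (f x))\<^sup>2) summable_on UNIV" "(\<Sum>\<^sub>\<infinity>x. (norm (f x))\<^sup>2) \<le> C"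
proof -
  show "(\<lambda>x. (norm (f x))\<^sup>2) summable_on UNIV"
    by (rule nonneg_bounded_partial_sums_imp_summable_on [where C = C])
       (auto intro!: eventually_finite_subsets_at_top_weakI assms)
  then show "(\<Sum>\<^sub>\<infinity>x. (norm (f x))\<^sup>2) \<le> C"
    by (rule infsum_le_finite_sums) (auto intro: assms)
qed

lemma ell2_add_aux:
  fixes f :: "'a \<Rightarrow> 'b::complex_hilbert"
  assumes "(\<lambda>x. (norm (f x))\<^sup>2) summable_on UNIV" "(\<lambda>x. (norm (g x))\<^sup>2) summable_on UNIV"
  shows "(\<lambda>x. (norm (f x + g x))\<^sup>2) summable_on UNIV"
proof (rule summable_on_comparison_test)
  show "(\<lambda>x. 2 * ((norm (f x))\<^sup>2 + (norm (g x))\<^sup>2)) summable_on UNIV"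
    by (intro summable_on_cmult_right summable_on_add assms)
  show "(norm (f x + g x))\<^sup>2 \<le> 2 * ((norm (f x))\<^sup>2 + (norm (g x))\<^sup>2)" for x
  proof -
    have "(norm (f x + g x))\<^sup>2 \<le> (norm (f x) + norm (g x))\<^sup>2"
      by (intro power_mono norm_triangle_ineq) simp
    also have "\<dots> \<le> 2 * ((norm (f x))\<^sup>2 + (norm (g x))\<^sup>2)"
      using sum_squares_bound [of "norm (f x)" "norm (g x)"] by (simp add: power2_sum)
    finally show ?thesis .
  qed
qed auto

lemma ell2_cinner_aux:
  fixes f :: "'a \<Rightarrow> 'b::complex_hilbert"
  assumes "(\<lambda>x. (norm (f x))\<^sup>2) summable_on UNIV" "(\<lambda>x. (norm (g x))\<^sup>2) summable_on UNIV"
  shows "(\<lambda>x. norm (cinner (f x) (g x))) summable_on UNIV"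
proof (rule summable_on_comparison_test)
  show "(\<lambda>x. (norm (f x))\<^sup>2 + (norm (g x))\<^sup>2) summable_on UNIV"
    by (intro summable_on_add assms)
  show "norm (cinner (f x) (g x)) \<le> (norm (f x))\<^sup>2 + (norm (g x))\<^sup>2" for x
  proof -
    have "norm (cinner (f x) (g x)) \<le> norm (f x) * norm (g x)"
      by (rule cinner_Cauchy_Schwarz)
    also have "\<dots> \<le> (norm (f x))\<^sup>2 + (norm (g x))\<^sup>2"
      using sum_squares_bound [of "norm (f x)" "norm (g x)"]
        mult_nonneg_nonneg [OF norm_ge_zero norm_ge_zero, of "f x" "g x"] by linarith
    finally show ?thesis .
  qed
qed auto

instantiation ell2 :: (type, complex_hilbert) real_inner
begin

lift_definition zero_ell2 :: "('a, 'b) ell2" is "\<lambda>_. 0" by simp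
lift_definition plus_ell2 :: "('a, 'b) ell2 \<Rightarrow> ('a, 'b) ell2 \<Rightarrow> ('a, 'b) ell2"
  is "\<lambda>f g x. f x + g x" by (rule ell2_add_aux)
lift_definition uminus_ell2 :: "('a, 'b) ell2 \<Rightarrow> ('a, 'b) ell2" is "\<lambda>f x. - f x" by simp
lift_definition minus_ell2 :: "('a, 'b) ell2 \<Rightarrow> ('a, 'b) ell2 \<Rightarrow> ('a, 'b) ell2"
  is "\<lambda>f g x. f x - g x"
proof -
  fix f g :: "'a \<Rightarrow> 'b"
  assume f: "(\<lambda>x. (norm (f x))\<^sup>2) summable_on UNIV"
    and g: "(\<lambda>x. (norm (g x))\<^sup>2) summable_on UNIV"
  have "(\<lambda>x. (norm (- g x))\<^sup>2) summable_on UNIV" using g by (simp only: norm_minus_cancel)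
  from ell2_add_aux [OF f this] show "(\<lambda>x. (norm (f x - g x))\<^sup>2) summable_on UNIV"
    by (simp only: add_uminus_conv_diff)
qed
lift_definition scaleR_ell2 :: "real \<Rightarrow> ('a, 'b) ell2 \<Rightarrow> ('a, 'b) ell2"
  is "\<lambda>r f x. r *\<^sub>R f x"
  by (simp add: power_mult_distrib summable_on_cmult_right)
definition inner_ell2 :: "('a, 'b) ell2 \<Rightarrow> ('a, 'b) ell2 \<Rightarrow> real"
  where "inner_ell2 f g = (\<Sum>\<^sub>\<infinity>x. inner (coord f x) (coord g x))"
definition norm_ell2 :: "('a, 'b) ell2 \<Rightarrow> real"
  where "norm_ell2 f = sqrt (inner f f)"
definition dist_ell2 :: "('a, 'b) ell2 \<Rightarrow> ('a, 'b) ell2 \<Rightarrow> real"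
  where "dist_ell2 f g = norm (f - g)"
definition sgn_ell2 :: "('a, 'b) ell2 \<Rightarrow> ('a, 'b) ell2"
  where "sgn_ell2 f = inverse (norm f) *\<^sub>R f"
definition uniformity_ell2 :: "(('a, 'b) ell2 \<times> ('a, 'b) ell2) filter"
  where "uniformity_ell2 = (INF e\<in>{0 <..}. principal {(x, y). dist x y < e})"
definition open_ell2 :: "('a, 'b) ell2 set \<Rightarrow> bool"
  where "open_ell2 U \<longleftrightarrow>
    (\<forall>x\<in>U. eventually (\<lambda>(x', y). x' = x \<longrightarrow> y \<in> U) uniformity)"

lemma coord_summable: "(\<lambda>x. (norm (coord f x))\<^sup>2) summable_on UNIV"
  using coord [of f] by simp

lemma coord_cinner_summable: "(\<lambda>x. cinner (coord f x) (coord g x)) summable_on UNIV"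
  by (rule abs_summable_summable, rule ell2_cinner_aux) (rule coord_summable)+

lemma coord_inner_summable: "(\<lambda>x. inner (coord f x) (coord g x)) summable_on UNIV"
  unfolding Re_cinner [symmetric] by (rule summable_on_Re) (rule coord_cinner_summable)

lemma inner_self_ell2_eq: "inner f f = (\<Sum>\<^sub>\<infinity>x. (norm (coord f x))\<^sup>2)"
  for f :: "('a, 'b) ell2"
  unfolding inner_ell2_def power2_norm_eq_inner ..

lemma coord_finite_sum_le: "finite F \<Longrightarrow> (\<Sum>x\<in>F. (norm (coord f x))\<^sup>2) \<le> inner f f"
  for f :: "('a, 'b) ell2"
  unfolding inner_self_ell2_eq by (intro finite_sum_le_infsum coord_summable) auto

lemma norm_coord_le: "norm (coord f x) \<le> norm f" for f :: "('a, 'b) ell2"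
  using coord_finite_sum_le [of "{x}" f] by (simp add: norm_ell2_def real_le_rsqrt)

instance
proof
  fix f g h :: "('a, 'b) ell2" and r s :: real
  show "f + g + h = f + (g + h)" by transfer (rule ext, rule add.assoc)
  show "f + g = g + f" by transfer (rule ext, rule add.commute)
  show "0 + f = f" by transfer (rule ext, rule add_0_left)
  show "- f + f = 0" by transfer (rule ext, rule left_minus)
  show "f - g = f + - g" by transfer (rule ext, rule diff_conv_add_uminus)
  show "r *\<^sub>R (f + g) = r *\<^sub>R f + r *\<^sub>R g" by transfer (rule ext, rule scaleR_add_right)
  show "(r + s) *\<^sub>R f = r *\<^sub>R f + s *\<^sub>R f" by transfer (rule ext, rule scaleR_add_left)
  show "r *\<^sub>R s *\<^sub>R f = (r * s) *\<^sub>R f" by transfer (rule ext, rule scaleR_scaleR)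
  show "1 *\<^sub>R f = f" by transfer (rule ext, rule scaleR_one)
  show "dist f g = norm (f - g)" by (rule dist_ell2_def)
  show "sgn f = inverse (norm f) *\<^sub>R f" by (rule sgn_ell2_def)
  show "uniformity = (INF e\<in>{0 <..}. principal {(x, y :: ('a, 'b) ell2). dist x y < e})"
    by (rule uniformity_ell2_def)
  show "open U \<longleftrightarrow> (\<forall>x\<in>U. eventually (\<lambda>(x', y). x' = x \<longrightarrow> y \<in> U) uniformity)"
    for U :: "('a, 'b) ell2 set"
    by (rule open_ell2_def)
  show "inner f g = inner g f" by (unfold inner_ell2_def, rule infsum_cong, rule inner_commute)
  show "inner (f + g) h = inner f h + inner g h"
    unfolding inner_ell2_def plus_ell2.rep_eq inner_add_left
    by (intro infsum_add coord_inner_summable)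
  show "inner (r *\<^sub>R f) g = r * inner f g"
    unfolding inner_ell2_def scaleR_ell2.rep_eq inner_scaleR_left
    by (intro infsum_cmult_right coord_inner_summable)
  show "0 \<le> inner f f" unfolding inner_self_ell2_eq by (rule infsum_nonneg) simp
  show "inner f f = 0 \<longleftrightarrow> f = 0"
  proof
    assume "inner f f = 0"
    then have "norm (coord f x) \<le> 0" for x
      using norm_coord_le [of f x] by (simp add: norm_ell2_def)
    then show "f = 0" by (simp add: coord_inject [symmetric] fun_eq_iff zero_ell2.rep_eq)
  qed (simp add: inner_self_ell2_eq zero_ell2.rep_eq)
  show "norm f = sqrt (inner f f)" by (rule norm_ell2_def)
qed

end

instance ell2 :: (type, complex_hilbert) complete_space
proof
  fix X :: "nat \<Rightarrow> ('a, 'b) ell2"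
  assume cX: "Cauchy X"
  have coord_diff: "coord (X m - X n) x = coord (X m) x - coord (X n) x" for m n x
    by (simp add: minus_ell2.rep_eq)
  have "Cauchy (\<lambda>n. coord (X n) x)" for x
  proof (rule metric_CauchyI)
    fix e :: real assume "0 < e"
    with cX obtain M where M: "\<And>m n. m \<ge> M \<Longrightarrow> n \<ge> M \<Longrightarrow> dist (X m) (X n) < e"
      unfolding Cauchy_def by blast
    show "\<exists>M. \<forall>m\<ge>M. \<forall>n\<ge>M. dist (coord (X m) x) (coord (X n) x) < e"
    proof (intro exI allI impI)
      fix m n assume "m \<ge> M" "n \<ge> M"
      have "dist (coord (X m) x) (coord (X n) x) \<le> dist (X m) (X n)"
        using norm_coord_le [of "X m - X n" x] by (simp add: dist_norm coord_diff)
      also have "\<dots> < e" using M \<open>m \<ge> M\<close> \<open>n \<ge> M\<close> by blast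
      finally show "dist (coord (X m) x) (coord (X n) x) < e" .
    qed
  qed
  then have "\<forall>x. \<exists>l. (\<lambda>n. coord (X n) x) \<longlonglongrightarrow> l"
    using Cauchy_convergent_iff convergent_def by blast
  then obtain L where L: "\<And>x. (\<lambda>n. coord (X n) x) \<longlonglongrightarrow> L x" by metis
  have tail: "\<exists>M. \<forall>n\<ge>M. \<forall>F. finite F \<longrightarrow> (\<Sum>x\<in>F. (norm (coord (X n) x - L x))\<^sup>2) \<le> e\<^sup>2"
    if "0 < e" for e :: real
  proof -
    from cX \<open>0 < e\<close> obtain M where M: "\<And>m n. m \<ge> M \<Longrightarrow> n \<ge> M \<Longrightarrow> dist (X m) (X n) < e"
      unfolding Cauchy_def by blast
    show ?thesis
    proof (intro exI allI impI)
      fix n and F :: "'a set" assume n: "n \<ge> M" and F: "finite F"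
      have "(\<lambda>m. \<Sum>x\<in>F. (norm (coord (X n) x - coord (X m) x))\<^sup>2)
          \<longlonglongrightarrow> (\<Sum>x\<in>F. (norm (coord (X n) x - L x))\<^sup>2)"
        by (intro tendsto_intros L)
      moreover have "(\<Sum>x\<in>F. (norm (coord (X n) x - coord (X m) x))\<^sup>2) \<le> e\<^sup>2" if "m \<ge> M" for m
      proof -
        have "inner (X n - X m) (X n - X m) = (norm (X n - X m))\<^sup>2"
          by (rule power2_norm_eq_inner [symmetric])
        moreover have "norm (X n - X m) < e" using M [OF n that] by (simp add: dist_norm)
        ultimately have "inner (X n - X m) (X n - X m) \<le> e\<^sup>2"
          by (simp add: power_mono)
        then show ?thesis
          using coord_finite_sum_le [OF F, of "X n - X m"] by (simp add: coord_diff)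
      qed
      ultimately show "(\<Sum>x\<in>F. (norm (coord (X n) x - L x))\<^sup>2) \<le> e\<^sup>2"
        by (intro LIMSEQ_le_const2) blast+
    qed
  qed
  obtain M where M: "\<forall>n\<ge>M. \<forall>F. finite F \<longrightarrow> (\<Sum>x\<in>F. (norm (coord (X n) x - L x))\<^sup>2) \<le> 1\<^sup>2"
    using tail [of 1] by auto
  have "(\<lambda>x. (norm (coord (X M) x - L x))\<^sup>2) summable_on UNIV"
    using M by (intro ell2_bound(1)) auto
  then have "(\<lambda>x. (norm (coord (X M) x + - (coord (X M) x - L x)))\<^sup>2) summable_on UNIV"
    by (intro ell2_add_aux coord_summable) (simp add: norm_minus_commute)
  then have sL: "(\<lambda>x. (norm (L x))\<^sup>2) summable_on UNIV" by simp
  define l where "l = Abs_ell2 L"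
  have l: "coord l x = L x" for x using sL by (simp add: l_def Abs_ell2_inverse)
  have "X \<longlonglongrightarrow> l"
  proof (rule metric_LIMSEQ_I)
    fix e :: real assume "0 < e"
    then obtain M where M: "\<forall>n\<ge>M. \<forall>F. finite F \<longrightarrow>
        (\<Sum>x\<in>F. (norm (coord (X n) x - L x))\<^sup>2) \<le> (e/2)\<^sup>2"
      using tail [of "e/2"] by auto
    have "dist (X n) l < e" if "n \<ge> M" for n
    proof -
      have "inner (X n - l) (X n - l) \<le> (e/2)\<^sup>2"
        unfolding inner_self_ell2_eq minus_ell2.rep_eq l using M that by (intro ell2_bound(2)) auto
      then have "norm (X n - l) \<le> e/2"
        unfolding norm_eq_sqrt_inner using \<open>0 < e\<close> by (intro real_le_lsqrt) auto
      then show ?thesis using \<open>0 < e\<close> by (simp add: dist_norm)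
    qed
    then show "\<exists>no. \<forall>n\<ge>no. dist (X n) l < e" by blast
  qed
  then show "convergent X" by (rule convergentI)
qed

instantiation ell2 :: (type, complex_hilbert) complex_hilbert
begin

lift_definition scaleC_ell2 :: "complex \<Rightarrow> ('a, 'b) ell2 \<Rightarrow> ('a, 'b) ell2"
  is "\<lambda>r f x. r *\<^sub>C f x"
  by (simp add: power_mult_distrib summable_on_cmult_right)
definition cinner_ell2 :: "('a, 'b) ell2 \<Rightarrow> ('a, 'b) ell2 \<Rightarrow> complex"
  where "cinner_ell2 f g = (\<Sum>\<^sub>\<infinity>x. cinner (coord f x) (coord g x))"

instance
proof
  fix f g h :: "('a, 'b) ell2" and c d :: complex and r :: real
  show "c *\<^sub>C (f + g) = c *\<^sub>C f + c *\<^sub>C g" "(c + d) *\<^sub>C f = c *\<^sub>C f + d *\<^sub>C f"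
    "c *\<^sub>C d *\<^sub>C f = (c * d) *\<^sub>C f" "complex_of_real r *\<^sub>C f = r *\<^sub>R f"
    by (simp_all add: coord_inject [symmetric] fun_eq_iff scaleC_ell2.rep_eq plus_ell2.rep_eq
        scaleR_ell2.rep_eq scaleC_add_right scaleC_add_left scaleC_scaleC scaleC_of_real)
  show "cinner f g = cnj (cinner g f)"
  proof -
    have "cinner f g = (\<Sum>\<^sub>\<infinity>x. cnj (cinner (coord g x) (coord f x)))"
      unfolding cinner_ell2_def by (rule infsum_cong) (rule cinner_commute)
    also have "\<dots> = cnj (cinner g f)" unfolding cinner_ell2_def by (rule infsum_cnj)
    finally show ?thesis .
  qed
  show "cinner (f + g) h = cinner f h + cinner g h"
    unfolding cinner_ell2_def plus_ell2.rep_eq cinner_add_left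
    by (intro infsum_add coord_cinner_summable)
  show "cinner (c *\<^sub>C f) g = c * cinner f g"
    unfolding cinner_ell2_def scaleC_ell2.rep_eq cinner_scaleC_left
    by (intro infsum_cmult_right coord_cinner_summable)
  show "Re (cinner f g) = inner f g"
    unfolding cinner_ell2_def inner_ell2_def
    by (simp add: infsum_Re [OF coord_cinner_summable, symmetric] Re_cinner)
qed

end

instance complex_hilbert \<subseteq> banach ..

section \<open>Subspaces and bounded operators\<close>

definition csubspace :: "'a::complex_hilbert set \<Rightarrow> bool" where
  "csubspace M \<longleftrightarrow> 0 \<in> M \<and> (\<forall>x\<in>M. \<forall>y\<in>M. x + y \<in> M) \<and> (\<forall>c. \<forall>x\<in>M. c *\<^sub>C x \<in> M)"

definition closed_csubspace :: "'a::complex_hilbert set \<Rightarrow> bool" where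
  "closed_csubspace M \<longleftrightarrow> csubspace M \<and> closed M"

definition cspan :: "'a::complex_hilbert set \<Rightarrow> 'a set" where
  "cspan S = csubspace hull S"

definition ocomp :: "'a::complex_hilbert set \<Rightarrow> 'a set" where
  "ocomp M = {y. \<forall>x\<in>M. cinner y x = 0}"

definition is_onb :: "'a::complex_hilbert set \<Rightarrow> 'a set \<Rightarrow> bool" where
  "is_onb B M \<longleftrightarrow> (\<forall>x\<in>B. norm x = 1) \<and> (\<forall>x\<in>B. \<forall>y\<in>B. x \<noteq> y \<longrightarrow> cinner x y = 0) \<and>
     closure (cspan B) = M"

definition same_dim :: "'a::complex_hilbert set \<Rightarrow> 'b::complex_hilbert set \<Rightarrow> bool" where
  "same_dim M N \<longleftrightarrow> (\<exists>B C. is_onb B M \<and> is_onb C N \<and> B \<approx> C)"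

lift_definition cscale :: "complex \<Rightarrow> ('a::complex_hilbert \<Rightarrow>\<^sub>L 'b::complex_hilbert) \<Rightarrow> ('a \<Rightarrow>\<^sub>L 'b)"
  is "\<lambda>c A x. c *\<^sub>C A x"
proof -
  fix c and A :: "'a \<Rightarrow> 'b"
  assume A: "bounded_linear A"
  have "bounded_linear (\<lambda>y :: 'b. c *\<^sub>C y)"
    by (rule bounded_linear_intro [where K = "cmod c"])
       (simp_all add: scaleC_add_right scaleC_scaleR mult.commute)
  from bounded_linear_compose [OF this A] show "bounded_linear (\<lambda>x. c *\<^sub>C A x)" .
qed

text \<open>
  For a closed subspace \<open>M\<close> of \<open>H\<close>, the algebra \<open>B(M)\<close> is represented by the corner of \<open>B(H)\<close>
  consisting of the operators that map into \<open>M\<close> and vanish on the orthogonal complement of \<open>M\<close>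
  (extension by zero).  Norms and adjoints are unaffected, and the identity of \<open>B(M)\<close> is the
  orthogonal projection \<open>proj M\<close>.  In particular, \<open>ops_on UNIV\<close> is \<open>B(H)\<close> with identity
  \<open>proj UNIV = id_blinfun\<close>.  Elements of the library type of bounded linear maps are only
  real-linear, so complex homogeneity is required explicitly.
\<close>

definition ops_on :: "'a::complex_hilbert set \<Rightarrow> ('a \<Rightarrow>\<^sub>L 'a) set" where
  "ops_on M = {A. (\<forall>c x. blinfun_apply A (c *\<^sub>C x) = c *\<^sub>C blinfun_apply A x) \<and>
     (\<forall>x. blinfun_apply A x \<in> M) \<and> (\<forall>x\<in>ocomp M. blinfun_apply A x = 0)}"

definition proj :: "'a::complex_hilbert set \<Rightarrow> ('a \<Rightarrow>\<^sub>L 'a)" where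
  "proj M = (THE P. P \<in> ops_on M \<and> (\<forall>x\<in>M. blinfun_apply P x = x))"

definition adj :: "('a::complex_hilbert \<Rightarrow>\<^sub>L 'a) \<Rightarrow> ('a \<Rightarrow>\<^sub>L 'a)" where
  "adj A = (THE B. \<forall>x y. cinner (blinfun_apply A x) y = cinner x (blinfun_apply B y))"

definition compact_op :: "('a::complex_hilbert \<Rightarrow>\<^sub>L 'a) \<Rightarrow> bool" where
  "compact_op A \<longleftrightarrow> compact (closure (blinfun_apply A ` cball 0 1))"

lemma csubspace_diff: "csubspace M \<Longrightarrow> x \<in> M \<Longrightarrow> y \<in> M \<Longrightarrow> x - y \<in> M"
  unfolding csubspace_def by (metis add_uminus_conv_diff scaleC_minus1)

lemma csubspace_scaleR: "csubspace M \<Longrightarrow> x \<in> M \<Longrightarrow> r *\<^sub>R x \<in> M"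
  unfolding csubspace_def by (metis scaleC_of_real)

lemma parallelogram: "(norm (x + y))\<^sup>2 + (norm (x - y))\<^sup>2 = 2 * (norm x)\<^sup>2 + 2 * (norm y)\<^sup>2"
  for x :: "'a::real_inner"
  by (simp add: power2_norm_eq_inner inner_add_left inner_add_right inner_diff_left
      inner_diff_right)

lemma nearest_point_exists:
  fixes M :: "'a::complex_hilbert set"
  assumes M: "closed_csubspace M"
  shows "\<exists>y\<in>M. \<forall>z\<in>M. norm (x - y) \<le> norm (x - z)"
proof -
  have sub: "csubspace M" and cl: "closed M" using M by (auto simp: closed_csubspace_def)
  define S where "S = (\<lambda>z. (norm (x - z))\<^sup>2) ` M"
  define d where "d = Inf S"
  have ne: "S \<noteq> {}" using sub by (auto simp: S_def csubspace_def)
  have bb: "bdd_below S" unfolding S_def by (rule bdd_belowI [where m = 0]) auto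
  have d_le: "d \<le> (norm (x - z))\<^sup>2" if "z \<in> M" for z
    unfolding d_def using that by (intro cInf_lower bb) (simp add: S_def)
  have "\<exists>z\<in>M. (norm (x - z))\<^sup>2 < d + 1 / real (Suc n)" for n
  proof -
    have "\<exists>s\<in>S. s < d + 1 / real (Suc n)"
      unfolding d_def by (subst cInf_less_iff [OF ne bb, symmetric]) simp
    then show ?thesis by (auto simp: S_def)
  qed
  then obtain y where y: "\<And>n. y n \<in> M" "\<And>n. (norm (x - y n))\<^sup>2 < d + 1 / real (Suc n)"
    by metis
  have close: "(norm (y m - y n))\<^sup>2 \<le> 2 / real (Suc n) + 2 / real (Suc m)" for m n
  proof -
    have "(1/2) *\<^sub>R (y m + y n) \<in> M"
      using sub y(1) by (intro csubspace_scaleR) (auto simp: csubspace_def)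
    then have "d \<le> (norm (x - (1/2) *\<^sub>R (y m + y n)))\<^sup>2" by (rule d_le)
    moreover have "(x - y n) + (x - y m) = 2 *\<^sub>R (x - (1/2) *\<^sub>R (y m + y n))"
      by (simp add: algebra_simps scaleR_2)
    then have "norm ((x - y n) + (x - y m)) = 2 * norm (x - (1/2) *\<^sub>R (y m + y n))"
      by (simp only: norm_scaleR)
    then have "(norm ((x - y n) + (x - y m)))\<^sup>2 = 4 * (norm (x - (1/2) *\<^sub>R (y m + y n)))\<^sup>2"
      by (simp add: power_mult_distrib)
    moreover have "(x - y n) - (x - y m) = y m - y n" by simp
    ultimately show ?thesis
      using parallelogram [of "x - y n" "x - y m"] y(2) [of n] y(2) [of m] by simp
  qed
  have "Cauchy y"
  proof (rule metric_CauchyI)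
    fix e :: real assume "0 < e"
    then obtain N where N: "4 / e\<^sup>2 < real N" using reals_Archimedean2 by blast
    show "\<exists>N. \<forall>m\<ge>N. \<forall>n\<ge>N. dist (y m) (y n) < e"
    proof (intro exI allI impI)
      fix m n assume mn: "m \<ge> N" "n \<ge> N"
      have N1: "4 / e\<^sup>2 < real (Suc N)" using N by simp
      then have "4 / real (Suc N) < e\<^sup>2" using \<open>0 < e\<close>
        by (simp add: divide_less_eq mult.commute del: of_nat_Suc)
      moreover have "2 / real (Suc n) \<le> 2 / real (Suc N)" "2 / real (Suc m) \<le> 2 / real (Suc N)"
        using mn by (auto intro!: divide_left_mono)
      ultimately have "(norm (y m - y n))\<^sup>2 < e\<^sup>2" using close [of m n] by simp
      then show "dist (y m) (y n) < e"
        using \<open>0 < e\<close> by (simp add: dist_norm power_less_imp_less_base)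
    qed
  qed
  then obtain l where l: "y \<longlonglongrightarrow> l" using Cauchy_convergent_iff convergent_def by blast
  have "l \<in> M" using closed_sequentially [OF cl] y(1) l by blast
  moreover have "norm (x - l) \<le> norm (x - z)" if "z \<in> M" for z
  proof -
    have "(\<lambda>n. (norm (x - y n))\<^sup>2) \<longlonglongrightarrow> (norm (x - l))\<^sup>2" by (intro tendsto_intros l)
    moreover have "(\<lambda>n. d + 1 / real (Suc n)) \<longlonglongrightarrow> d + 0"
      by (intro tendsto_intros LIMSEQ_Suc lim_1_over_n)
    ultimately have "(norm (x - l))\<^sup>2 \<le> d + 0"
      by (rule LIMSEQ_le) (use y(2) less_imp_le in blast)
    then have "(norm (x - l))\<^sup>2 \<le> (norm (x - z))\<^sup>2" using d_le [OF that] by linarith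
    then show ?thesis by (rule power2_le_imp_le) simp
  qed
  ultimately show ?thesis by blast
qed

lemma orth_decomp_exists:
  fixes M :: "'a::complex_hilbert set"
  assumes M: "closed_csubspace M"
  shows "\<exists>y\<in>M. x - y \<in> ocomp M"
proof -
  have sub: "csubspace M" using M by (auto simp: closed_csubspace_def)
  obtain y where y: "y \<in> M" and min: "\<And>z. z \<in> M \<Longrightarrow> norm (x - y) \<le> norm (x - z)"
    using nearest_point_exists [OF M] by blast
  have re: "inner (x - y) z = 0" if z: "z \<in> M" for z
  proof (cases "z = 0")
    case False
    define t where "t = inner (x - y) z / inner z z"
    have "y + t *\<^sub>R z \<in> M"
      using y csubspace_scaleR [OF sub z] sub by (auto simp: csubspace_def)
    then have "norm (x - y) \<le> norm ((x - y) - t *\<^sub>R z)"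
      using min by (simp add: diff_diff_eq)
    then have "(norm (x - y))\<^sup>2 \<le> (norm ((x - y) - t *\<^sub>R z))\<^sup>2" by (intro power_mono) auto
    also have "\<dots> = (norm (x - y))\<^sup>2 - 2 * t * inner (x - y) z + t\<^sup>2 * inner z z"
      unfolding power2_norm_eq_inner
      by (simp add: inner_diff_left inner_diff_right inner_commute power2_eq_square algebra_simps)
    also have "\<dots> = (norm (x - y))\<^sup>2 - (inner (x - y) z)\<^sup>2 / inner z z"
      using False by (simp add: t_def power2_eq_square field_simps)
    finally have "(inner (x - y) z)\<^sup>2 / inner z z \<le> 0" by simp
    then show ?thesis using False
      by (simp add: divide_le_0_iff not_le [symmetric] del: inner_gt_zero_iff)
         (metis False inner_gt_zero_iff linorder_not_less)
  qed simp
  have "cinner (x - y) z = 0" if z: "z \<in> M" for z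
  proof (rule complex_eqI)
    show "Re (cinner (x - y) z) = Re 0" using re [OF z] by (simp add: Re_cinner)
    have "\<i> *\<^sub>C z \<in> M" using sub z by (auto simp: csubspace_def)
    then show "Im (cinner (x - y) z) = Im 0" using re by (simp add: Im_cinner)
  qed
  with y show ?thesis by (auto simp: ocomp_def)
qed

lemma csubspace_ocomp: "csubspace (ocomp M)"
  by (auto simp: csubspace_def ocomp_def cinner_add_left cinner_scaleC_left)

lemma ocomp_Int: "x \<in> M \<Longrightarrow> x \<in> ocomp M \<Longrightarrow> x = 0"
  by (auto simp: ocomp_def cinner_self)

lemma ocomp_UNIV [simp]: "ocomp UNIV = {0}"
  using ocomp_Int [of _ UNIV] by (auto simp: ocomp_def)

lemma proj_exists_unique:
  fixes M :: "'a::complex_hilbert set"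
  assumes M: "closed_csubspace M"
  shows "\<exists>!P. P \<in> ops_on M \<and> (\<forall>x\<in>M. blinfun_apply P x = x)"
proof -
  have sub: "csubspace M" using M by (auto simp: closed_csubspace_def)
  obtain p where p: "\<And>x. p x \<in> M" "\<And>x. x - p x \<in> ocomp M"
    using orth_decomp_exists [OF M] by metis
  have uniq: "p x = y" if "y \<in> M" "x - y \<in> ocomp M" for x y
  proof -
    have "p x - y \<in> M" by (intro csubspace_diff sub p that)
    moreover have "(x - y) - (x - p x) \<in> ocomp M" by (intro csubspace_diff csubspace_ocomp p that)
    ultimately have "p x - y = 0" by (intro ocomp_Int) auto
    then show ?thesis by simp
  qed
  have add: "p (x + y) = p x + p y" for x y
  proof (rule uniq)
    show "p x + p y \<in> M" using sub p by (auto simp: csubspace_def)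
    have "(x - p x) + (y - p y) \<in> ocomp M"
      using csubspace_ocomp [of M] p by (auto simp: csubspace_def)
    then show "x + y - (p x + p y) \<in> ocomp M" by (simp add: algebra_simps)
  qed
  have scC: "p (c *\<^sub>C x) = c *\<^sub>C p x" for c x
  proof (rule uniq)
    show "c *\<^sub>C p x \<in> M" using sub p by (auto simp: csubspace_def)
    have "c *\<^sub>C (x - p x) \<in> ocomp M"
      using csubspace_ocomp [of M] p by (auto simp: csubspace_def)
    moreover have "c *\<^sub>C (x - p x) = c *\<^sub>C x - c *\<^sub>C p x"
      by (metis add_diff_cancel_right' diff_add_cancel scaleC_add_right)
    ultimately show "c *\<^sub>C x - c *\<^sub>C p x \<in> ocomp M" by simp
  qed
  have nrm: "norm (p x) \<le> norm x" for x
  proof -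
    have "cinner (x - p x) (p x) = 0" using p [of x] by (auto simp: ocomp_def)
    then have "inner (x - p x) (p x) = 0" by (metis Re_cinner zero_complex.simps(1))
    then have "(norm x)\<^sup>2 = (norm (x - p x))\<^sup>2 + (norm (p x))\<^sup>2"
      by (simp add: power2_norm_eq_inner inner_diff_left inner_diff_right inner_commute)
    then have "(norm (p x))\<^sup>2 \<le> (norm x)\<^sup>2" by simp
    then show ?thesis by (rule power2_le_imp_le) simp
  qed
  have "bounded_linear p"
    by (rule bounded_linear_intro [where K = 1])
       (auto simp: add nrm scC scaleC_of_real [symmetric])
  then have P: "blinfun_apply (Blinfun p) = p" by (rule bounded_linear_Blinfun_apply)
  have p_id: "p x = x" if "x \<in> M" for x
    using that by (intro uniq) (auto simp: ocomp_def)
  have p_0: "p x = 0" if "x \<in> ocomp M" for x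
    using that sub by (intro uniq) (auto simp: csubspace_def)
  show ?thesis
  proof (rule ex1I)
    show "Blinfun p \<in> ops_on M \<and> (\<forall>x\<in>M. blinfun_apply (Blinfun p) x = x)"
      by (auto simp: ops_on_def P p scC p_id p_0)
    fix Q assume Q: "Q \<in> ops_on M \<and> (\<forall>x\<in>M. blinfun_apply Q x = x)"
    show "Q = Blinfun p"
    proof (rule blinfun_eqI)
      fix x
      have "blinfun_apply Q x = blinfun_apply Q (p x + (x - p x))" by simp
      also have "\<dots> = p x + 0"
        unfolding blinfun.add_right using Q p by (simp add: ops_on_def)
      finally show "blinfun_apply Q x = blinfun_apply (Blinfun p) x" by (simp add: P)
    qed
  qed
qed

lemma
  assumes "closed_csubspace M"
  shows proj_in_ops_on: "proj M \<in> ops_on M"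
    and proj_apply: "x \<in> M \<Longrightarrow> blinfun_apply (proj M) x = x"
  using theI' [OF proj_exists_unique [OF assms]] by (auto simp: proj_def)

lemma proj_UNIV [simp]: "proj UNIV = id_blinfun"
  by (rule blinfun_eqI) (simp add: proj_apply closed_csubspace_def csubspace_def)

lemma riesz:
  fixes \<phi> :: "'a::complex_hilbert \<Rightarrow> complex"
  assumes add: "\<And>x y. \<phi> (x + y) = \<phi> x + \<phi> y" and sc: "\<And>c x. \<phi> (c *\<^sub>C x) = c * \<phi> x"
    and cont: "continuous_on UNIV \<phi>"
  shows "\<exists>w. \<forall>x. \<phi> x = cinner x w"
proof (cases "\<forall>x. \<phi> x = 0")
  case True
  then show ?thesis by (intro exI [of _ 0]) simp
next
  case False
  then obtain z where z: "\<phi> z \<noteq> 0" by blast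
  define M where "M = {x. \<phi> x = 0}"
  have \<phi>0: "\<phi> 0 = 0" using sc [of 0 0] by simp
  have diff: "\<phi> (x - y) = \<phi> x - \<phi> y" for x y
    using add [of "x - y" y] by simp
  have "closed M" unfolding M_def
    by (intro closed_Collect_eq cont continuous_on_const)
  moreover have "csubspace M" by (auto simp: M_def csubspace_def add sc \<phi>0)
  ultimately have "closed_csubspace M" by (simp add: closed_csubspace_def)
  then obtain y where y: "y \<in> M" "z - y \<in> ocomp M" using orth_decomp_exists by blast
  define u where "u = z - y"
  have \<phi>u: "\<phi> u \<noteq> 0" using z y by (simp add: u_def diff M_def)
  then have u0: "u \<noteq> 0" using \<phi>0 by auto
  define w where "w = cnj (\<phi> u / complex_of_real ((norm u)\<^sup>2)) *\<^sub>C u"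
  have "\<phi> x = cinner x w" for x
  proof -
    have "x - (\<phi> x / \<phi> u) *\<^sub>C u \<in> M" using \<phi>u by (simp add: M_def diff sc)
    then have "cinner u (x - (\<phi> x / \<phi> u) *\<^sub>C u) = 0"
      using y(2) by (auto simp: u_def ocomp_def)
    then have "cinner (x - (\<phi> x / \<phi> u) *\<^sub>C u) u = 0"
      by (subst cinner_commute) simp
    then have "cinner x u = \<phi> x / \<phi> u * complex_of_real ((norm u)\<^sup>2)"
      by (simp add: cinner_diff_left cinner_scaleC_left cinner_self)
    then show ?thesis using \<phi>u u0 by (simp add: w_def cinner_scaleC_right)
  qed
  then show ?thesis by blast
qed

lemma ops_on_scaleC: "A \<in> ops_on M \<Longrightarrow> blinfun_apply A (c *\<^sub>C x) = c *\<^sub>C blinfun_apply A x"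
  by (simp add: ops_on_def)

lemma ops_on_UNIV_iff:
  "A \<in> ops_on UNIV \<longleftrightarrow> (\<forall>c x. blinfun_apply A (c *\<^sub>C x) = c *\<^sub>C blinfun_apply A x)"
  by (simp add: ops_on_def blinfun.zero_right)

lemma continuous_on_cinner_left: "continuous_on S (\<lambda>x. cinner x y)" for y :: "'a::complex_hilbert"
proof -
  have "bounded_linear (\<lambda>x. cinner x y)"
    by (rule bounded_linear_intro [where K = "norm y"])
       (simp_all add: cinner_add_left cinner_scaleR_left scaleR_conv_of_real cinner_Cauchy_Schwarz)
  then show ?thesis by (rule linear_continuous_on)
qed

lemma adj_exists_unique:
  fixes A :: "'a::complex_hilbert \<Rightarrow>\<^sub>L 'a"
  assumes A: "A \<in> ops_on M"
  shows "\<exists>!B. \<forall>x y. cinner (blinfun_apply A x) y = cinner x (blinfun_apply B y)"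
proof -
  have "\<exists>w. \<forall>x. cinner (blinfun_apply A x) y = cinner x w" for y
  proof (rule riesz)
    show "continuous_on UNIV (\<lambda>x. cinner (blinfun_apply A x) y)"
      by (rule continuous_on_compose2 [OF continuous_on_cinner_left [of UNIV y]])
         (auto intro: linear_continuous_on blinfun.bounded_linear_right)
  qed (simp_all add: blinfun.add_right cinner_add_left ops_on_scaleC [OF A] cinner_scaleC_left)
  then obtain B where B: "\<And>x y. cinner (blinfun_apply A x) y = cinner x (B y)" by metis
  have B': "cinner (B y) x = cinner y (blinfun_apply A x)" for x y
    by (metis B cinner_commute)
  have add: "B (x + y) = B x + B y" for x y
    by (rule cinner_eqI) (simp add: B' cinner_add_left)
  have sc: "B (r *\<^sub>R x) = r *\<^sub>R B x" for r x
    by (rule cinner_eqI) (simp add: B' cinner_scaleR_left)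
  have nrm: "norm (B y) \<le> norm y * norm A" for y
  proof (cases "B y = 0")
    case False
    have "complex_of_real ((norm (B y))\<^sup>2) = cinner (blinfun_apply A (B y)) y"
      by (simp add: B cinner_self)
    then have "(norm (B y))\<^sup>2 = cmod (cinner (blinfun_apply A (B y)) y)"
      by (metis norm_of_real abs_of_nonneg zero_le_power2)
    also have "\<dots> \<le> norm (blinfun_apply A (B y)) * norm y" by (rule cinner_Cauchy_Schwarz)
    also have "\<dots> \<le> (norm A * norm (B y)) * norm y"
      by (intro mult_right_mono norm_blinfun) simp
    finally have "norm (B y) * norm (B y) \<le> norm (B y) * (norm y * norm A)"
      by (simp add: power2_eq_square mult_ac)
    then show ?thesis using False by simp
  qed simp
  have "bounded_linear B" by (rule bounded_linear_intro [OF add sc nrm])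
  then have "blinfun_apply (Blinfun B) = B" by (rule bounded_linear_Blinfun_apply)
  show ?thesis
  proof (rule ex1I)
    show "\<forall>x y. cinner (blinfun_apply A x) y = cinner x (blinfun_apply (Blinfun B) y)"
      by (simp add: \<open>blinfun_apply (Blinfun B) = B\<close> B)
    fix C assume C: "\<forall>x y. cinner (blinfun_apply A x) y = cinner x (blinfun_apply C y)"
    show "C = Blinfun B"
    proof (rule blinfun_eqI)
      fix y
      show "blinfun_apply C y = blinfun_apply (Blinfun B) y"
        unfolding \<open>blinfun_apply (Blinfun B) = B\<close>
        by (rule cinner_eqI) (metis B C cinner_commute)
    qed
  qed
qed

lemma cinner_adj: "A \<in> ops_on M \<Longrightarrow>
    cinner (blinfun_apply A x) y = cinner x (blinfun_apply (adj A) y)"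
  using theI' [OF adj_exists_unique] unfolding adj_def by blast

section \<open>C*-algebras of operators and their representations\<close>

definition cstar_subalgebra :: "('a::complex_hilbert \<Rightarrow>\<^sub>L 'a) set \<Rightarrow> bool" where
  "cstar_subalgebra S \<longleftrightarrow> S \<subseteq> ops_on UNIV \<and> closed S \<and> 0 \<in> S \<and>
     (\<forall>A\<in>S. \<forall>B\<in>S. A + B \<in> S \<and> A o\<^sub>L B \<in> S) \<and>
     (\<forall>A\<in>S. adj A \<in> S \<and> (\<forall>c. cscale c A \<in> S))"

definition unital_star_rep ::
  "('a::complex_hilbert \<Rightarrow>\<^sub>L 'a) set \<Rightarrow> 'k::complex_hilbert set \<Rightarrow> (('a \<Rightarrow>\<^sub>L 'a) \<Rightarrow> ('k \<Rightarrow>\<^sub>L 'k)) \<Rightarrow> bool"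
where
  "unital_star_rep \<A> M \<pi> \<longleftrightarrow> closed_csubspace M \<and>
     (\<forall>X\<in>\<A>. \<pi> X \<in> ops_on M) \<and>
     \<pi> id_blinfun = proj M \<and>
     (\<forall>X\<in>\<A>. \<forall>Y\<in>\<A>. \<pi> (X + Y) = \<pi> X + \<pi> Y) \<and>
     (\<forall>X\<in>\<A>. \<forall>Y\<in>\<A>. \<pi> (X o\<^sub>L Y) = \<pi> X o\<^sub>L \<pi> Y) \<and>
     (\<forall>X\<in>\<A>. \<forall>c. \<pi> (cscale c X) = cscale c (\<pi> X)) \<and>
     (\<forall>X\<in>\<A>. \<pi> (adj X) = adj (\<pi> X))"

definition restrict_rep ::
  "('x \<Rightarrow> ('k::complex_hilbert \<Rightarrow>\<^sub>L 'k)) \<Rightarrow> 'k set \<Rightarrow> ('x \<Rightarrow> ('k \<Rightarrow>\<^sub>L 'k))"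
where
  "restrict_rep \<pi> N X = \<pi> X o\<^sub>L proj N"

text \<open>Since \<open>\<A>\<close> is closed under adjoints, closed invariant subspaces are reducing.\<close>

definition subrep_space ::
  "'x set \<Rightarrow> 'k::complex_hilbert set \<Rightarrow> ('x \<Rightarrow> ('k \<Rightarrow>\<^sub>L 'k)) \<Rightarrow> 'k set \<Rightarrow> bool"
where
  "subrep_space \<A> M \<pi> N \<longleftrightarrow> closed_csubspace N \<and> N \<subseteq> M \<and>
     (\<forall>X\<in>\<A>. \<forall>x\<in>N. blinfun_apply (\<pi> X) x \<in> N)"

definition unitary_between ::
  "'k::complex_hilbert set \<Rightarrow> 'l::complex_hilbert set \<Rightarrow> ('k \<Rightarrow> 'l) \<Rightarrow> bool"
where
  "unitary_between M N U \<longleftrightarrow>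
     (\<forall>x\<in>M. \<forall>y\<in>M. U (x + y) = U x + U y) \<and> (\<forall>c. \<forall>x\<in>M. U (c *\<^sub>C x) = c *\<^sub>C U x) \<and>
     (\<forall>x\<in>M. \<forall>y\<in>M. cinner (U x) (U y) = cinner x y) \<and> U ` M = N"

definition unitarily_equivalent ::
  "'x set \<Rightarrow> 'k::complex_hilbert set \<Rightarrow> ('x \<Rightarrow> ('k \<Rightarrow>\<^sub>L 'k)) \<Rightarrow>
   'l::complex_hilbert set \<Rightarrow> ('x \<Rightarrow> ('l \<Rightarrow>\<^sub>L 'l)) \<Rightarrow> bool"
where
  "unitarily_equivalent \<A> M \<pi> N \<rho> \<longleftrightarrow> (\<exists>U. unitary_between M N U \<and>
     (\<forall>X\<in>\<A>. \<forall>x\<in>M. U (blinfun_apply (\<pi> X) x) = blinfun_apply (\<rho> X) (U x)))"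

definition disjoint_reps ::
  "'x set \<Rightarrow> 'k::complex_hilbert set \<Rightarrow> ('x \<Rightarrow> ('k \<Rightarrow>\<^sub>L 'k)) \<Rightarrow>
   'l::complex_hilbert set \<Rightarrow> ('x \<Rightarrow> ('l \<Rightarrow>\<^sub>L 'l)) \<Rightarrow> bool"
where
  "disjoint_reps \<A> M \<pi> N \<rho> \<longleftrightarrow> \<not> (\<exists>M' N'.
     subrep_space \<A> M \<pi> M' \<and> M' \<noteq> {0} \<and> subrep_space \<A> N \<rho> N' \<and> N' \<noteq> {0} \<and>
     unitarily_equivalent \<A> M' (restrict_rep \<pi> M') N' (restrict_rep \<rho> N'))"

definition is_direct_sum_rep ::
  "'x set \<Rightarrow> 'k::complex_hilbert set \<Rightarrow> ('x \<Rightarrow> ('k \<Rightarrow>\<^sub>L 'k)) \<Rightarrow>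
   'k set \<Rightarrow> ('x \<Rightarrow> ('k \<Rightarrow>\<^sub>L 'k)) \<Rightarrow> 'k set \<Rightarrow> ('x \<Rightarrow> ('k \<Rightarrow>\<^sub>L 'k)) \<Rightarrow> bool"
where
  "is_direct_sum_rep \<A> M \<pi> M\<^sub>0 \<pi>\<^sub>0 M\<^sub>1 \<pi>\<^sub>1 \<longleftrightarrow>
     (\<forall>x\<in>M\<^sub>0. \<forall>y\<in>M\<^sub>1. cinner x y = 0) \<and> M = {x + y | x y. x \<in> M\<^sub>0 \<and> y \<in> M\<^sub>1} \<and>
     (\<forall>X\<in>\<A>. \<pi> X = \<pi>\<^sub>0 X + \<pi>\<^sub>1 X)"

section \<open>Noncommutative power series and weighted creation operators\<close>

text \<open>
  The free semigroup on the generators \<open>g\<^sub>i\<close>, \<open>i :: 'n\<close>, is \<^typ>\<open>'n list\<close> with concatenation; so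
  \<open>n = CARD('n)\<close>, the identity is \<open>[]\<close> and \<open>g\<^sub>i \<alpha>\<close> is \<open>i # \<alpha>\<close>.
  A formal power series is its family of coefficients.
\<close>

type_synonym 'n fock = "('n list, complex) ell2"

lift_definition ket :: "'a \<Rightarrow> ('a, complex) ell2" is "\<lambda>\<alpha> \<beta>. if \<beta> = \<alpha> then 1 else 0"
proof -
  fix \<alpha> :: 'a
  have "(\<lambda>\<beta>. (norm (if \<beta> = \<alpha> then 1 else 0 :: complex))\<^sup>2) summable_on {\<alpha>}" by simp
  then show "(\<lambda>\<beta>. (norm (if \<beta> = \<alpha> then 1 else 0 :: complex))\<^sup>2) summable_on UNIV"
    by (rule summable_on_cong_neutral [THEN iffD1, rotated -1]) auto
qed

text \<open>The sum runs over all factorisations of a word.\<close>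

definition nc_mult :: "('n list \<Rightarrow> real) \<Rightarrow> ('n list \<Rightarrow> real) \<Rightarrow> 'n list \<Rightarrow> real" where
  "nc_mult f g \<gamma> = (\<Sum>k\<le>length \<gamma>. f (take k \<gamma>) * g (drop k \<gamma>))"

definition nc_one :: "'n list \<Rightarrow> real" where
  "nc_one \<gamma> = (if \<gamma> = [] then 1 else 0)"

definition nc_inverse :: "('n list \<Rightarrow> real) \<Rightarrow> 'n list \<Rightarrow> real" where
  "nc_inverse b = (THE a. nc_mult b a = nc_one \<and> nc_mult a b = nc_one)"

lemma nc_mult_assoc: "nc_mult (nc_mult f g) h = nc_mult f (nc_mult g h)"
proof
  fix \<gamma> :: "'a list"
  let ?n = "length \<gamma>"
  have "nc_mult (nc_mult f g) h \<gamma> =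
      (\<Sum>k\<le>?n. \<Sum>j\<le>k. f (take j \<gamma>) * g (drop j (take k \<gamma>)) * h (drop k \<gamma>))"
    unfolding nc_mult_def
  proof (rule sum.cong [OF refl])
    fix k assume "k \<in> {..?n}"
    then have l: "length (take k \<gamma>) = k" by simp
    have "take j (take k \<gamma>) = take j \<gamma>" if "j \<le> k" for j using that by (simp add: min_def)
    then show "(\<Sum>j\<le>length (take k \<gamma>). f (take j (take k \<gamma>)) * g (drop j (take k \<gamma>))) * h (drop k \<gamma>)
        = (\<Sum>j\<le>k. f (take j \<gamma>) * g (drop j (take k \<gamma>)) * h (drop k \<gamma>))"
      unfolding l sum_distrib_right by (intro sum.cong) auto
  qed
  also have "\<dots> = (\<Sum>j\<le>?n. \<Sum>k\<in>{j..?n}. f (take j \<gamma>) * g (drop j (take k \<gamma>)) * h (drop k \<gamma>))"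
    by (subst sum.Sigma, simp, simp, subst sum.Sigma, simp, simp)
       (rule sum.reindex_bij_witness [of _ "\<lambda>(j, k). (k, j)" "\<lambda>(k, j). (j, k)"], auto)
  also have "\<dots> = (\<Sum>j\<le>?n. \<Sum>k\<le>?n - j. f (take j \<gamma>) * g (take k (drop j \<gamma>)) * h (drop k (drop j \<gamma>)))"
  proof (rule sum.cong [OF refl])
    fix j assume "j \<in> {..?n}"
    then show "(\<Sum>k\<in>{j..?n}. f (take j \<gamma>) * g (drop j (take k \<gamma>)) * h (drop k \<gamma>))
        = (\<Sum>k\<le>?n - j. f (take j \<gamma>) * g (take k (drop j \<gamma>)) * h (drop k (drop j \<gamma>)))"
      by (intro sum.reindex_bij_witness [of _ "\<lambda>k. k + j" "\<lambda>k. k - j"]) (auto simp: drop_take)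
  qed
  also have "\<dots> = nc_mult f (nc_mult g h) \<gamma>"
    unfolding nc_mult_def by (simp add: sum_distrib_left mult.assoc)
  finally show "nc_mult (nc_mult f g) h \<gamma> = nc_mult f (nc_mult g h) \<gamma>" .
qed

lemma nc_mult_one: "nc_mult nc_one f = f" "nc_mult f nc_one = f"
proof -
  show "nc_mult nc_one f = f"
  proof
    fix \<gamma> :: "'a list"
    have "nc_mult nc_one f \<gamma> = (\<Sum>k\<in>{0}. nc_one (take k \<gamma>) * f (drop k \<gamma>))"
      unfolding nc_mult_def by (rule sum.mono_neutral_right) (auto simp: nc_one_def)
    then show "nc_mult nc_one f \<gamma> = f \<gamma>" by (simp add: nc_one_def)
  qed
  show "nc_mult f nc_one = f"
  proof
    fix \<gamma> :: "'a list"
    have "nc_mult f nc_one \<gamma> = (\<Sum>k\<in>{length \<gamma>}. f (take k \<gamma>) * nc_one (drop k \<gamma>))"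
      unfolding nc_mult_def by (rule sum.mono_neutral_right) (auto simp: nc_one_def)
    then show "nc_mult f nc_one \<gamma> = f \<gamma>" by (simp add: nc_one_def)
  qed
qed

fun nc_rinv :: "nat \<Rightarrow> ('n list \<Rightarrow> real) \<Rightarrow> 'n list \<Rightarrow> real" where
  "nc_rinv 0 b \<gamma> = nc_one \<gamma>"
| "nc_rinv (Suc m) b \<gamma> = (if length \<gamma> \<le> m then nc_rinv m b \<gamma>
     else - (\<Sum>k=1..length \<gamma>. b (take k \<gamma>) * nc_rinv m b (drop k \<gamma>)))"

lemma nc_rinv_stable: "length \<gamma> \<le> m \<Longrightarrow> nc_rinv m b \<gamma> = nc_rinv (length \<gamma>) b \<gamma>"
  by (induction m) (auto simp: le_Suc_eq)

lemma nc_right_inverse: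
  fixes b :: "'n list \<Rightarrow> real"
  assumes b: "b [] = 1"
  shows "\<exists>a. a [] = 1 \<and> nc_mult b a = nc_one"
proof -
  define a where "a \<gamma> = nc_rinv (length \<gamma>) b \<gamma>" for \<gamma>
  have "nc_mult b a \<gamma> = nc_one \<gamma>" for \<gamma>
  proof (cases \<gamma>)
    case Nil
    then show ?thesis by (simp add: nc_mult_def a_def b nc_one_def)
  next
    case (Cons i \<alpha>)
    have "a \<gamma> = - (\<Sum>k=1..length \<gamma>. b (take k \<gamma>) * nc_rinv (length \<alpha>) b (drop k \<gamma>))"
      by (simp add: a_def Cons)
    also have "\<dots> = - (\<Sum>k=1..length \<gamma>. b (take k \<gamma>) * a (drop k \<gamma>))"
    proof -
      have "nc_rinv (length \<alpha>) b (drop k \<gamma>) = a (drop k \<gamma>)" if "k \<in> {1..length \<gamma>}" for k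
        unfolding a_def by (rule nc_rinv_stable) (use that in \<open>auto simp: Cons\<close>)
      then show ?thesis by simp
    qed
    finally have "b [] * a \<gamma> + (\<Sum>k=1..length \<gamma>. b (take k \<gamma>) * a (drop k \<gamma>)) = 0"
      by (simp add: b)
    moreover have "nc_mult b a \<gamma> =
        b (take 0 \<gamma>) * a (drop 0 \<gamma>) + (\<Sum>k=1..length \<gamma>. b (take k \<gamma>) * a (drop k \<gamma>))"
      unfolding nc_mult_def atMost_atLeast0 by (subst sum.atLeast_Suc_atMost) auto
    ultimately show ?thesis by (simp add: nc_one_def Cons)
  qed
  moreover have "a [] = 1" by (simp add: a_def nc_one_def)
  ultimately show ?thesis by blast
qed

lemma nc_inverse_exists_unique:
  assumes b: "b [] = 1"
  shows "\<exists>!a. nc_mult b a = nc_one \<and> nc_mult a b = nc_one"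
proof -
  obtain a where a: "a [] = 1" "nc_mult b a = nc_one" using nc_right_inverse [of b] b by blast
  obtain c where c: "nc_mult a c = nc_one" using nc_right_inverse [of a] a by blast
  have "c = b" by (metis a(2) c nc_mult_assoc nc_mult_one)
  show ?thesis
  proof (rule ex1I)
    show "nc_mult b a = nc_one \<and> nc_mult a b = nc_one" using a c \<open>c = b\<close> by simp
    show "d = a" if "nc_mult b d = nc_one \<and> nc_mult d b = nc_one" for d
      by (metis a(2) nc_mult_assoc nc_mult_one that)
  qed
qed

lemma
  assumes "b [] = 1"
  shows nc_mult_inverse_right: "nc_mult b (nc_inverse b) = nc_one"
    and nc_mult_inverse_left: "nc_mult (nc_inverse b) b = nc_one"
  using theI' [OF nc_inverse_exists_unique [of b, OF assms]] unfolding nc_inverse_def by blast+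

definition word_op ::
  "'a::complex_hilbert set \<Rightarrow> ('n \<Rightarrow> ('a \<Rightarrow>\<^sub>L 'a)) \<Rightarrow> 'n list \<Rightarrow> ('a \<Rightarrow>\<^sub>L 'a)"
where
  "word_op M X \<alpha> = foldr (\<lambda>i A. X i o\<^sub>L A) \<alpha> (proj M)"

definition Delta_term ::
  "'a::complex_hilbert set \<Rightarrow> ('n list \<Rightarrow> real) \<Rightarrow> ('n \<Rightarrow> ('a \<Rightarrow>\<^sub>L 'a)) \<Rightarrow> nat \<Rightarrow> ('a \<Rightarrow>\<^sub>L 'a)"
where
  "Delta_term M a X k = (\<Sum>\<alpha> | length \<alpha> = k. a \<alpha> *\<^sub>R (word_op M X \<alpha> o\<^sub>L adj (word_op M X \<alpha>)))"

definition Delta ::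
  "'a::complex_hilbert set \<Rightarrow> ('n list \<Rightarrow> real) \<Rightarrow> ('n \<Rightarrow> ('a \<Rightarrow>\<^sub>L 'a)) \<Rightarrow> ('a \<Rightarrow>\<^sub>L 'a)"
where
  "Delta M a X = (\<Sum>k. Delta_term M a X k)"

text \<open>The unique bounded operator with the given values on the basis, see \<open>wcreation_exists_unique\<close>.\<close>

definition wcreation :: "('n list \<Rightarrow> real) \<Rightarrow> 'n \<Rightarrow> ('n fock \<Rightarrow>\<^sub>L 'n fock)" where
  "wcreation b i = (THE T. T \<in> ops_on UNIV \<and>
     (\<forall>\<alpha>. blinfun_apply T (ket \<alpha>) = sqrt (b \<alpha> / b (i # \<alpha>)) *\<^sub>R ket (i # \<alpha>)))"

lemma coord_ket: "coord (ket \<alpha>) \<beta> = (if \<beta> = \<alpha> then 1 else 0)"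
  by (simp add: ket.rep_eq)

lemma cinner_ket: "cinner (ket \<alpha>) f = cnj (coord f \<alpha>)"
proof -
  have "cinner (ket \<alpha>) f = (\<Sum>\<^sub>\<infinity>\<beta>\<in>{\<alpha>}. cinner (coord (ket \<alpha>) \<beta>) (coord f \<beta>))"
    unfolding cinner_ell2_def by (rule infsum_cong_neutral) (auto simp: coord_ket)
  then show ?thesis by (simp add: coord_ket cinner_complex_def)
qed

lemma ops_eqI_ket:
  fixes S T :: "('a, complex) ell2 \<Rightarrow>\<^sub>L ('a, complex) ell2"
  assumes S: "S \<in> ops_on M" and T: "T \<in> ops_on N"
    and eq: "\<And>\<alpha>. blinfun_apply S (ket \<alpha>) = blinfun_apply T (ket \<alpha>)"
  shows "S = T"
proof -
  have "coord (blinfun_apply (adj S) g) \<alpha> = coord (blinfun_apply (adj T) g) \<alpha>" for g \<alpha>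
    by (metis cinner_ket cinner_adj [OF S] cinner_adj [OF T] eq complex_cnj_cnj)
  then have "blinfun_apply (adj S) g = blinfun_apply (adj T) g" for g
    by (simp add: coord_inject [symmetric] fun_eq_iff)
  then have "cinner (blinfun_apply S f) g = cinner (blinfun_apply T f) g" for f g
    by (simp add: cinner_adj [OF S] cinner_adj [OF T])
  then have "blinfun_apply S f = blinfun_apply T f" for f by (rule cinner_eqI)
  then show ?thesis by (rule blinfun_eqI)
qed

definition wshift :: "('n list \<Rightarrow> real) \<Rightarrow> 'n \<Rightarrow> ('n list \<Rightarrow> complex) \<Rightarrow> 'n list \<Rightarrow> complex" where
  "wshift w i f \<gamma> = (case \<gamma> of [] \<Rightarrow> 0 | j # \<alpha> \<Rightarrow> if j = i then w \<alpha> *\<^sub>R f \<alpha> else 0)"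

lemma wshift_bound:
  fixes f :: "'n list \<Rightarrow> complex"
  assumes f: "(\<lambda>\<alpha>. (norm (f \<alpha>))\<^sup>2) summable_on UNIV" and w: "\<And>\<alpha>. \<bar>w \<alpha>\<bar> \<le> C"
  shows "(\<lambda>\<gamma>. (norm (wshift w i f \<gamma>))\<^sup>2) summable_on UNIV"
    "(\<Sum>\<^sub>\<infinity>\<gamma>. (norm (wshift w i f \<gamma>))\<^sup>2) \<le> C\<^sup>2 * (\<Sum>\<^sub>\<infinity>\<alpha>. (norm (f \<alpha>))\<^sup>2)"
proof -
  have le: "(w \<alpha>)\<^sup>2 * (norm (f \<alpha>))\<^sup>2 \<le> C\<^sup>2 * (norm (f \<alpha>))\<^sup>2" for \<alpha>
    using power_mono [OF w [of \<alpha>], of 2] by (intro mult_right_mono) auto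
  have sC: "(\<lambda>\<alpha>. C\<^sup>2 * (norm (f \<alpha>))\<^sup>2) summable_on UNIV"
    by (rule summable_on_cmult_right [OF f])
  have s: "(\<lambda>\<alpha>. (w \<alpha>)\<^sup>2 * (norm (f \<alpha>))\<^sup>2) summable_on UNIV"
    by (rule summable_on_comparison_test [OF sC le]) auto
  have eq: "(norm (wshift w i f (i # \<alpha>)))\<^sup>2 = (w \<alpha>)\<^sup>2 * (norm (f \<alpha>))\<^sup>2" for \<alpha>
    by (simp add: wshift_def power_mult_distrib)
  have inj: "inj (Cons i)" by simp
  have z: "(norm (wshift w i f \<gamma>))\<^sup>2 = 0" if "\<gamma> \<notin> range (Cons i)" for \<gamma>
    using that by (cases \<gamma>) (auto simp: wshift_def)
  have "((\<lambda>\<gamma>. (norm (wshift w i f \<gamma>))\<^sup>2) has_sum (\<Sum>\<^sub>\<infinity>\<alpha>. (w \<alpha>)\<^sup>2 * (norm (f \<alpha>))\<^sup>2)) (range (Cons i))"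
    unfolding has_sum_reindex [OF inj] o_def eq by (rule has_sum_infsum [OF s])
  then have *: "((\<lambda>\<gamma>. (norm (wshift w i f \<gamma>))\<^sup>2) has_sum (\<Sum>\<^sub>\<infinity>\<alpha>. (w \<alpha>)\<^sup>2 * (norm (f \<alpha>))\<^sup>2)) UNIV"
    by (rule has_sum_cong_neutral [THEN iffD1, rotated -1]) (use z in auto)
  then show "(\<lambda>\<gamma>. (norm (wshift w i f \<gamma>))\<^sup>2) summable_on UNIV"
    by (rule has_sum_imp_summable)
  have "(\<Sum>\<^sub>\<infinity>\<gamma>. (norm (wshift w i f \<gamma>))\<^sup>2) = (\<Sum>\<^sub>\<infinity>\<alpha>. (w \<alpha>)\<^sup>2 * (norm (f \<alpha>))\<^sup>2)"
    using * by (rule infsumI)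
  also have "\<dots> \<le> (\<Sum>\<^sub>\<infinity>\<alpha>. C\<^sup>2 * (norm (f \<alpha>))\<^sup>2)" by (intro infsum_mono s sC le)
  also have "\<dots> = C\<^sup>2 * (\<Sum>\<^sub>\<infinity>\<alpha>. (norm (f \<alpha>))\<^sup>2)" by (intro infsum_cmult_right f)
  finally show "(\<Sum>\<^sub>\<infinity>\<gamma>. (norm (wshift w i f \<gamma>))\<^sup>2) \<le> C\<^sup>2 * (\<Sum>\<^sub>\<infinity>\<alpha>. (norm (f \<alpha>))\<^sup>2)" .
qed

lemma wshift_exists_unique:
  assumes w: "\<And>\<alpha>. \<bar>w \<alpha>\<bar> \<le> C"
  shows "\<exists>!T. T \<in> ops_on UNIV \<and> (\<forall>\<alpha>. blinfun_apply T (ket \<alpha>) = w \<alpha> *\<^sub>R ket (i # \<alpha>))"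
proof -
  define T where "T f = Abs_ell2 (wshift w i (coord f))" for f
  have T: "coord (T f) = wshift w i (coord f)" for f
    unfolding T_def using wshift_bound(1) [where w = w and C = C, OF coord_summable w] by (simp add: Abs_ell2_inverse)
  have "0 \<le> C" using w [of "[]"] by linarith
  have add: "T (x + y) = T x + T y" for x y
    by (auto simp: coord_inject [symmetric] fun_eq_iff T plus_ell2.rep_eq wshift_def algebra_simps
        split: list.split)
  have scC: "T (c *\<^sub>C x) = c *\<^sub>C T x" for c x
    by (auto simp: coord_inject [symmetric] fun_eq_iff T scaleC_ell2.rep_eq wshift_def
        scaleC_complex_def split: list.split)
  have nrm: "norm (T x) \<le> norm x * C" for x
  proof -
    have "(norm (T x))\<^sup>2 \<le> C\<^sup>2 * (norm x)\<^sup>2"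
      unfolding power2_norm_eq_inner [of "T x"] power2_norm_eq_inner [of x] inner_self_ell2_eq T
      by (rule wshift_bound(2) [where w = w and C = C, OF coord_summable w])
    then have "(norm (T x))\<^sup>2 \<le> (norm x * C)\<^sup>2" by (simp add: power_mult_distrib mult.commute)
    then show ?thesis by (rule power2_le_imp_le) (simp add: \<open>0 \<le> C\<close>)
  qed
  have "bounded_linear T"
    by (rule bounded_linear_intro [OF add _ nrm]) (simp add: scC scaleC_of_real [symmetric])
  then have Tb: "blinfun_apply (Blinfun T) = T" by (rule bounded_linear_Blinfun_apply)
  show ?thesis
  proof (rule ex1I)
    show "Blinfun T \<in> ops_on UNIV \<and>
        (\<forall>\<alpha>. blinfun_apply (Blinfun T) (ket \<alpha>) = w \<alpha> *\<^sub>R ket (i # \<alpha>))"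
      by (auto simp: ops_on_UNIV_iff Tb scC coord_inject [symmetric] fun_eq_iff T wshift_def
          coord_ket scaleR_ell2.rep_eq split: list.split)
    then show "S = Blinfun T" if "S \<in> ops_on UNIV \<and>
        (\<forall>\<alpha>. blinfun_apply S (ket \<alpha>) = w \<alpha> *\<^sub>R ket (i # \<alpha>))" for S
      using that by (intro ops_eqI_ket [of S UNIV _ UNIV]) auto
  qed
qed

lemma wcreation_exists_unique:
  assumes pos: "\<And>\<alpha>. b \<alpha> > 0" and bdd: "bdd_above (range (\<lambda>\<alpha>. b \<alpha> / b (i # \<alpha>)))"
  shows "\<exists>!T. T \<in> ops_on UNIV \<and>
    (\<forall>\<alpha>. blinfun_apply T (ket \<alpha>) = sqrt (b \<alpha> / b (i # \<alpha>)) *\<^sub>R ket (i # \<alpha>))"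
proof -
  obtain C where "\<And>\<alpha>. b \<alpha> / b (i # \<alpha>) \<le> C" using bdd by (auto simp: bdd_above_def)
  then have "\<bar>sqrt (b \<alpha> / b (i # \<alpha>))\<bar> \<le> sqrt C" for \<alpha>
    using pos [of \<alpha>] pos [of "i # \<alpha>"] by (simp add: less_imp_le)
  then show ?thesis by (rule wshift_exists_unique)
qed

lemma
  assumes "\<And>\<alpha>. b \<alpha> > 0" "bdd_above (range (\<lambda>\<alpha>. b \<alpha> / b (i # \<alpha>)))"
  shows wcreation_in_ops_on: "wcreation b i \<in> ops_on UNIV"
    and wcreation_ket:
      "blinfun_apply (wcreation b i) (ket \<alpha>) = sqrt (b \<alpha> / b (i # \<alpha>)) *\<^sub>R ket (i # \<alpha>)"
  using theI' [OF wcreation_exists_unique [OF assms]] unfolding wcreation_def by blast+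

text \<open>
  A definition cannot quantify over all Hilbert spaces, so the coefficient form of the condition
  is used.  \<open>convergent_on_small_tuples\<close> gives convergence in norm on small row tuples over
  every Hilbert space, with a radius that depends on the coefficients only, and
  \<open>free_holomorphic_near_0_fock\<close> the converse (it is enough to test on the full Fock space).
\<close>

definition free_holomorphic_near_0 :: "('n::finite list \<Rightarrow> complex) \<Rightarrow> bool" where
  "free_holomorphic_near_0 c \<longleftrightarrow>
     limsup (\<lambda>k. ereal (root (2 * k) (\<Sum>\<alpha> | length \<alpha> = k. (cmod (c \<alpha>))\<^sup>2))) < \<infinity>"

lemma cscale_apply [simp]: "blinfun_apply (cscale c A) x = c *\<^sub>C blinfun_apply A x"
  by (simp add: cscale.rep_eq)

lemma finite_words: "finite {\<alpha> :: 'n::finite list. length \<alpha> = k}"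
  using finite_lists_length_eq [of "UNIV :: 'n set" k] by simp

lemma sum_words_Suc:
  fixes f :: "'n::finite list \<Rightarrow> 'b::comm_monoid_add"
  shows "(\<Sum>\<alpha> | length \<alpha> = Suc k. f \<alpha>) = (\<Sum>i\<in>UNIV. \<Sum>\<alpha> | length \<alpha> = k. f (i # \<alpha>))"
proof -
  have "(\<Sum>i\<in>UNIV. \<Sum>\<alpha> | length \<alpha> = k. f (i # \<alpha>))
      = (\<Sum>(i, \<alpha>)\<in>UNIV \<times> {\<alpha>. length \<alpha> = k}. f (i # \<alpha>))"
    by (simp add: sum.cartesian_product)
  also have "\<dots> = (\<Sum>\<alpha> | length \<alpha> = Suc k. f \<alpha>)"
    by (rule sum.reindex_bij_witness [of _ "\<lambda>\<alpha>. (hd \<alpha>, tl \<alpha>)" "\<lambda>(i, \<alpha>). i # \<alpha>"])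
       (auto simp: length_Suc_conv)
  finally show ?thesis by simp
qed

lemma row_bound:
  fixes X :: "'n::finite \<Rightarrow> ('h::complex_hilbert \<Rightarrow>\<^sub>L 'h)"
  assumes X: "\<And>i. X i \<in> ops_on UNIV" and "0 \<le> \<rho>"
    and \<rho>: "sqrt (norm (\<Sum>i\<in>UNIV. X i o\<^sub>L adj (X i))) \<le> \<rho>"
  shows "(norm (\<Sum>i\<in>UNIV. blinfun_apply (X i) (y i)))\<^sup>2 \<le> \<rho>\<^sup>2 * (\<Sum>i\<in>UNIV. (norm (y i))\<^sup>2)"
proof -
  define T where "T = (\<Sum>i\<in>UNIV. X i o\<^sub>L adj (X i))"
  have T: "norm T \<le> \<rho>\<^sup>2"
    using power_mono [OF \<rho>, of 2] by (simp add: T_def)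
  define v where "v = (\<Sum>i\<in>UNIV. blinfun_apply (X i) (y i))"
  define w where "w i = blinfun_apply (adj (X i)) v" for i
  have iw: "inner (blinfun_apply (X i) z) v = inner z (w i)" for i z
    using cinner_adj [OF X [of i], of z v] by (metis Re_cinner w_def)
  have "(\<Sum>i\<in>UNIV. (norm (w i))\<^sup>2) = inner (blinfun_apply T v) v"
    unfolding T_def blinfun.sum_left inner_sum_left blinfun_apply_blinfun_compose w_def [symmetric] iw
      power2_norm_eq_inner ..
  also have "\<dots> \<le> norm (blinfun_apply T v) * norm v" by (rule norm_cauchy_schwarz)
  also have "\<dots> \<le> (\<rho>\<^sup>2 * norm v) * norm v"
    by (intro mult_right_mono order_trans [OF norm_blinfun] T) simp_all
  finally have sw: "(\<Sum>i\<in>UNIV. (norm (w i))\<^sup>2) \<le> \<rho>\<^sup>2 * (norm v)\<^sup>2"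
    by (simp add: power2_eq_square mult_ac)
  have "(norm v)\<^sup>2 = (\<Sum>i\<in>UNIV. inner (y i) (w i))"
    unfolding power2_norm_eq_inner by (subst v_def) (simp add: inner_sum_left iw)
  also have "\<dots> \<le> (\<Sum>i\<in>UNIV. norm (y i) * norm (w i))"
    by (intro sum_mono norm_cauchy_schwarz)
  finally have "((norm v)\<^sup>2)\<^sup>2 \<le> (\<Sum>i\<in>UNIV. norm (y i) * norm (w i))\<^sup>2"
    by (intro power_mono) auto
  also have "\<dots> \<le> (\<Sum>i\<in>UNIV. (norm (y i))\<^sup>2) * (\<Sum>i\<in>UNIV. (norm (w i))\<^sup>2)"
    by (rule Cauchy_Schwarz_ineq_sum)
  also have "\<dots> \<le> (\<Sum>i\<in>UNIV. (norm (y i))\<^sup>2) * (\<rho>\<^sup>2 * (norm v)\<^sup>2)"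
    by (intro mult_left_mono sw sum_nonneg) auto
  finally have "(norm v)\<^sup>2 * (norm v)\<^sup>2 \<le> (norm v)\<^sup>2 * (\<rho>\<^sup>2 * (\<Sum>i\<in>UNIV. (norm (y i))\<^sup>2))"
    by (simp add: power2_eq_square mult_ac)
  then have "(norm v)\<^sup>2 \<le> \<rho>\<^sup>2 * (\<Sum>i\<in>UNIV. (norm (y i))\<^sup>2)"
  proof (cases "v = 0")
    case True
    then show ?thesis by (simp add: sum_nonneg)
  next
    case False
    then have "0 < (norm v)\<^sup>2" by simp
    with \<open>_ \<le> (norm v)\<^sup>2 * _\<close> show ?thesis by (simp only: mult_le_cancel_left_pos)
  qed
  then show ?thesis by (simp only: v_def)
qed

lemma word_op_Cons: "word_op M X (i # \<alpha>) = X i o\<^sub>L word_op M X \<alpha>"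
  by (simp add: word_op_def)

lemma word_sum_bound:
  fixes X :: "'n::finite \<Rightarrow> ('h::complex_hilbert \<Rightarrow>\<^sub>L 'h)"
  assumes X: "\<And>i. X i \<in> ops_on UNIV" and "0 \<le> \<rho>"
    and \<rho>: "sqrt (norm (\<Sum>i\<in>UNIV. X i o\<^sub>L adj (X i))) \<le> \<rho>"
  shows "(norm (\<Sum>\<alpha> | length \<alpha> = k. c \<alpha> *\<^sub>C blinfun_apply (word_op UNIV X \<alpha>) y))\<^sup>2
    \<le> (\<rho> ^ k)\<^sup>2 * (\<Sum>\<alpha> | length \<alpha> = k. (cmod (c \<alpha>))\<^sup>2) * (norm y)\<^sup>2"
proof (induction k arbitrary: c)
  case 0
  then show ?case by (simp add: word_op_def power_mult_distrib)
next
  case (Suc k)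
  let ?S = "\<lambda>i. \<Sum>\<alpha> | length \<alpha> = k. c (i # \<alpha>) *\<^sub>C blinfun_apply (word_op UNIV X \<alpha>) y"
  have "(\<Sum>\<alpha> | length \<alpha> = Suc k. c \<alpha> *\<^sub>C blinfun_apply (word_op UNIV X \<alpha>) y)
      = (\<Sum>i\<in>UNIV. blinfun_apply (X i) (?S i))"
    by (simp add: sum_words_Suc word_op_Cons blinfun.sum_right ops_on_scaleC [OF X])
  then have "(norm (\<Sum>\<alpha> | length \<alpha> = Suc k. c \<alpha> *\<^sub>C blinfun_apply (word_op UNIV X \<alpha>) y))\<^sup>2
      \<le> \<rho>\<^sup>2 * (\<Sum>i\<in>UNIV. (norm (?S i))\<^sup>2)"
    using row_bound [OF X \<open>0 \<le> \<rho>\<close> \<rho>, of ?S] by simp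
  also have "\<dots> \<le> \<rho>\<^sup>2 * (\<Sum>i\<in>UNIV. (\<rho> ^ k)\<^sup>2 * (\<Sum>\<alpha> | length \<alpha> = k. (cmod (c (i # \<alpha>)))\<^sup>2) * (norm y)\<^sup>2)"
    by (intro mult_left_mono sum_mono Suc.IH) simp
  also have "\<dots> = (\<rho> ^ Suc k)\<^sup>2 * (\<Sum>\<alpha> | length \<alpha> = Suc k. (cmod (c \<alpha>))\<^sup>2) * (norm y)\<^sup>2"
    by (simp add: sum_words_Suc sum_distrib_left sum_distrib_right power_mult_distrib mult_ac)
  finally show ?case .
qed

lemma convergent_on_small_tuples:
  fixes c :: "'n::finite list \<Rightarrow> complex" and X :: "'n \<Rightarrow> ('h::complex_hilbert \<Rightarrow>\<^sub>L 'h)"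
  assumes lim: "limsup (\<lambda>k. ereal (root (2 * k) (\<Sum>\<alpha> | length \<alpha> = k. (cmod (c \<alpha>))\<^sup>2))) < ereal R"
    and \<rho>: "0 \<le> \<rho>" "\<rho> * R < 1"
    and X: "\<And>i. X i \<in> ops_on UNIV" "sqrt (norm (\<Sum>i\<in>UNIV. X i o\<^sub>L adj (X i))) \<le> \<rho>"
  shows "summable (\<lambda>k. \<Sum>\<alpha> | length \<alpha> = k. cscale (c \<alpha>) (word_op UNIV X \<alpha>))"
proof (rule summable_comparison_test_ev)
  let ?s = "\<lambda>k. \<Sum>\<alpha> | length \<alpha> = k. (cmod (c \<alpha>))\<^sup>2"
  have s0: "0 \<le> ?s k" for k by (intro sum_nonneg) auto
  have "eventually (\<lambda>k. ereal (root (2 * k) (?s k)) < ereal R) sequentially"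
    using lim by (rule Limsup_lessD)
  from eventually_conj [OF this eventually_gt_at_top [of 0]]
  have ev: "eventually (\<lambda>k. root (2 * k) (?s k) < R \<and> 0 < k) sequentially"
    by (simp only: ereal_less_eq less_ereal.simps)
  have bnd: "norm (\<Sum>\<alpha> | length \<alpha> = k. cscale (c \<alpha>) (word_op UNIV X \<alpha>)) \<le> (\<rho> * \<bar>R\<bar>) ^ k"
    if k: "root (2 * k) (?s k) < R" "0 < k" for k
  proof (rule norm_blinfun_bound)
    show "0 \<le> (\<rho> * \<bar>R\<bar>) ^ k" using \<rho> by simp
    have "0 \<le> root (2 * k) (?s k)" using s0 by (rule real_root_ge_zero)
    then have R: "0 < R" using k by linarith
    have "?s k = root (2 * k) (?s k) ^ (2 * k)" using k s0 by (simp add: real_root_pow_pos2)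
    also have "\<dots> \<le> R ^ (2 * k)"
      using k real_root_ge_zero [OF s0] by (intro power_mono) auto
    finally have sk: "?s k \<le> (R ^ k)\<^sup>2" by (simp only: power_even_eq)
    fix y
    have "(norm (\<Sum>\<alpha> | length \<alpha> = k. c \<alpha> *\<^sub>C blinfun_apply (word_op UNIV X \<alpha>) y))\<^sup>2
        \<le> (\<rho> ^ k)\<^sup>2 * ?s k * (norm y)\<^sup>2"
      by (rule word_sum_bound [OF X(1) \<rho>(1) X(2)])
    also have "\<dots> \<le> (\<rho> ^ k)\<^sup>2 * (R ^ k)\<^sup>2 * (norm y)\<^sup>2"
      by (intro mult_right_mono mult_left_mono sk) auto
    also have "\<dots> = ((\<rho> * \<bar>R\<bar>) ^ k * norm y)\<^sup>2"
      using R by (simp only: power_mult_distrib abs_of_pos)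
    finally have "norm (\<Sum>\<alpha> | length \<alpha> = k. c \<alpha> *\<^sub>C blinfun_apply (word_op UNIV X \<alpha>) y)
        \<le> (\<rho> * \<bar>R\<bar>) ^ k * norm y"
      by (rule power2_le_imp_le) (simp add: \<rho>)
    then show "norm (blinfun_apply (\<Sum>\<alpha> | length \<alpha> = k. cscale (c \<alpha>) (word_op UNIV X \<alpha>)) y)
        \<le> (\<rho> * \<bar>R\<bar>) ^ k * norm y"
      by (simp add: blinfun.sum_left)
  qed
  show "eventually (\<lambda>k. norm (\<Sum>\<alpha> | length \<alpha> = k. cscale (c \<alpha>) (word_op UNIV X \<alpha>))
      \<le> (\<rho> * \<bar>R\<bar>) ^ k) sequentially"
    by (rule eventually_mono [OF ev]) (rule bnd; simp)
  have "0 \<le> R"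
  proof -
    obtain k where "root (2 * k) (?s k) < R"
      using eventually_happens [OF ev] by auto
    moreover have "0 \<le> root (2 * k) (?s k)" using s0 by (rule real_root_ge_zero)
    ultimately show ?thesis by linarith
  qed
  then show "summable (\<lambda>k. (\<rho> * \<bar>R\<bar>) ^ k)"
    using \<rho> by (intro summable_geometric) simp
qed

lemma norm_ell2_sum_ket:
  "finite F \<Longrightarrow> (norm (\<Sum>\<alpha>\<in>F. c \<alpha> *\<^sub>C ket \<alpha>))\<^sup>2 = (\<Sum>\<alpha>\<in>F. (cmod (c \<alpha>))\<^sup>2)"
proof -
  assume F: "finite F"
  let ?v = "\<Sum>\<alpha>\<in>F. c \<alpha> *\<^sub>C ket \<alpha>"
  have "coord (\<Sum>\<alpha>\<in>F. c \<alpha> *\<^sub>C ket \<alpha>) \<beta> = (if \<beta> \<in> F then c \<beta> else 0)" for \<beta>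
    using F by (induction F rule: finite_induct)
      (auto simp: zero_ell2.rep_eq plus_ell2.rep_eq scaleC_ell2.rep_eq coord_ket scaleC_complex_def)
  then have "(norm ?v)\<^sup>2 = (\<Sum>\<^sub>\<infinity>\<beta>. (norm (if \<beta> \<in> F then c \<beta> else 0))\<^sup>2)"
    unfolding power2_norm_eq_inner [of ?v] inner_self_ell2_eq by simp
  also have "\<dots> = (\<Sum>\<^sub>\<infinity>\<beta>\<in>F. (cmod (c \<beta>))\<^sup>2)"
    by (rule infsum_cong_neutral) auto
  finally show ?thesis using F by simp
qed

lemma shift_row_norm:
  fixes S :: "'n::finite \<Rightarrow> ('n fock \<Rightarrow>\<^sub>L 'n fock)"
  defines "S \<equiv> wcreation (\<lambda>_. 1)"
  shows "norm (\<Sum>i\<in>UNIV. S i o\<^sub>L adj (S i)) \<le> 1"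
proof (rule norm_blinfun_bound)
  have S: "S i \<in> ops_on UNIV" "blinfun_apply (S i) (ket \<alpha>) = ket (i # \<alpha>)" for i \<alpha>
    unfolding S_def by (auto intro!: wcreation_in_ops_on simp: wcreation_ket)
  have a: "coord (blinfun_apply (adj (S i)) f) \<alpha> = coord f (i # \<alpha>)" for i f \<alpha>
    by (metis S cinner_adj cinner_ket complex_cnj_cnj)
  have ak: "blinfun_apply (adj (S i)) (ket \<gamma>) =
      (case \<gamma> of [] \<Rightarrow> 0 | j # \<alpha> \<Rightarrow> if i = j then ket \<alpha> else 0)" for i \<gamma>
    by (auto simp: coord_inject [symmetric] fun_eq_iff a coord_ket zero_ell2.rep_eq split: list.split)
  have cS: "coord (blinfun_apply (S i) f) \<gamma> = cinner (blinfun_apply (S i) f) (ket \<gamma>)" for i f \<gamma>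
    by (metis cinner_commute cinner_ket complex_cnj_cnj)
  fix x :: "'n fock"
  let ?T = "\<Sum>i\<in>UNIV. S i o\<^sub>L adj (S i)"
  have csum: "coord (\<Sum>i\<in>A. f i) \<gamma> = (\<Sum>i\<in>A. coord (f i) \<gamma>)"
    for A and f :: "'n \<Rightarrow> 'n fock" and \<gamma>
    by (induction A rule: infinite_finite_induct) (auto simp: zero_ell2.rep_eq plus_ell2.rep_eq)
  have "cmod (coord (blinfun_apply ?T x) \<gamma>) \<le> cmod (coord x \<gamma>)" for \<gamma>
  proof -
    have "coord (blinfun_apply ?T x) \<gamma>
        = (\<Sum>i\<in>UNIV. cinner (blinfun_apply (adj (S i)) x) (blinfun_apply (adj (S i)) (ket \<gamma>)))"
      by (simp add: blinfun.sum_left csum cS cinner_adj [OF S(1)])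
    also have "\<dots> = (case \<gamma> of [] \<Rightarrow> 0 | j # \<alpha> \<Rightarrow>
        (\<Sum>i\<in>UNIV. if i = j then cinner (blinfun_apply (adj (S i)) x) (ket \<alpha>) else 0))"
    proof (cases \<gamma>)
      case (Cons j \<alpha>)
      have "cinner (blinfun_apply (adj (S i)) x) (blinfun_apply (adj (S i)) (ket \<gamma>))
          = (if i = j then cinner (blinfun_apply (adj (S i)) x) (ket \<alpha>) else 0)" for i
        by (simp add: ak Cons)
      then show ?thesis by (simp add: Cons)
    qed (simp add: ak)
    also have "\<dots> = (case \<gamma> of [] \<Rightarrow> 0 | j # \<alpha> \<Rightarrow> coord x \<gamma>)"
      by (auto simp: a cinner_commute [of _ "ket _"] cinner_ket split: list.split)
    finally show ?thesis by (auto split: list.split)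
  qed
  then have "(\<Sum>\<^sub>\<infinity>\<gamma>. (norm (coord (blinfun_apply ?T x) \<gamma>))\<^sup>2) \<le> (\<Sum>\<^sub>\<infinity>\<gamma>. (norm (coord x \<gamma>))\<^sup>2)"
    by (intro infsum_mono coord_summable power_mono) auto
  then have "(norm (blinfun_apply ?T x))\<^sup>2 \<le> (norm x)\<^sup>2"
    by (simp only: power2_norm_eq_inner inner_self_ell2_eq)
  then show "norm (blinfun_apply ?T x) \<le> 1 * norm x" by (auto intro: power2_le_imp_le)
qed simp

lemma free_holomorphic_near_0_fock:
  fixes c :: "'n::finite list \<Rightarrow> complex"
  assumes "0 < \<rho>"
    and conv: "\<And>X :: 'n \<Rightarrow> ('n fock \<Rightarrow>\<^sub>L 'n fock). (\<And>i. X i \<in> ops_on UNIV) \<Longrightarrow>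
      sqrt (norm (\<Sum>i\<in>UNIV. X i o\<^sub>L adj (X i))) \<le> \<rho> \<Longrightarrow>
      summable (\<lambda>k. \<Sum>\<alpha> | length \<alpha> = k. cscale (c \<alpha>) (word_op UNIV X \<alpha>))"
  shows "free_holomorphic_near_0 c"
proof -
  let ?s = "\<lambda>k. \<Sum>\<alpha> | length \<alpha> = k. (cmod (c \<alpha>))\<^sup>2"
  define S :: "'n \<Rightarrow> ('n fock \<Rightarrow>\<^sub>L 'n fock)" where "S = wcreation (\<lambda>_. 1)"
  define X where "X i = \<rho> *\<^sub>R S i" for i
  have S: "S i \<in> ops_on UNIV" "blinfun_apply (S i) (ket \<alpha>) = ket (i # \<alpha>)" for i \<alpha>
    unfolding S_def by (auto intro!: wcreation_in_ops_on simp: wcreation_ket)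
  have X: "X i \<in> ops_on UNIV" for i
    using S(1) by (simp add: X_def ops_on_UNIV_iff blinfun.scaleR_left scaleC_scaleR)
  have adjX: "adj (X i) = \<rho> *\<^sub>R adj (S i)" for i
  proof -
    have "blinfun_apply (adj (X i)) y = blinfun_apply (\<rho> *\<^sub>R adj (S i)) y" for y
    proof (rule cinner_eqI)
      fix x
      have "cinner x (blinfun_apply (adj (X i)) y) = cinner (blinfun_apply (X i) x) y"
        by (rule cinner_adj [OF X, symmetric])
      also have "\<dots> = cinner x (blinfun_apply (\<rho> *\<^sub>R adj (S i)) y)"
        by (simp add: X_def blinfun.scaleR_left cinner_adj [OF S(1)]
            scaleC_of_real [symmetric] cinner_scaleC_left cinner_scaleC_right)
      finally show "cinner (blinfun_apply (adj (X i)) y) x = cinner (blinfun_apply (\<rho> *\<^sub>R adj (S i)) y) x"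
        by (metis cinner_commute)
    qed
    then show ?thesis by (rule blinfun_eqI)
  qed
  have "(\<Sum>i\<in>UNIV. X i o\<^sub>L adj (X i)) = \<rho>\<^sup>2 *\<^sub>R (\<Sum>i\<in>UNIV. S i o\<^sub>L adj (S i))"
    unfolding adjX scaleR_sum_right
    by (intro sum.cong refl blinfun_eqI)
       (simp add: X_def blinfun.scaleR_left blinfun.scaleR_right power2_eq_square)
  then have "norm (\<Sum>i\<in>UNIV. X i o\<^sub>L adj (X i)) \<le> \<rho>\<^sup>2 * 1"
    using mult_left_mono [OF shift_row_norm, of "\<rho>\<^sup>2"] by (simp add: S_def)
  then have "sqrt (norm (\<Sum>i\<in>UNIV. X i o\<^sub>L adj (X i))) \<le> \<rho>"
    using \<open>0 < \<rho>\<close> by (simp add: real_le_lsqrt)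
  from summable_LIMSEQ_zero [OF conv [OF X this]]
  have "Bseq (\<lambda>k. \<Sum>\<alpha> | length \<alpha> = k. cscale (c \<alpha>) (word_op UNIV X \<alpha>))"
    by (intro convergent_imp_Bseq convergentI)
  then obtain C where C: "0 < C"
    "\<And>k. norm (\<Sum>\<alpha> | length \<alpha> = k. cscale (c \<alpha>) (word_op UNIV X \<alpha>)) \<le> C"
    unfolding Bseq_def by blast
  have wk: "blinfun_apply (word_op UNIV X \<alpha>) (ket []) = \<rho> ^ length \<alpha> *\<^sub>R ket \<alpha>" for \<alpha>
    by (induction \<alpha>) (auto simp: word_op_def X_def blinfun.scaleR_left blinfun.scaleR_right S)
  have n1: "norm (ket [] :: 'n fock) = 1"
  proof (rule power2_eq_imp_eq)
    show "(norm (ket [] :: 'n fock))\<^sup>2 = 1\<^sup>2"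
      using norm_ell2_sum_ket [of "{[] :: 'n list}" "\<lambda>_. 1"] by simp
  qed simp_all
  have sk: "?s k \<le> C\<^sup>2 / \<rho> ^ (2 * k)" for k
  proof -
    have "\<rho> ^ k *\<^sub>R (\<Sum>\<alpha> | length \<alpha> = k. c \<alpha> *\<^sub>C ket \<alpha>) =
        blinfun_apply (\<Sum>\<alpha> | length \<alpha> = k. cscale (c \<alpha>) (word_op UNIV X \<alpha>)) (ket [])"
      unfolding blinfun.sum_left scaleR_sum_right
      by (rule sum.cong) (simp_all add: wk scaleC_scaleR)
    then have "norm (\<rho> ^ k *\<^sub>R (\<Sum>\<alpha> | length \<alpha> = k. c \<alpha> *\<^sub>C ket \<alpha>)) \<le>
        norm (\<Sum>\<alpha> | length \<alpha> = k. cscale (c \<alpha>) (word_op UNIV X \<alpha>)) * norm (ket [] :: 'n fock)"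
      by (simp only: norm_blinfun)
    then have "norm (\<rho> ^ k *\<^sub>R (\<Sum>\<alpha> | length \<alpha> = k. c \<alpha> *\<^sub>C ket \<alpha>)) \<le> C"
      unfolding n1 mult_1_right using C(2) by (rule order_trans)
    moreover have "norm (\<rho> ^ k *\<^sub>R (\<Sum>\<alpha> | length \<alpha> = k. c \<alpha> *\<^sub>C ket \<alpha>))
        = \<rho> ^ k * norm (\<Sum>\<alpha> | length \<alpha> = k. c \<alpha> *\<^sub>C ket \<alpha>)"
      unfolding norm_scaleR using \<open>0 < \<rho>\<close> by simp
    ultimately have "\<rho> ^ k * norm (\<Sum>\<alpha> | length \<alpha> = k. c \<alpha> *\<^sub>C ket \<alpha>) \<le> C"
      by (simp only:)
    then have "(\<rho> ^ k * norm (\<Sum>\<alpha> | length \<alpha> = k. c \<alpha> *\<^sub>C ket \<alpha>))\<^sup>2 \<le> C\<^sup>2"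
      using \<open>0 < \<rho>\<close> by (intro power_mono) auto
    then have "\<rho> ^ (2 * k) * ?s k \<le> C\<^sup>2"
      by (simp only: power_mult_distrib norm_ell2_sum_ket [OF finite_words] power_even_eq)
    then show ?thesis
      using \<open>0 < \<rho>\<close> by (subst pos_le_divide_eq) (simp_all add: mult.commute)
  qed
  define D where "D = max 1 (C\<^sup>2)"
  have "root (2 * k) (?s k) \<le> D / \<rho>" if "0 < k" for k
  proof -
    have "?s k \<le> D ^ (2 * k) / \<rho> ^ (2 * k)"
    proof -
      have "C\<^sup>2 \<le> D ^ 1" by (simp add: D_def)
      also have "\<dots> \<le> D ^ (2 * k)" using that by (intro power_increasing) (auto simp: D_def)
      finally have "C\<^sup>2 / \<rho> ^ (2 * k) \<le> D ^ (2 * k) / \<rho> ^ (2 * k)"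
        using \<open>0 < \<rho>\<close> by (intro divide_right_mono) auto
      then show ?thesis using sk [of k] by linarith
    qed
    then have "root (2 * k) (?s k) \<le> root (2 * k) ((D / \<rho>) ^ (2 * k))"
      using that by (intro real_root_le_mono) (simp_all add: power_divide)
    also have "\<dots> = D / \<rho>" using that \<open>0 < \<rho>\<close> by (intro real_root_power_cancel) (auto simp: D_def)
    finally show ?thesis .
  qed
  then have "eventually (\<lambda>k. ereal (root (2 * k) (?s k)) \<le> ereal (D / \<rho>)) sequentially"
    by (intro eventually_mono [OF eventually_gt_at_top [of 0]]) (simp only: ereal_less_eq)
  then have "limsup (\<lambda>k. ereal (root (2 * k) (?s k))) \<le> ereal (D / \<rho>)" by (rule Limsup_bounded)
  then show ?thesis unfolding free_holomorphic_near_0_def by (rule le_less_trans) simp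
qed

definition admissible :: "('n::finite list \<Rightarrow> real) \<Rightarrow> bool" where
  "admissible b \<longleftrightarrow>
     b [] = 1 \<and> (\<forall>\<alpha>. b \<alpha> > 0) \<and> (\<forall>i. bdd_above (range (\<lambda>\<alpha>. b \<alpha> / b (i # \<alpha>)))) \<and>
     free_holomorphic_near_0 (\<lambda>\<alpha>. complex_of_real (b \<alpha>)) \<and>
     bdd_above (range (\<lambda>k. norm (\<Sum>p\<le>k. Delta_term UNIV (nc_inverse b) (wcreation b) p)))"

definition cstar_W :: "('n list \<Rightarrow> real) \<Rightarrow> ('n fock \<Rightarrow>\<^sub>L 'n fock) set" where
  "cstar_W b = cstar_subalgebra hull (insert id_blinfun (range (wcreation b)))"

section \<open>The Wold decomposition of a representation\<close>

definition rep_defect ::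
  "('n list \<Rightarrow> real) \<Rightarrow> (('n fock \<Rightarrow>\<^sub>L 'n fock) \<Rightarrow> ('k::complex_hilbert \<Rightarrow>\<^sub>L 'k)) \<Rightarrow> ('k \<Rightarrow>\<^sub>L 'k)"
where
  "rep_defect b \<pi> = Delta UNIV (nc_inverse b) (\<lambda>i. \<pi> (wcreation b i))"

definition K0 ::
  "('n list \<Rightarrow> real) \<Rightarrow> (('n fock \<Rightarrow>\<^sub>L 'n fock) \<Rightarrow> ('k::complex_hilbert \<Rightarrow>\<^sub>L 'k)) \<Rightarrow> 'k set"
where
  "K0 b \<pi> = closure (cspan {blinfun_apply (\<pi> (word_op UNIV (wcreation b) \<beta>))
                             (blinfun_apply (rep_defect b \<pi>) x) | \<beta> x. True})"

definition K1 ::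
  "('n list \<Rightarrow> real) \<Rightarrow> (('n fock \<Rightarrow>\<^sub>L 'n fock) \<Rightarrow> ('k::complex_hilbert \<Rightarrow>\<^sub>L 'k)) \<Rightarrow> 'k set"
where
  "K1 b \<pi> = ocomp (K0 b \<pi>)"

text \<open>
  The Hilbert space tensor product of \<open>\<ell>\<^sup>2(I)\<close> with a closed subspace \<open>G\<close> is realised as the
  space of square-summable \<open>G\<close>-valued families on \<open>I\<close>, with \<open>x \<otimes> y = (x\<^sub>\<alpha> y)\<^sub>\<alpha>\<close>.
\<close>

lift_definition tens :: "('a, complex) ell2 \<Rightarrow> 'g::complex_hilbert \<Rightarrow> ('a, 'g) ell2"
  is "\<lambda>f y \<alpha>. f \<alpha> *\<^sub>C y"
  by (simp add: power_mult_distrib summable_on_cmult_left)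

definition ell2_tensor :: "'g::complex_hilbert set \<Rightarrow> ('a, 'g) ell2 set" where
  "ell2_tensor G = {u. \<forall>\<alpha>. coord u \<alpha> \<in> G}"

lemma cinner_tens: "cinner (tens x y) (tens x' y') = cinner x x' * cinner y y'"
proof -
  have "cinner (tens x y) (tens x' y') =
      (\<Sum>\<^sub>\<infinity>\<alpha>. cinner (coord x \<alpha>) (coord x' \<alpha>) * cinner y y')"
    unfolding cinner_ell2_def
    by (simp add: tens.rep_eq cinner_scaleC_left cinner_scaleC_right cinner_complex_def mult_ac)
  also have "\<dots> = cinner x x' * cinner y y'"
    unfolding cinner_ell2_def by (intro infsum_cmult_left coord_cinner_summable)
  finally show ?thesis .
qed

lemma csubspace_closure:
  assumes M: "csubspace M" shows "csubspace (closure M)"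
proof -
  have "x + y \<in> closure M" if x: "x \<in> closure M" and y: "y \<in> closure M" for x y
  proof -
    obtain f g where f: "\<And>n. f n \<in> M" "f \<longlonglongrightarrow> x" and g: "\<And>n. g n \<in> M" "g \<longlonglongrightarrow> y"
      using x y by (auto simp: closure_sequential)
    have "(\<lambda>n. f n + g n) \<longlonglongrightarrow> x + y" by (intro tendsto_add f g)
    moreover have "f n + g n \<in> M" for n using M f g by (auto simp: csubspace_def)
    ultimately show ?thesis unfolding closure_sequential by (intro exI [of _ "\<lambda>n. f n + g n"]) auto
  qed
  moreover have "c *\<^sub>C x \<in> closure M" if x: "x \<in> closure M" for c x
  proof -
    obtain f where f: "\<And>n. f n \<in> M" "f \<longlonglongrightarrow> x" using x by (auto simp: closure_sequential)
    have "bounded_linear (\<lambda>y :: 'a. c *\<^sub>C y)"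
      by (rule bounded_linear_intro [where K = "cmod c"])
         (simp_all add: scaleC_add_right scaleC_scaleR mult.commute)
    from bounded_linear.tendsto [OF this f(2)] have "(\<lambda>n. c *\<^sub>C f n) \<longlonglongrightarrow> c *\<^sub>C x" .
    moreover have "c *\<^sub>C f n \<in> M" for n using M f by (auto simp: csubspace_def)
    ultimately show ?thesis unfolding closure_sequential by (intro exI [of _ "\<lambda>n. c *\<^sub>C f n"]) auto
  qed
  moreover have "0 \<in> closure M" using M closure_subset by (auto simp: csubspace_def)
  ultimately show ?thesis by (simp add: csubspace_def)
qed

lemma csubspace_cspan: "csubspace (cspan S)"
  unfolding cspan_def by (rule hull_in) (auto simp: csubspace_def)

lemma closed_ell2_tensor:
  fixes G :: "'g::complex_hilbert set"
  assumes G: "closed_csubspace G"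
  shows "closed_csubspace (ell2_tensor G :: ('a, 'g) ell2 set)"
proof -
  have "closed (ell2_tensor G :: ('a, 'g) ell2 set)"
  proof -
    have bl: "bounded_linear (\<lambda>u :: ('a, 'g) ell2. coord u \<alpha>)" for \<alpha>
      by (rule bounded_linear_intro [where K = 1])
         (simp_all add: plus_ell2.rep_eq scaleR_ell2.rep_eq norm_coord_le)
    have "closed ((\<lambda>u :: ('a, 'g) ell2. coord u \<alpha>) -` G)" for \<alpha>
      using G by (intro closed_vimage linear_continuous_on bl) (simp add: closed_csubspace_def)
    then have "closed (\<Inter>\<alpha>. (\<lambda>u :: ('a, 'g) ell2. coord u \<alpha>) -` G)" by (intro closed_INT) auto
    moreover have "(\<Inter>\<alpha>. (\<lambda>u :: ('a, 'g) ell2. coord u \<alpha>) -` G) = ell2_tensor G"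
      by (auto simp: ell2_tensor_def)
    ultimately show ?thesis by simp
  qed
  then show ?thesis using G
    by (auto simp: closed_csubspace_def csubspace_def ell2_tensor_def zero_ell2.rep_eq
        plus_ell2.rep_eq scaleC_ell2.rep_eq)
qed

lemma ell2_tensor_eq:
  fixes G :: "'g::complex_hilbert set"
  assumes G: "closed_csubspace G"
  shows "closure (cspan {tens x y | x y. y \<in> G}) = (ell2_tensor G :: ('a, 'g) ell2 set)"
proof (rule antisym)
  let ?E = "{tens x y | x y. y \<in> G} :: ('a, 'g) ell2 set"
  have cT: "csubspace (ell2_tensor G :: ('a, 'g) ell2 set)"
    "closed (ell2_tensor G :: ('a, 'g) ell2 set)"
    using closed_ell2_tensor [OF G] by (auto simp: closed_csubspace_def)
  have "?E \<subseteq> ell2_tensor G"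
    using G by (auto simp: ell2_tensor_def tens.rep_eq closed_csubspace_def csubspace_def)
  then have "cspan ?E \<subseteq> ell2_tensor G" unfolding cspan_def by (intro hull_minimal cT)
  then show sub: "closure (cspan ?E) \<subseteq> ell2_tensor G" by (intro closure_minimal cT)
  have M: "closed_csubspace (closure (cspan ?E))"
    by (simp add: closed_csubspace_def csubspace_closure csubspace_cspan)
  show "ell2_tensor G \<subseteq> closure (cspan ?E)"
  proof
    fix u :: "('a, 'g) ell2" assume u: "u \<in> ell2_tensor G"
    obtain p where p: "p \<in> closure (cspan ?E)" "u - p \<in> ocomp (closure (cspan ?E))"
      using orth_decomp_exists [OF M] by blast
    have q: "u - p \<in> ell2_tensor G" using csubspace_diff [OF cT(1) u] p(1) sub by blast
    have "coord (u - p) \<alpha> = 0" for \<alpha>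
    proof -
      let ?y = "coord (u - p) \<alpha>"
      have "tens (ket \<alpha>) ?y \<in> ?E" using q by (auto simp: ell2_tensor_def)
      then have "tens (ket \<alpha>) ?y \<in> closure (cspan ?E)"
        unfolding cspan_def by (rule subsetD [OF closure_subset, OF subsetD [OF hull_subset]])
      then have "cinner (u - p) (tens (ket \<alpha>) ?y) = 0" using p(2) by (auto simp: ocomp_def)
      moreover have "cinner (u - p) (tens (ket \<alpha>) ?y) =
          (\<Sum>\<^sub>\<infinity>\<beta>\<in>{\<alpha>}. cinner (coord (u - p) \<beta>) (coord (tens (ket \<alpha>) ?y) \<beta>))"
        unfolding cinner_ell2_def by (rule infsum_cong_neutral) (auto simp: tens.rep_eq coord_ket)
      ultimately have "cinner ?y ?y = 0" by (simp add: tens.rep_eq coord_ket)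
      then show ?thesis unfolding cinner_self by simp
    qed
    then have "u - p = 0" by (simp add: coord_inject [symmetric] fun_eq_iff zero_ell2.rep_eq)
    then show "u \<in> closure (cspan ?E)" using p(1) by simp
  qed
qed

definition is_ampliation ::
  "'g::complex_hilbert set \<Rightarrow> (('a, complex) ell2 \<Rightarrow>\<^sub>L ('a, complex) ell2) \<Rightarrow>
   (('a, 'g) ell2 \<Rightarrow>\<^sub>L ('a, 'g) ell2) \<Rightarrow> bool"
where
  "is_ampliation G X T \<longleftrightarrow> T \<in> ops_on (ell2_tensor G) \<and>
     (\<forall>x. \<forall>y\<in>G. blinfun_apply T (tens x y) = tens (blinfun_apply X x) y)"

text \<open>
  \<open>multiplicity_space b \<pi> G\<close>: the Hilbert space \<open>G\<close> has the dimension of the range of the defect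
  operator, and \<open>\<pi>\<^sub>0\<close> is unitarily equivalent to \<open>X \<mapsto> X \<otimes> I\<close> on \<open>F\<^sup>2 \<otimes> G\<close>.
\<close>

definition multiplicity_space ::
  "('n list \<Rightarrow> real) \<Rightarrow> (('n fock \<Rightarrow>\<^sub>L 'n fock) \<Rightarrow> ('k::complex_hilbert \<Rightarrow>\<^sub>L 'k)) \<Rightarrow>
   'g::complex_hilbert set \<Rightarrow> bool"
where
  "multiplicity_space b \<pi> G \<longleftrightarrow> closed_csubspace G \<and>
     same_dim G (closure (range (blinfun_apply (rep_defect b \<pi>)))) \<and>
     (\<exists>\<rho>. (\<forall>X\<in>cstar_W b. is_ampliation G X (\<rho> X)) \<and>
       unitarily_equivalent (cstar_W b) (K0 b \<pi>) (restrict_rep \<pi> (K0 b \<pi>)) (ell2_tensor G) \<rho>)"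

end

theory Submission
  imports Defs
begin

text \<open>
  On basis vectors the partial sums of \<open>\<Delta>\<close> telescope through \<open>g\<^sup>-\<^sup>1 g = 1\<close>, so the defect
  operator of \<open>W\<close> is the projection onto the vacuum vector.  By norm convergence it belongs to
  \<open>C*(W)\<close>, and with it every rank-one operator \<open>E v = v \<otimes> e\<^sub>0*\<close>, because the vectors
  \<open>W\<^sub>\<beta> e\<^sub>0\<close> span the Fock space.  The relations \<open>X (E v) = E (X v)\<close> and
  \<open>(E w)* (E v) = \<langle>v, w\<rangle> E e\<^sub>0\<close> turn \<open>v \<otimes> y \<mapsto> \<pi> (E v) y\<close>, for \<open>y\<close> in the range of the
  projection \<open>\<pi> (E e\<^sub>0)\<close>, into a unitary from the Fock space tensored with that range onto
  \<open>K\<^sub>0\<close>, which intertwines \<open>X \<otimes> I\<close> and \<open>\<pi>\<^sub>0\<close>.  On \<open>K\<^sub>1\<close> all \<open>\<pi> (E v)\<close>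
  vanish, hence so does \<open>\<pi>\<close> of every compact operator.  As the defect projection distinguishes the
  two summands, they are disjoint and every intertwiner respects the decomposition.
\<close>

section \<open>Closed subspaces and unitaries\<close>

text \<open>A representation is assumed to be algebraic only, yet the series for the defect and the
  approximation of compact operators have to be carried through it. Continuity is therefore proved
  first, from a square root of 1 - X*X inside the algebra; a fixed point argument supplies the root,
  so that no spectral theory enters, and it yields the constant 2 in place of 1. The second obstacle
  is that a map prescribed by \<open>v \<otimes> y \<mapsto> \<pi> (E v) y\<close> on elementary
  tensors must be shown to be well defined. All such maps come from one principle: two families with
  the same Gram matrix are exchanged by a unitary between their closed spans. No bases have to be
  chosen for this, and it also turns equality of dimensions into existence of a unitary. Among the
  rank-one operators only the column \<open>E v\<close> over the vacuum is followed through
  \<open>\<pi>\<close>. This is enough, because the coordinate projections are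
  \<open>E v (E v)*\<close> for basis vectors v.\<close>

lemma closed_csubspace_closure_cspan: "closed_csubspace (closure (cspan S))"
  by (simp add: closed_csubspace_def csubspace_closure csubspace_cspan)

lemma cspan_closure_superset: "S \<subseteq> closure (cspan S)"
  unfolding cspan_def by (meson closure_subset hull_subset order_trans)

text \<open>This acts as the induction rule for closed spans: a property whose extension is a closed
  subspace has to be checked on generators only. Preimages, equalisers and orthogonal complements
  supply the closed subspaces.\<close>

lemma closure_cspan_minimal: "S \<subseteq> M \<Longrightarrow> closed_csubspace M \<Longrightarrow> closure (cspan S) \<subseteq> M"
  unfolding cspan_def closed_csubspace_def by (meson closure_minimal hull_minimal)

lemma closed_csubspace_UNIV: "closed_csubspace UNIV"
  by (simp add: closed_csubspace_def csubspace_def)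

text \<open>Homogeneity is assumed explicitly because \<open>ops_on\<close> speaks of operators from
  a space to itself, while \<open>T\<close> may connect two different spaces.\<close>

lemma closed_csubspace_vimage:
  assumes T: "\<And>c x. blinfun_apply T (c *\<^sub>C x) = c *\<^sub>C blinfun_apply T x" and M: "closed_csubspace M"
  shows "closed_csubspace {x. blinfun_apply T x \<in> M}"
proof -
  have "closed (blinfun_apply T -` M)"
    using M by (intro closed_vimage linear_continuous_on blinfun.bounded_linear_right)
      (auto simp: closed_csubspace_def)
  then show ?thesis
    using M by (auto simp: closed_csubspace_def csubspace_def T blinfun.add_right blinfun.zero_right
      vimage_def)
qed

lemma closed_csubspace_eq:
  assumes S: "\<And>c x. blinfun_apply S (c *\<^sub>C x) = c *\<^sub>C blinfun_apply S x"
    and T: "\<And>c x. blinfun_apply T (c *\<^sub>C x) = c *\<^sub>C blinfun_apply T x"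
  shows "closed_csubspace {x. blinfun_apply S x = blinfun_apply T x}"
proof -
  have "closed {x. blinfun_apply S x = blinfun_apply T x}"
    by (intro closed_Collect_eq linear_continuous_on blinfun.bounded_linear_right)
  then show ?thesis
    by (auto simp: closed_csubspace_def csubspace_def S T blinfun.add_right blinfun.zero_right)
qed

lemma continuous_on_cinner_right: "continuous_on S (\<lambda>x. cinner y x)" for y :: "'a::complex_hilbert"
  by (subst cinner_commute) (intro continuous_intros continuous_on_cinner_left)

lemma closed_csubspace_ocomp: "closed_csubspace (ocomp M)"
proof -
  have "ocomp M = (\<Inter>x\<in>M. {y. cinner y x = 0})" by (auto simp: ocomp_def)
  moreover have "closed {y. cinner y x = 0}" for x :: 'a
    by (intro closed_Collect_eq continuous_on_cinner_left continuous_on_const)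
  ultimately have "closed (ocomp M)" by (simp add: closed_INT)
  then show ?thesis by (simp add: closed_csubspace_def csubspace_ocomp)
qed

lemma ocomp_orthogonal: "x \<in> M \<Longrightarrow> y \<in> ocomp M \<Longrightarrow> cinner x y = 0"
  by (metis (mono_tags, lifting) cinner_commute complex_cnj_zero mem_Collect_eq ocomp_def)

lemma mem_ocomp_singleton: "x \<in> ocomp {y} \<longleftrightarrow> cinner y x = 0"
proof -
  have "cinner x y = 0 \<longleftrightarrow> cinner y x = 0" by (metis cinner_commute complex_cnj_zero)
  then show ?thesis by (simp add: ocomp_def)
qed

text \<open>Orthogonality to \<open>y\<close> is a closed linear condition, so it passes from
  \<open>S\<close> to the closed span.\<close>

lemma ocomp_closure_cspan_iff: "y \<in> ocomp (closure (cspan S)) \<longleftrightarrow> (\<forall>x\<in>S. cinner y x = 0)"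
proof
  assume y: "\<forall>x\<in>S. cinner y x = 0"
  then have "S \<subseteq> ocomp {y}" by (auto simp: mem_ocomp_singleton)
  then have "closure (cspan S) \<subseteq> ocomp {y}" by (intro closure_cspan_minimal closed_csubspace_ocomp)
  then show "y \<in> ocomp (closure (cspan S))"
    by (auto simp: mem_ocomp_singleton ocomp_def [of "closure _"])
qed (use cspan_closure_superset [of S] in \<open>auto simp: ocomp_def\<close>)

lemma proj_mem: "closed_csubspace M \<Longrightarrow> blinfun_apply (proj M) x \<in> M"
  using proj_in_ops_on [of M] by (simp add: ops_on_def)

lemma proj_scaleC: "closed_csubspace M \<Longrightarrow>
    blinfun_apply (proj M) (c *\<^sub>C x) = c *\<^sub>C blinfun_apply (proj M) x"
  using proj_in_ops_on [of M] by (simp add: ops_on_def)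

lemma proj_ocomp: "closed_csubspace M \<Longrightarrow> x \<in> ocomp M \<Longrightarrow> blinfun_apply (proj M) x = 0"
  using proj_in_ops_on [of M] by (simp add: ops_on_def)

lemma proj_eqI:
  assumes M: "closed_csubspace M" and y: "y \<in> M" "x - y \<in> ocomp M"
  shows "blinfun_apply (proj M) x = y"
proof -
  have "blinfun_apply (proj M) x = blinfun_apply (proj M) y + blinfun_apply (proj M) (x - y)"
    by (simp flip: blinfun.add_right)
  then show ?thesis using y by (simp add: proj_apply [OF M] proj_ocomp [OF M])
qed

lemma diff_proj_mem_ocomp:
  assumes M: "closed_csubspace M" shows "x - blinfun_apply (proj M) x \<in> ocomp M"
proof -
  obtain y where "y \<in> M" "x - y \<in> ocomp M" using orth_decomp_exists [OF M] by blast
  then show ?thesis using proj_eqI [OF M] by metis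
qed

lemma proj_ocomp_eq:
  assumes M: "closed_csubspace M"
  shows "blinfun_apply (proj (ocomp M)) x = x - blinfun_apply (proj M) x"
proof (rule proj_eqI [OF closed_csubspace_ocomp diff_proj_mem_ocomp [OF M]])
  show "x - (x - blinfun_apply (proj M) x) \<in> ocomp (ocomp M)"
    using proj_mem [OF M, of x] by (auto simp: ocomp_def [of "ocomp M"] ocomp_orthogonal)
qed

lemma cinner_proj_left:
  assumes M: "closed_csubspace M" and y: "y \<in> M"
  shows "cinner (blinfun_apply (proj M) x) y = cinner x y"
proof -
  have "cinner (x - blinfun_apply (proj M) x) y = 0"
    using diff_proj_mem_ocomp [OF M, of x] y by (auto simp: ocomp_def)
  then show ?thesis by (simp add: cinner_diff_left)
qed

section \<open>Unitaries between subspaces\<close>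

lemma unitary_betweenD:
  assumes "unitary_between M N U" "x \<in> M" "y \<in> M"
  shows "U (x + y) = U x + U y" "U (c *\<^sub>C x) = c *\<^sub>C U x" "cinner (U x) (U y) = cinner x y"
    "U x \<in> N"
  using assms by (auto simp: unitary_between_def)

lemma unitary_between_norm:
  assumes "unitary_between M N U" "x \<in> M" shows "norm (U x) = norm x"
proof -
  have "complex_of_real ((norm (U x))\<^sup>2) = complex_of_real ((norm x)\<^sup>2)"
    using unitary_betweenD(3) [OF assms assms(2)] by (simp only: cinner_self)
  then show ?thesis by (simp only: of_real_eq_iff power2_eq_iff_nonneg norm_ge_zero)
qed

lemma unitary_between_inj_on:
  assumes M: "csubspace M" and U: "unitary_between M N U" shows "inj_on U M"
proof (rule inj_onI)
  fix x y assume xy: "x \<in> M" "y \<in> M" "U x = U y"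
  \<comment> \<open>Only sums and complex multiples are preserved by assumption, so the difference
    is reached through \<open>x = (x - y) + y\<close>.\<close>
  have "U ((x - y) + y) = U (x - y) + U y"
    using U xy csubspace_diff [OF M] by (intro unitary_betweenD(1) [OF U]) auto
  then have "U (x - y) = 0" using xy by simp
  then have "norm (x - y) = 0"
    using unitary_between_norm [OF U, of "x - y"] csubspace_diff [OF M] xy by simp
  then show "x = y" by simp
qed

lemma unitary_between_inverse:
  assumes M: "csubspace M" and U: "unitary_between M N U"
  shows "unitary_between N M (inv_into M U)"
proof -
  note inj = unitary_between_inj_on [OF M U]
  have img: "U ` M = N" using U by (simp add: unitary_between_def)
  have sub: "x + y \<in> M" "c *\<^sub>C x \<in> M" if "x \<in> M" "y \<in> M" for x y c
    using M that by (auto simp: csubspace_def)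
  have "inv_into M U (U x + U y) = x + y" if "x \<in> M" "y \<in> M" for x y
    using inv_into_f_f [OF inj sub(1) [OF that]] unitary_betweenD(1) [OF U that] by metis
  moreover have "inv_into M U (c *\<^sub>C U x) = c *\<^sub>C x" if "x \<in> M" for x c
    using inv_into_f_f [OF inj sub(2) [OF that that]] unitary_betweenD(2) [OF U that that] by metis
  moreover have "inv_into M U ` N = M"
    using inj img by (metis inv_into_image_cancel order_refl)
  ultimately show ?thesis
    using U img by (auto simp: unitary_between_def inv_into_f_f [OF inj])
qed

lemma unitary_between_compose:
  "unitary_between M N U \<Longrightarrow> unitary_between N L V \<Longrightarrow> unitary_between M L (\<lambda>x. V (U x))"
  by (auto simp: unitary_between_def image_image [symmetric])

text \<open>Outside \<open>M\<close> nothing is known about \<open>U\<close>. Composition with the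
  projection gives a bounded operator on the whole space, to which closed equalisers and preimages
  apply.\<close>

lemma unitary_between_blinfun:
  assumes M: "closed_csubspace M" and U: "unitary_between M N U"
  obtains T where "\<And>x. blinfun_apply T x = U (blinfun_apply (proj M) x)"
    and "\<And>c x. blinfun_apply T (c *\<^sub>C x) = c *\<^sub>C blinfun_apply T x"
    and "\<And>x. x \<in> M \<Longrightarrow> blinfun_apply T x = U x"
proof -
  let ?f = "\<lambda>x. U (blinfun_apply (proj M) x)"
  note m = proj_mem [OF M]
  have C: "?f (c *\<^sub>C x) = c *\<^sub>C ?f x" for c x
    by (simp add: proj_scaleC [OF M] unitary_betweenD(2) [OF U m m])
  have "bounded_linear ?f"
  proof (rule bounded_linear_intro [where K = "norm (proj M)"])
    show "?f (x + y) = ?f x + ?f y" for x y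
      by (simp add: blinfun.add_right unitary_betweenD(1) [OF U m m])
    show "?f (r *\<^sub>R x) = r *\<^sub>R ?f x" for r x by (metis C scaleC_of_real)
    show "norm (?f x) \<le> norm x * norm (proj M)" for x
      unfolding unitary_between_norm [OF U m] mult.commute [of "norm x"] by (rule norm_blinfun)
  qed
  then have "blinfun_apply (Blinfun ?f) = ?f" by (rule bounded_linear_Blinfun_apply)
  then show ?thesis using C proj_apply [OF M] by (intro that [of "Blinfun ?f"]) auto
qed

section \<open>Direct sums of Hilbert spaces and graphs of unitaries\<close>

instantiation prod :: (complex_hilbert, complex_hilbert) complex_hilbert
begin

definition "scaleC_prod c (p :: 'a \<times> 'b) = (c *\<^sub>C fst p, c *\<^sub>C snd p)"
definition "cinner_prod (p :: 'a \<times> 'b) q = cinner (fst p) (fst q) + cinner (snd p) (snd q)"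

instance
proof
  fix p q r :: "'a \<times> 'b" and c d :: complex and s :: real
  show "cinner p q = cnj (cinner q p)"
    by (simp add: cinner_prod_def cinner_commute [of "fst q"] cinner_commute [of "snd q"])
qed (simp_all add: scaleC_prod_def cinner_prod_def scaleC_add_right scaleC_add_left scaleC_scaleC
    scaleC_of_real cinner_add_left cinner_scaleC_left Re_cinner inner_prod_def distrib_left
    prod_eq_iff)

end

text \<open>With the swap, a fact about first projections of graphs also serves for second
  projections.\<close>

lemma closed_csubspace_swap:
  assumes "closed_csubspace \<Gamma>" shows "closed_csubspace (prod.swap ` \<Gamma>)"
proof -
  have eq: "prod.swap ` \<Gamma> = prod.swap -` \<Gamma>" by force
  have "closed (prod.swap -` \<Gamma>)" using assms
    by (intro closed_vimage)
      (auto simp: closed_csubspace_def prod.swap_def intro!: continuous_intros)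
  moreover have "csubspace (prod.swap -` \<Gamma>)" using assms
    unfolding closed_csubspace_def csubspace_def
    by (auto simp: scaleC_prod_def zero_prod_def) (metis add_Pair, metis fst_conv snd_conv)
  ultimately show ?thesis by (simp add: closed_csubspace_def eq)
qed

text \<open>The projection is isometric up to the factor \<open>\<surd>2\<close>, so its range is complete.\<close>

lemma closed_csubspace_fst_isometric:
  fixes \<Gamma> :: "('a::complex_hilbert \<times> 'b::complex_hilbert) set"
  assumes \<Gamma>: "closed_csubspace \<Gamma>" and iso: "\<And>p. p \<in> \<Gamma> \<Longrightarrow> norm (snd p) = norm (fst p)"
  shows "closed_csubspace (fst ` \<Gamma>)"
proof -
  have sub: "csubspace \<Gamma>" and cl: "closed \<Gamma>" using \<Gamma> by (auto simp: closed_csubspace_def)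
  have "closed (fst ` \<Gamma>)"
    unfolding closed_sequential_limits
  proof (intro allI impI, elim conjE)
    fix x l assume x: "\<forall>n. x n \<in> fst ` \<Gamma>" and l: "x \<longlonglongrightarrow> l"
    then have "\<forall>n. \<exists>p. p \<in> \<Gamma> \<and> fst p = x n" by (metis image_iff)
    then obtain p where p: "\<And>n. p n \<in> \<Gamma>" "\<And>n. fst (p n) = x n" by metis
    \<comment> \<open>Differences stay in \<open>\<Gamma>\<close>, so the norm condition becomes an
      equality of distances: convergence of the first components makes the second components
      Cauchy.\<close>
    have d: "dist (snd (p m)) (snd (p n)) = dist (x m) (x n)" for m n
      using iso [OF csubspace_diff [OF sub p(1) p(1)]] p(2) by (simp add: dist_norm)
    have "Cauchy x" using l by (rule LIMSEQ_imp_Cauchy)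
    then have "Cauchy (\<lambda>n. snd (p n))" unfolding Cauchy_def d .
    then obtain m where m: "(\<lambda>n. snd (p n)) \<longlonglongrightarrow> m" using Cauchy_convergent_iff convergent_def by blast
    have "(\<lambda>n. (x n, snd (p n))) \<longlonglongrightarrow> (l, m)" by (rule tendsto_Pair [OF l m])
    moreover have "(\<lambda>n. (x n, snd (p n))) = p" by (simp add: fun_eq_iff prod_eq_iff p)
    ultimately have "p \<longlonglongrightarrow> (l, m)" by simp
    then have "(l, m) \<in> \<Gamma>" using closed_sequentially [OF cl, of p] p(1) by blast
    then show "l \<in> fst ` \<Gamma>" by force
  qed
  moreover have "csubspace (fst ` \<Gamma>)"
    unfolding csubspace_def
  proof (intro conjI ballI allI)
    have "0 \<in> \<Gamma>" using sub by (simp add: csubspace_def)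
    then have "fst (0 :: 'a \<times> 'b) \<in> fst ` \<Gamma>" by (rule imageI)
    then show "0 \<in> fst ` \<Gamma>" by simp
  next
    fix x y assume "x \<in> fst ` \<Gamma>" "y \<in> fst ` \<Gamma>"
    then obtain p q where "p \<in> \<Gamma>" "q \<in> \<Gamma>" "x = fst p" "y = fst q" by blast
    moreover from this have "fst (p + q) \<in> fst ` \<Gamma>"
      using sub unfolding csubspace_def by (intro imageI) blast
    ultimately show "x + y \<in> fst ` \<Gamma>" by simp
  next
    fix c x assume "x \<in> fst ` \<Gamma>"
    then obtain p where "p \<in> \<Gamma>" "x = fst p" by blast
    moreover from this have "fst (c *\<^sub>C p) \<in> fst ` \<Gamma>"
      using sub unfolding csubspace_def by (intro imageI) blast
    ultimately show "c *\<^sub>C x \<in> fst ` \<Gamma>" by (simp add: scaleC_prod_def)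
  qed
  ultimately show ?thesis by (simp add: closed_csubspace_def)
qed

text \<open>The unitary is read off its graph, the closed span of the pairs \<open>(f i, g i)\<close>.\<close>

lemma unitary_between_extend:
  fixes f :: "'i \<Rightarrow> 'a::complex_hilbert" and g :: "'i \<Rightarrow> 'b::complex_hilbert"
  assumes fg: "\<And>i j. i \<in> I \<Longrightarrow> j \<in> I \<Longrightarrow> cinner (g i) (g j) = cinner (f i) (f j)"
  obtains U where "unitary_between (closure (cspan (f ` I))) (closure (cspan (g ` I))) U"
    and "\<And>i. i \<in> I \<Longrightarrow> U (f i) = g i"
proof -
  let ?M = "closure (cspan (f ` I))" and ?N = "closure (cspan (g ` I))"
  define \<Gamma> where "\<Gamma> = closure (cspan ((\<lambda>i. (f i, g i)) ` I))"
  have \<Gamma>: "closed_csubspace \<Gamma>" unfolding \<Gamma>_def by (rule closed_csubspace_closure_cspan)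
  have gen: "(f i, g i) \<in> \<Gamma>" if "i \<in> I" for i
    unfolding \<Gamma>_def by (rule subsetD [OF cspan_closure_superset]) (use that in blast)
  \<comment> \<open>The form \<open>cinner p (J q)\<close> is the difference of the two inner
    products of components, so its vanishing on \<open>\<Gamma>\<close> says that the graph is
    isometric. It vanishes on generators by \<open>fg\<close>; being linear in \<open>p\<close> and
    conjugate linear in \<open>q\<close>, it is extended to the closed span one argument at a time,
    and \<open>J'\<close> exchanges the arguments.\<close>
  define J :: "'a \<times> 'b \<Rightarrow> 'a \<times> 'b" where "J p = (fst p, - snd p)" for p
  have J: "cinner p (J q) = 0 \<longleftrightarrow> cinner (snd p) (snd q) = cinner (fst p) (fst q)" for p q
    by (auto simp: J_def cinner_prod_def cinner_minus_right)
  have J': "cinner p (J q) = cnj (cinner q (J p))" for p q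
    by (simp add: J_def cinner_prod_def cinner_minus_right cinner_commute [of "fst p"]
        cinner_commute [of "snd p"])
  have "J (f i, g i) \<in> ocomp \<Gamma>" if "i \<in> I" for i
    unfolding \<Gamma>_def ocomp_closure_cspan_iff
    using that fg by (auto simp: J_def cinner_prod_def cinner_minus_left)
  then have "cinner (f i, g i) (J q) = 0" if "i \<in> I" "q \<in> \<Gamma>" for i q
    using ocomp_orthogonal [OF that(2)] that(1) by (subst J') simp
  then have "(\<lambda>i. (f i, g i)) ` I \<subseteq> ocomp (J ` \<Gamma>)" by (auto simp: ocomp_def)
  then have "closure (cspan ((\<lambda>i. (f i, g i)) ` I)) \<subseteq> ocomp (J ` \<Gamma>)"
    by (rule closure_cspan_minimal [OF _ closed_csubspace_ocomp])
  then have "cinner p (J q) = 0" if "p \<in> \<Gamma>" "q \<in> \<Gamma>" for p q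
    using that unfolding \<Gamma>_def [symmetric] by (auto simp: ocomp_def)
  then have inner: "cinner (snd p) (snd q) = cinner (fst p) (fst q)" if "p \<in> \<Gamma>" "q \<in> \<Gamma>" for p q
    using that J by blast
  have nrm: "norm (snd p) = norm (fst p)" if "p \<in> \<Gamma>" for p
  proof -
    have "complex_of_real ((norm (snd p))\<^sup>2) = complex_of_real ((norm (fst p))\<^sup>2)"
      using inner [OF that that] by (simp only: cinner_self)
    then show ?thesis by (simp only: of_real_eq_iff power2_eq_iff_nonneg norm_ge_zero)
  qed
  have fstM: "fst ` \<Gamma> = ?M"
  proof (rule antisym)
    have "closed_csubspace {p :: 'a \<times> 'b. fst p \<in> ?M}"
    proof -
      have "closed (fst -` ?M :: ('a \<times> 'b) set)"
        by (intro closed_vimage) (auto intro: continuous_intros)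
      then show ?thesis using closed_csubspace_closure_cspan [of "f ` I"]
        by (auto simp: closed_csubspace_def csubspace_def scaleC_prod_def vimage_def)
    qed
    then have "\<Gamma> \<subseteq> {p. fst p \<in> ?M}" unfolding \<Gamma>_def
      using cspan_closure_superset [of "f ` I"] by (intro closure_cspan_minimal) auto
    then show "fst ` \<Gamma> \<subseteq> ?M" by auto
    show "?M \<subseteq> fst ` \<Gamma>"
      by (intro closure_cspan_minimal closed_csubspace_fst_isometric \<Gamma> nrm) (force dest: gen)+
  qed
  have sndN: "snd ` \<Gamma> = ?N"
  proof (rule antisym)
    have "closed_csubspace {p :: 'a \<times> 'b. snd p \<in> ?N}"
    proof -
      have "closed (snd -` ?N :: ('a \<times> 'b) set)"
        by (intro closed_vimage) (auto intro: continuous_intros)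
      then show ?thesis using closed_csubspace_closure_cspan [of "g ` I"]
        by (auto simp: closed_csubspace_def csubspace_def scaleC_prod_def vimage_def)
    qed
    then have "\<Gamma> \<subseteq> {p. snd p \<in> ?N}" unfolding \<Gamma>_def
      using cspan_closure_superset [of "g ` I"] by (intro closure_cspan_minimal) auto
    then show "snd ` \<Gamma> \<subseteq> ?N" by auto
    have eq: "snd ` \<Gamma> = fst ` prod.swap ` \<Gamma>" by (force simp: image_iff)
    show "?N \<subseteq> snd ` \<Gamma>" unfolding eq
      by (intro closure_cspan_minimal closed_csubspace_fst_isometric closed_csubspace_swap \<Gamma>)
         (force dest: gen nrm)+
  qed
  define U where "U x = (SOME y. (x, y) \<in> \<Gamma>)" for x
  have sub: "csubspace \<Gamma>" using \<Gamma> by (simp add: closed_csubspace_def)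
  \<comment> \<open>The difference of the two pairs is \<open>(0, y - z)\<close>, and its components
    have equal norm; hence \<open>\<Gamma>\<close> is the graph of a function.\<close>
  have uniq: "y = z" if "(x, y) \<in> \<Gamma>" "(x, z) \<in> \<Gamma>" for x y z
    using nrm [OF csubspace_diff [OF sub that]] by simp
  have U: "(x, U x) \<in> \<Gamma>" if "x \<in> ?M" for x
  proof -
    from that obtain y where "(x, y) \<in> \<Gamma>" unfolding fstM [symmetric] by force
    then show ?thesis unfolding U_def by (rule someI)
  qed
  have UI: "U x = y" if "(x, y) \<in> \<Gamma>" for x y
    using that unfolding U_def by (intro some_equality) (auto dest: uniq)
  have "unitary_between ?M ?N U"
    unfolding unitary_between_def
  proof (intro conjI ballI allI)
    fix x y assume xy: "x \<in> ?M" "y \<in> ?M"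
    show "U (x + y) = U x + U y"
      using sub U [OF xy(1)] U [OF xy(2)] by (intro UI) (force simp: csubspace_def)
    show "cinner (U x) (U y) = cinner x y" using inner [OF U U, OF xy] by simp
  next
    fix x c assume "x \<in> ?M"
    then show "U (c *\<^sub>C x) = c *\<^sub>C U x"
      using sub U [of x] by (intro UI) (force simp: csubspace_def scaleC_prod_def)
  next
    show "U ` ?M = ?N"
    proof (rule antisym)
      show "U ` ?M \<subseteq> ?N" using U unfolding sndN [symmetric] by force
      show "?N \<subseteq> U ` ?M"
      proof
        fix y assume "y \<in> ?N"
        then obtain x where x: "(x, y) \<in> \<Gamma>" unfolding sndN [symmetric] by force
        then have "x \<in> ?M" unfolding fstM [symmetric] by force
        with UI [OF x] show "y \<in> U ` ?M" by blast
      qed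
    qed
  qed
  then show ?thesis using UI gen by (intro that) auto
qed

section \<open>Hilbert space dimension\<close>

text \<open>Zorn's lemma gives a maximal orthonormal subset of \<open>M\<close>. If its closed span
  missed a vector of \<open>M\<close>, the normalised orthogonal remainder of that vector could be
  added.\<close>

lemma is_onb_exists:
  assumes M: "closed_csubspace M"
  obtains B where "is_onb B M"
proof -
  define \<O> where "\<O> = {B. B \<subseteq> M \<and> (\<forall>x\<in>B. norm x = 1) \<and> (\<forall>x\<in>B. \<forall>y\<in>B. x \<noteq> y \<longrightarrow> cinner x y = 0)}"
  have "\<Union>C \<in> \<O>" if C: "subset.chain \<O> C" for C
  proof -
    have "cinner x y = 0" if "x \<in> A" "y \<in> B" "A \<in> C" "B \<in> C" "x \<noteq> y" for x y A B
    proof -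
      have "A \<subseteq> B \<or> B \<subseteq> A" "A \<in> \<O>" "B \<in> \<O>" using C that by (auto simp: subset_chain_def)
      then show ?thesis using that unfolding \<O>_def by blast
    qed
    moreover have "C \<subseteq> \<O>" using C by (auto simp: subset_chain_def)
    then have "A \<subseteq> M" "\<forall>x\<in>A. norm x = 1" if "A \<in> C" for A using that by (auto simp: \<O>_def)
    then have "\<Union>C \<subseteq> M" "\<forall>x\<in>\<Union>C. norm x = 1" by blast+
    ultimately show ?thesis unfolding \<O>_def by simp
  qed
  then obtain B where B: "B \<in> \<O>" and max: "\<And>X. X \<in> \<O> \<Longrightarrow> B \<subseteq> X \<Longrightarrow> X = B"
    using subset_Zorn' [of \<O>] by blast
  have BM: "closure (cspan B) \<subseteq> M" using B M by (intro closure_cspan_minimal) (auto simp: \<O>_def)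
  have "M \<subseteq> closure (cspan B)"
  proof
    fix x assume x: "x \<in> M"
    obtain y where y: "y \<in> closure (cspan B)" "x - y \<in> ocomp (closure (cspan B))"
      using orth_decomp_exists [OF closed_csubspace_closure_cspan] by blast
    have "x - y = 0"
    proof (rule ccontr)
      assume n: "x - y \<noteq> 0"
      define z where "z = complex_of_real (inverse (norm (x - y))) *\<^sub>C (x - y)"
      have "x - y \<in> M" using x y BM M by (auto simp: closed_csubspace_def intro: csubspace_diff)
      then have zM: "z \<in> M" using M by (simp add: z_def closed_csubspace_def csubspace_def)
      have z1: "norm z = 1" using n by (simp add: z_def norm_inverse)
      have "cinner z u = 0" if "u \<in> B" for u
        using y(2) that by (simp add: z_def cinner_scaleC_left ocomp_closure_cspan_iff)
      moreover have "cinner u z = 0" if "u \<in> B" for u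
        using calculation [OF that] by (metis cinner_commute complex_cnj_zero)
      ultimately have "insert z B \<in> \<O>" using B zM z1 by (auto simp: \<O>_def)
      then have "z \<in> B" using max by blast
      then have "cinner z z = 0" using \<open>\<And>u. u \<in> B \<Longrightarrow> cinner z u = 0\<close> by blast
      then show False using z1 by (simp add: cinner_self)
    qed
    then show "x \<in> closure (cspan B)" using y by simp
  qed
  with BM B show ?thesis by (intro that [of B]) (auto simp: is_onb_def \<O>_def)
qed

lemma cinner_onb:
  assumes "is_onb B M" "x \<in> B" "y \<in> B"
  shows "cinner x y = (if x = y then 1 else 0)"
  using assms by (auto simp: is_onb_def cinner_self)

text \<open>The unitary \<open>V\<close> obtained from the Gram matrix of \<open>B\<close> has the
  desired closed span as its range. It agrees with \<open>U\<close> on \<open>B\<close>, hence on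
  all of \<open>M\<close>, and so both have the same range.\<close>

lemma unitary_between_image_closure_cspan:
  assumes M: "closed_csubspace M" and U: "unitary_between M N U" and B: "B \<subseteq> M"
    "closure (cspan B) = M"
  shows "closure (cspan (U ` B)) = N"
proof -
  obtain V where V: "unitary_between (closure (cspan (id ` B))) (closure (cspan (U ` B))) V"
    and VB: "\<And>x. x \<in> B \<Longrightarrow> V (id x) = U x"
  proof (rule unitary_between_extend)
    show "cinner (U x) (U y) = cinner (id x) (id y)" if "x \<in> B" "y \<in> B" for x y
      using that B(1) by (auto intro: unitary_betweenD(3) [OF U])
  qed blast
  have VM: "unitary_between M (closure (cspan (U ` B))) V" using V B by simp
  obtain S where S: "\<And>c x. blinfun_apply S (c *\<^sub>C x) = c *\<^sub>C blinfun_apply S x"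
    "\<And>x. x \<in> M \<Longrightarrow> blinfun_apply S x = U x" by (rule unitary_between_blinfun [OF M U]) blast
  obtain T where T: "\<And>c x. blinfun_apply T (c *\<^sub>C x) = c *\<^sub>C blinfun_apply T x"
    "\<And>x. x \<in> M \<Longrightarrow> blinfun_apply T x = V x" by (rule unitary_between_blinfun [OF M VM]) blast
  have "closure (cspan B) \<subseteq> {x. blinfun_apply S x = blinfun_apply T x}"
    using B(1) VB
    by (intro closure_cspan_minimal closed_csubspace_eq S T) (auto simp: S T subset_iff)
  then have "V x = U x" if "x \<in> M" for x using that S T B(2) by auto
  then have "V ` M = U ` M" by (rule image_cong [OF refl])
  then show ?thesis using VM U by (simp add: unitary_between_def)
qed

text \<open>Dimensions are handled through unitaries from here on, so that transitivity becomes
  composition and cardinalities of different bases never have to be compared.\<close>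

lemma same_dim_iff_unitary:
  assumes M: "closed_csubspace M"
  shows "same_dim M N \<longleftrightarrow> (\<exists>U. unitary_between M N U)"
proof
  assume "same_dim M N"
  then obtain B C h where B: "is_onb B M" and C: "is_onb C N" and h: "bij_betw h B C"
    unfolding same_dim_def eqpoll_def by blast
  have hC: "h x \<in> C" if "x \<in> B" for x using h that by (auto simp: bij_betw_def)
  have "cinner (h x) (h y) = cinner (id x) (id y)" if "x \<in> B" "y \<in> B" for x y
    using that h
    by (simp add: cinner_onb [OF B] cinner_onb [OF C] hC bij_betw_def) (auto dest: inj_onD)
  then obtain U where "unitary_between (closure (cspan (id ` B))) (closure (cspan (h ` B))) U"
    by (rule unitary_between_extend) auto
  moreover have "closure (cspan (id ` B)) = M" "closure (cspan (h ` B)) = N"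
    using B C h by (auto simp: is_onb_def bij_betw_def)
  ultimately show "\<exists>U. unitary_between M N U" by auto
next
  assume "\<exists>U. unitary_between M N U"
  then obtain U where U: "unitary_between M N U" by blast
  obtain B where B: "is_onb B M" using is_onb_exists [OF M] .
  then have BM: "B \<subseteq> M" using cspan_closure_superset by (auto simp: is_onb_def)
  have "inj_on U B"
    using unitary_between_inj_on [of M N U] M U BM
    by (auto simp: closed_csubspace_def inj_on_subset)
  then have "B \<approx> U ` B" by (metis inj_on_image_eqpoll_self eqpoll_sym)
  moreover have "is_onb (U ` B) N"
    using B BM U unitary_between_image_closure_cspan [OF M U BM]
    by (auto simp: is_onb_def unitary_between_norm [OF U] unitary_betweenD(3) [OF U] subset_iff)
  ultimately show "same_dim M N" using B by (auto simp: same_dim_def)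
qed

section \<open>Bounded *-representations\<close>

lemma ops_on_subset_UNIV: "A \<in> ops_on M \<Longrightarrow> A \<in> ops_on UNIV"
  by (simp add: ops_on_UNIV_iff ops_on_scaleC)

lemma adj_eqI:
  assumes "\<And>x y. cinner (blinfun_apply A x) y = cinner x (blinfun_apply B y)"
    and "A \<in> ops_on UNIV"
  shows "adj A = B"
  using adj_exists_unique [OF assms(2)] assms(1) cinner_adj [OF assms(2)] by blast

lemma cinner_adj_left:
  "A \<in> ops_on UNIV \<Longrightarrow> cinner (blinfun_apply (adj A) x) y = cinner x (blinfun_apply A y)"
  by (metis cinner_adj cinner_commute)

lemma adj_ops_on: 
  assumes "A \<in> ops_on UNIV" shows "adj A \<in> ops_on UNIV"
  unfolding ops_on_UNIV_iff
  by (intro allI, rule cinner_eqI) (simp add: cinner_adj_left [OF assms] cinner_scaleC_left)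

lemma ops_on_compose: "A \<in> ops_on UNIV \<Longrightarrow> B \<in> ops_on UNIV \<Longrightarrow> A o\<^sub>L B \<in> ops_on UNIV"
  by (simp add: ops_on_UNIV_iff)

lemma ops_on_add: "A \<in> ops_on UNIV \<Longrightarrow> B \<in> ops_on UNIV \<Longrightarrow> A + B \<in> ops_on UNIV"
  by (simp add: ops_on_UNIV_iff blinfun.add_left scaleC_add_right)

lemma adj_compose:
  assumes "A \<in> ops_on UNIV" "B \<in> ops_on UNIV"
  shows "adj (A o\<^sub>L B) = adj B o\<^sub>L adj A"
  by (rule adj_eqI)
    (simp_all add: cinner_adj assms ops_on_compose cinner_adj [OF assms(1)] cinner_adj
        [OF assms(2)])

lemma adj_add:
  assumes "A \<in> ops_on UNIV" "B \<in> ops_on UNIV"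
  shows "adj (A + B) = adj A + adj B"
  by (rule adj_eqI) (simp_all add: assms ops_on_add blinfun.add_left cinner_add_left
    cinner_add_right cinner_adj [OF assms(1)] cinner_adj [OF assms(2)])

lemma adj_adj: "A \<in> ops_on UNIV \<Longrightarrow> adj (adj A) = A"
  by (rule adj_eqI) (simp_all add: cinner_adj_left adj_ops_on)

lemma scaleR_eq_cscale: "r *\<^sub>R A = cscale (complex_of_real r) A"
  by (rule blinfun_eqI) (simp add: scaleC_of_real blinfun.scaleR_left)

section \<open>Square roots in C*-subalgebras\<close>

lemma cstar_subalgebraD:
  assumes "cstar_subalgebra \<A>"
  shows "X \<in> \<A> \<Longrightarrow> X \<in> ops_on UNIV" "closed \<A>" "0 \<in> \<A>"
    "X \<in> \<A> \<Longrightarrow> Y \<in> \<A> \<Longrightarrow> X + Y \<in> \<A>" "X \<in> \<A> \<Longrightarrow> Y \<in> \<A> \<Longrightarrow> X o\<^sub>L Y \<in> \<A>"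
    "X \<in> \<A> \<Longrightarrow> adj X \<in> \<A>" "X \<in> \<A> \<Longrightarrow> cscale c X \<in> \<A>" "X \<in> \<A> \<Longrightarrow> r *\<^sub>R X \<in> \<A>"
  using assms by (auto simp: cstar_subalgebra_def scaleR_eq_cscale)

text \<open>
  The self-adjoint solution of \<open>2R = S + R\<^sup>2\<close> makes \<open>1 - R\<close> a square root of \<open>1 - S\<close> inside the
  algebra.
\<close>

lemma cstar_sqrt:
  assumes \<A>: "cstar_subalgebra \<A>" and S: "S \<in> \<A>" "adj S = S" "norm S \<le> 1/4"
  obtains R where "R \<in> \<A>" "adj R = R" "R + R = S + (R o\<^sub>L R)"
proof -
  note c = cstar_subalgebraD [OF \<A>]
  \<comment> \<open>Radius 1/2 makes \<open>F\<close> a contraction with factor 1/2, and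
    \<open>norm S \<le> 1/4\<close> keeps the ball invariant. Self-adjointness is written with inner
    products because in this form it is visibly closed under norm limits.\<close>
  define D where "D = \<A> \<inter> {R. \<forall>x y. cinner (blinfun_apply R x) y = cinner x (blinfun_apply R y)}
    \<inter> cball 0 (1/2)"
  have D: "R \<in> D \<longleftrightarrow> R \<in> \<A> \<and> adj R = R \<and> norm R \<le> 1/2" for R
  proof -
    have "(\<forall>x y. cinner (blinfun_apply R x) y = cinner x (blinfun_apply R y)) \<longleftrightarrow> adj R = R"
      if "R \<in> \<A>" using adj_eqI [of R R] cinner_adj [of R UNIV] c(1) [OF that] by metis
    then show ?thesis unfolding D_def by auto
  qed
  define F where "F R = (1/2) *\<^sub>R (S + (R o\<^sub>L R))" for R
  have "closed {R :: 'a \<Rightarrow>\<^sub>L 'a. \<forall>x y. cinner (blinfun_apply R x) y = cinner x (blinfun_apply R y)}"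
    by (intro closed_Collect_all closed_Collect_eq continuous_on_compose2
        [OF continuous_on_cinner_left [of UNIV]]
        continuous_on_compose2 [OF continuous_on_cinner_right [of UNIV]] linear_continuous_on
        blinfun.bounded_linear_left subset_UNIV)
  then have "complete D" unfolding D_def complete_eq_closed
    by (intro closed_Int closed_cball c)
  moreover have "0 \<in> D" unfolding D_def using c(3) by auto
  moreover have "F R \<in> D" if "R \<in> D" for R
  proof -
    have R: "R \<in> \<A>" "adj R = R" "norm R \<le> 1/2" using that by (auto simp: D)
    have FA: "F R \<in> \<A>" unfolding F_def by (intro c R S)
    have "adj (R o\<^sub>L R) = R o\<^sub>L R" using adj_compose c(1) R by metis
    then have "adj (S + (R o\<^sub>L R)) = S + (R o\<^sub>L R)" using adj_add c R S by metis
    then have a: "cinner (blinfun_apply (S + (R o\<^sub>L R)) x) y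
        = cinner x (blinfun_apply (S + (R o\<^sub>L R)) y)" for x y
      using cinner_adj [of "S + (R o\<^sub>L R)" UNIV] c R S by metis
    have "adj (F R) = F R"
      by (rule adj_eqI [OF _ c(1) [OF FA]])
        (unfold F_def blinfun.scaleR_left scaleC_of_real [symmetric] cinner_scaleC_left
            cinner_scaleC_right a, simp)
    moreover have "norm (R o\<^sub>L R) \<le> 1/2 * (1/2)"
      by (rule order_trans [OF norm_blinfun_compose]) (intro mult_mono R, auto)
    then have "norm (F R) \<le> 1/2"
      unfolding F_def using norm_triangle_ineq [of S "R o\<^sub>L R"] S(3) by simp
    ultimately show ?thesis using FA by (simp add: D)
  qed
  moreover have "dist (F R) (F R') \<le> 1/2 * dist R R'" if "R \<in> D" "R' \<in> D" for R R'
  proof -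
    have n: "norm R \<le> 1/2" "norm R' \<le> 1/2" using that by (auto simp: D)
    have "F R - F R' = (1/2) *\<^sub>R ((R o\<^sub>L (R - R')) + ((R - R') o\<^sub>L R'))"
      by (rule blinfun_eqI) (simp add: F_def blinfun.bilinear_simps algebra_simps)
    then have "dist (F R) (F R') \<le> 1/2 * (norm (R o\<^sub>L (R - R')) + norm ((R - R') o\<^sub>L R'))"
      unfolding dist_norm by (simp add: norm_triangle_ineq)
    also have "\<dots> \<le> 1/2 * (norm R * norm (R - R') + norm (R - R') * norm R')"
      by (intro mult_left_mono add_mono norm_blinfun_compose) simp
    also have "\<dots> \<le> 1/2 * (1/2 * norm (R - R') + norm (R - R') * (1/2))"
      by (intro mult_left_mono add_mono mult_right_mono n) simp_all
    finally show ?thesis by (simp add: dist_norm)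
  qed
  ultimately have "\<exists>!R\<in>D. F R = R"
    by (intro Banach_fix [of D "1/2"]) auto
  then obtain R where R: "R \<in> D" "F R = R" by blast
  have "R + R = 2 *\<^sub>R R" by (simp add: scaleR_2)
  also have "\<dots> = 2 *\<^sub>R F R" by (simp only: R(2))
  also have "\<dots> = S + (R o\<^sub>L R)" by (simp add: F_def)
  finally show ?thesis using R D that by blast
qed

section \<open>Continuity of representations and passage to invariant subspaces\<close>

lemma unital_star_repD:
  assumes "unital_star_rep \<A> M \<pi>"
  shows "closed_csubspace M" "\<pi> id_blinfun = proj M" "X \<in> \<A> \<Longrightarrow> \<pi> X \<in> ops_on M"
    "X \<in> \<A> \<Longrightarrow> \<pi> X \<in> ops_on UNIV"
    "X \<in> \<A> \<Longrightarrow> Y \<in> \<A> \<Longrightarrow> \<pi> (X + Y) = \<pi> X + \<pi> Y"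
    "X \<in> \<A> \<Longrightarrow> Y \<in> \<A> \<Longrightarrow> \<pi> (X o\<^sub>L Y) = \<pi> X o\<^sub>L \<pi> Y"
    "X \<in> \<A> \<Longrightarrow> \<pi> (cscale c X) = cscale c (\<pi> X)" "X \<in> \<A> \<Longrightarrow> \<pi> (r *\<^sub>R X) = r *\<^sub>R \<pi> X"
    "X \<in> \<A> \<Longrightarrow> \<pi> (adj X) = adj (\<pi> X)"
  using assms ops_on_subset_UNIV by (auto simp: unital_star_rep_def scaleR_eq_cscale)

lemma rep_zero:
  assumes "cstar_subalgebra \<A>" "unital_star_rep \<A> M \<pi>" shows "\<pi> 0 = 0"
  using unital_star_repD(8) [OF assms(2) cstar_subalgebraD(3) [OF assms(1)], of 0] by simp

lemma rep_diff:
  assumes \<A>: "cstar_subalgebra \<A>" and \<pi>: "unital_star_rep \<A> M \<pi>" and XY: "X \<in> \<A>" "Y \<in> \<A>"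
  shows "\<pi> (X - Y) = \<pi> X - \<pi> Y" "X - Y \<in> \<A>"
proof -
  have eq: "X - Y = X + (- 1) *\<^sub>R Y" by simp
  note c = cstar_subalgebraD [OF \<A>] and p = unital_star_repD [OF \<pi>]
  show "X - Y \<in> \<A>" unfolding eq by (intro c XY)
  show "\<pi> (X - Y) = \<pi> X - \<pi> Y"
    unfolding eq p(5) [OF XY(1) c(8) [OF XY(2)]] p(8) [OF XY(2)] by simp
qed

lemma rep_sum:
  assumes \<A>: "cstar_subalgebra \<A>" and \<pi>: "unital_star_rep \<A> M \<pi>"
    and X: "\<And>i. i \<in> I \<Longrightarrow> X i \<in> \<A>"
  shows "(\<Sum>i\<in>I. X i) \<in> \<A>" "\<pi> (\<Sum>i\<in>I. X i) = (\<Sum>i\<in>I. \<pi> (X i))"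
proof -
  have "(\<Sum>i\<in>I. X i) \<in> \<A> \<and> \<pi> (\<Sum>i\<in>I. X i) = (\<Sum>i\<in>I. \<pi> (X i))"
    using X by (induction I rule: infinite_finite_induct)
      (simp_all add: cstar_subalgebraD [OF \<A>] unital_star_repD [OF \<pi>] rep_zero [OF \<A> \<pi>])
  then show "(\<Sum>i\<in>I. X i) \<in> \<A>" "\<pi> (\<Sum>i\<in>I. X i) = (\<Sum>i\<in>I. \<pi> (X i))" by auto
qed

text \<open>For \<open>norm Z \<le> 1/2\<close> the operator \<open>S = Z*Z\<close> has norm at most
  1/4, so \<open>1 - S = (1 - R)^2\<close> with \<open>R\<close> self-adjoint in the algebra.
  Applying \<open>\<pi>\<close> gives \<open>|x|^2 - |\<pi> Z x|^2 = |x - \<pi> R x|^2\<close>,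
  hence \<open>\<pi> Z\<close> is a contraction. The factor 2 arises because \<open>X\<close> is
  scaled to norm 1/2, where the square root is available.\<close>

lemma norm_rep_le:
  assumes \<A>: "cstar_subalgebra \<A>" "id_blinfun \<in> \<A>" and \<pi>: "unital_star_rep \<A> UNIV \<pi>"
    and X: "X \<in> \<A>"
  shows "norm (\<pi> X) \<le> 2 * norm X"
proof -
  note c = cstar_subalgebraD [OF \<A>(1)] and p = unital_star_repD [OF \<pi>]
  have contr: "norm (\<pi> Z) \<le> 1" if Z: "Z \<in> \<A>" "norm Z \<le> 1/2" for Z
  proof (rule norm_blinfun_bound)
    fix x
    define S where "S = adj Z o\<^sub>L Z"
    have SA: "S \<in> \<A>" unfolding S_def by (intro c Z)
    have Sadj: "adj S = S"
      unfolding S_def by (simp add: adj_compose adj_ops_on adj_adj c(1) Z)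
    have nadj: "norm (adj Z) \<le> 1/2"
    proof (rule norm_blinfun_bound)
      fix y
      have "(norm (blinfun_apply (adj Z) y))\<^sup>2
          = cmod (cinner (blinfun_apply (adj Z) y) (blinfun_apply (adj Z) y))"
        by (simp add: cinner_self norm_power)
      also have "\<dots> = cmod (cinner y (blinfun_apply Z (blinfun_apply (adj Z) y)))"
        by (simp add: cinner_adj_left c(1) Z)
      also have "\<dots> \<le> norm y * norm (blinfun_apply Z (blinfun_apply (adj Z) y))"
        by (rule cinner_Cauchy_Schwarz)
      also have "\<dots> \<le> norm y * (norm Z * norm (blinfun_apply (adj Z) y))"
        by (intro mult_left_mono norm_blinfun) simp
      also have "\<dots> \<le> norm y * (1/2 * norm (blinfun_apply (adj Z) y))"
        by (intro mult_left_mono mult_right_mono Z) simp_all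
      finally have "norm (blinfun_apply (adj Z) y) * norm (blinfun_apply (adj Z) y)
          \<le> (1/2 * norm y) * norm (blinfun_apply (adj Z) y)"
        by (simp add: power2_eq_square mult_ac)
      then show "norm (blinfun_apply (adj Z) y) \<le> 1/2 * norm y"
        by (cases "norm (blinfun_apply (adj Z) y) = 0") (simp_all add: mult_le_cancel_right)
    qed simp
    have "norm S \<le> 1/2 * (1/2)"
      unfolding S_def by (rule order_trans [OF norm_blinfun_compose]) (intro mult_mono nadj Z, auto)
    then have "norm S \<le> 1/4" by simp
    then obtain R where R: "R \<in> \<A>" "adj R = R" "R + R = S + (R o\<^sub>L R)"
      by (rule cstar_sqrt [OF \<A>(1) SA Sadj])
    define Y where "Y = id_blinfun - R"
    have piY: "\<pi> Y = id_blinfun - \<pi> R" using rep_diff [OF \<A>(1) \<pi> \<A>(2) R(1)] p(2)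
      by (simp add: Y_def)
    have "adj (\<pi> R) = \<pi> R" using p(9) [OF R(1)] R(2) by simp
    then have sR: "cinner (blinfun_apply (\<pi> R) u) v = cinner u (blinfun_apply (\<pi> R) v)" for u v
      using cinner_adj [OF p(3), OF R(1)] by metis
    have "\<pi> R + \<pi> R = \<pi> (S + (R o\<^sub>L R))" using p(5) [OF R(1) R(1)] R(3) by simp
    also have "\<dots> = \<pi> S + (\<pi> R o\<^sub>L \<pi> R)"
      by (simp only: p(5) [OF SA c(5) [OF R(1) R(1)]] p(6) [OF R(1) R(1)])
    also have "\<pi> S = adj (\<pi> Z) o\<^sub>L \<pi> Z"
      by (simp only: S_def p(6) [OF c(6) [OF Z(1)] Z(1)] p(9) [OF Z(1)])
    finally have e: "blinfun_apply (\<pi> R) x + blinfun_apply (\<pi> R) x =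
        blinfun_apply (adj (\<pi> Z)) (blinfun_apply (\<pi> Z) x)
        + blinfun_apply (\<pi> R) (blinfun_apply (\<pi> R) x)"
      by (metis blinfun.add_left blinfun_apply_blinfun_compose)
    let ?y = "x - blinfun_apply (\<pi> R) x" and ?z = "blinfun_apply (\<pi> Z) x"
    have "cinner ?y ?y = cinner x x - cinner x (blinfun_apply (\<pi> R) x + blinfun_apply (\<pi> R) x)
        + cinner x (blinfun_apply (\<pi> R) (blinfun_apply (\<pi> R) x))"
      by (simp add: cinner_diff_left cinner_diff_right cinner_add_right sR)
    also have "\<dots> = cinner x x - cinner ?z ?z"
      unfolding e cinner_add_right by (simp add: cinner_adj [OF p(3) [OF Z(1)], symmetric])
    finally have "(norm ?y)\<^sup>2 = (norm x)\<^sup>2 - (norm ?z)\<^sup>2"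
      unfolding cinner_self by (simp only: of_real_eq_iff of_real_diff [symmetric])
    then have "(norm ?z)\<^sup>2 \<le> (norm x)\<^sup>2" using zero_le_power2 [of "norm ?y"] by linarith
    then show "norm ?z \<le> 1 * norm x" by (auto intro: power2_le_imp_le)
  qed simp
  show ?thesis
  proof (cases "X = 0")
    case False
    define r where "r = 1 / (2 * norm X)"
    have r: "0 < r" using False by (simp add: r_def)
    have "norm (\<pi> (r *\<^sub>R X)) \<le> 1"
      by (intro contr c X) (use False in \<open>simp add: r_def\<close>)
    then have "r * norm (\<pi> X) \<le> 1" using r by (simp add: p X)
    then show ?thesis using False by (simp add: r_def field_simps)
  qed (simp add: rep_zero [OF \<A>(1) \<pi>])
qed

lemma rep_tendsto:
  assumes \<A>: "cstar_subalgebra \<A>" "id_blinfun \<in> \<A>" and \<pi>: "unital_star_rep \<A> UNIV \<pi>"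
    and X: "\<And>n. X n \<in> \<A>" "X \<longlonglongrightarrow> L"
  shows "(\<lambda>n. \<pi> (X n)) \<longlonglongrightarrow> \<pi> L"
proof -
  have L: "L \<in> \<A>" using closed_sequentially [OF cstar_subalgebraD(2) [OF \<A>(1)], of X] X by blast
  have "(\<lambda>n. 2 * norm (X n - L)) \<longlonglongrightarrow> 2 * 0"
    by (intro tendsto_mult tendsto_const tendsto_norm_zero LIM_zero X)
  then have z: "(\<lambda>n. 2 * norm (X n - L)) \<longlonglongrightarrow> 0" by simp
  have b: "norm (\<pi> (X n) - \<pi> L) \<le> 2 * norm (X n - L)" for n
    using norm_rep_le [OF \<A> \<pi> rep_diff(2) [OF \<A>(1) \<pi> X(1) L]]
    by (simp only: rep_diff(1) [OF \<A>(1) \<pi> X(1) L])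
  have "(\<lambda>n. \<pi> (X n) - \<pi> L) \<longlonglongrightarrow> 0"
    by (rule Lim_null_comparison [OF always_eventually z]) (intro allI b)
  then show ?thesis by (rule LIM_zero_cancel)
qed

lemma rep_sums:
  assumes \<A>: "cstar_subalgebra \<A>" "id_blinfun \<in> \<A>" and \<pi>: "unital_star_rep \<A> UNIV \<pi>"
    and X: "\<And>n. X n \<in> \<A>" "X sums L"
  shows "(\<lambda>n. \<pi> (X n)) sums \<pi> L"
proof -
  have "(\<lambda>n. \<pi> (\<Sum>i<n. X i)) \<longlonglongrightarrow> \<pi> L"
    using X by (intro rep_tendsto [OF \<A> \<pi>] rep_sum [OF \<A>(1) \<pi>]) (auto simp: sums_def)
  then show ?thesis by (simp add: sums_def rep_sum [OF \<A>(1) \<pi> X(1)])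
qed

text \<open>The empty word gives \<open>proj M\<close>, which is the image of the identity; this
  form covers both \<open>\<pi>\<close> and its restrictions to invariant subspaces.\<close>

lemma rep_word_op:
  assumes \<A>: "cstar_subalgebra \<A>" "id_blinfun \<in> \<A>" and \<pi>: "unital_star_rep \<A> M \<pi>"
    and X: "\<And>i. X i \<in> \<A>"
  shows "word_op UNIV X \<alpha> \<in> \<A>" "word_op M (\<lambda>i. \<pi> (X i)) \<alpha> = \<pi> (word_op UNIV X \<alpha>)"
proof -
  have "word_op UNIV X \<alpha> \<in> \<A> \<and> word_op M (\<lambda>i. \<pi> (X i)) \<alpha> = \<pi> (word_op UNIV X \<alpha>)"
    by (induction \<alpha>)
      (auto simp: word_op_def \<A> unital_star_repD [OF \<pi>] X cstar_subalgebraD(5) [OF \<A>(1)])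
  then show "word_op UNIV X \<alpha> \<in> \<A>" "word_op M (\<lambda>i. \<pi> (X i)) \<alpha> = \<pi> (word_op UNIV X \<alpha>)" by auto
qed

lemma rep_Delta_term:
  fixes X :: "'n::finite \<Rightarrow> _"
  assumes \<A>: "cstar_subalgebra \<A>" "id_blinfun \<in> \<A>" and \<pi>: "unital_star_rep \<A> M \<pi>"
    and X: "\<And>i. X i \<in> \<A>"
  shows "Delta_term UNIV a X k \<in> \<A>"
    and "Delta_term M a (\<lambda>i. \<pi> (X i)) k = \<pi> (Delta_term UNIV a X k)"
proof -
  note w = rep_word_op [OF \<A> \<pi>, of X, OF X]
  note c = cstar_subalgebraD [OF \<A>(1)] and p = unital_star_repD [OF \<pi>]
  have "a \<alpha> *\<^sub>R (word_op UNIV X \<alpha> o\<^sub>L adj (word_op UNIV X \<alpha>)) \<in> \<A>" for \<alpha> by (intro c w)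
  note s = rep_sum [OF \<A>(1) \<pi>, where X = "\<lambda>\<alpha>. a \<alpha> *\<^sub>R (word_op UNIV X \<alpha>
      o\<^sub>L adj (word_op UNIV X \<alpha>))", OF this]
  show "Delta_term UNIV a X k \<in> \<A>" unfolding Delta_term_def by (rule s)
  show "Delta_term M a (\<lambda>i. \<pi> (X i)) k = \<pi> (Delta_term UNIV a X k)"
    unfolding Delta_term_def s(2) by (simp add: w c p)
qed

lemma restrict_rep_apply [simp]:
  "blinfun_apply (restrict_rep \<pi> N X) x = blinfun_apply (\<pi> X) (blinfun_apply (proj N) x)"
  by (simp add: restrict_rep_def)

text \<open>The adjoint of \<open>X\<close> lies in the algebra too, so \<open>\<pi> X\<close> can
  be moved to the other side of the inner product without leaving \<open>N\<close>.\<close>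

lemma ocomp_invariant:
  assumes \<A>: "cstar_subalgebra \<A>" and \<pi>: "unital_star_rep \<A> UNIV \<pi>"
    and N: "\<And>X x. X \<in> \<A> \<Longrightarrow> x \<in> N \<Longrightarrow> blinfun_apply (\<pi> X) x \<in> N"
    and X: "X \<in> \<A>" and x: "x \<in> ocomp N"
  shows "blinfun_apply (\<pi> X) x \<in> ocomp N"
proof -
  have "cinner (blinfun_apply (\<pi> X) x) y = 0" if "y \<in> N" for y
  proof -
    have "cinner (blinfun_apply (\<pi> X) x) y = cinner x (blinfun_apply (\<pi> (adj X)) y)"
      by (simp add: cinner_adj [OF unital_star_repD(4) [OF \<pi> X]] unital_star_repD(9) [OF \<pi> X])
    also have "\<dots> = 0" using x N [OF cstar_subalgebraD(6) [OF \<A> X] that] by (auto simp: ocomp_def)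
    finally show ?thesis .
  qed
  then show ?thesis by (auto simp: ocomp_def)
qed

lemma restrict_rep_unital_star_rep:
  assumes \<A>: "cstar_subalgebra \<A>" and \<pi>: "unital_star_rep \<A> UNIV \<pi>"
    and N: "closed_csubspace N" "\<And>X x. X \<in> \<A> \<Longrightarrow> x \<in> N \<Longrightarrow> blinfun_apply (\<pi> X) x \<in> N"
  shows "unital_star_rep \<A> N (restrict_rep \<pi> N)"
proof -
  note c = cstar_subalgebraD [OF \<A>] and p = unital_star_repD [OF \<pi>]
  note pm = proj_mem [OF N(1)]
  have ops: "restrict_rep \<pi> N X \<in> ops_on N" if "X \<in> \<A>" for X
    using that N pm
    by (auto simp: ops_on_def proj_scaleC proj_ocomp ops_on_scaleC [OF p(3)] blinfun.zero_right)
  \<comment> \<open>Both \<open>N\<close> and its complement are invariant, so the projection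
    commutes with the representation. This is what makes adjoints survive the restriction.\<close>
  have commute: "blinfun_apply (proj N) (blinfun_apply (\<pi> X) x) =
      blinfun_apply (\<pi> X) (blinfun_apply (proj N) x)" if "X \<in> \<A>" for X x
  proof (rule proj_eqI [OF N(1) N(2) [OF that pm]])
    show "blinfun_apply (\<pi> X) x - blinfun_apply (\<pi> X) (blinfun_apply (proj N) x) \<in> ocomp N"
      unfolding blinfun.diff_right [symmetric]
      by (rule ocomp_invariant [OF \<A> \<pi> N(2) that diff_proj_mem_ocomp [OF N(1)]])
  qed
  have "restrict_rep \<pi> N (adj X) = adj (restrict_rep \<pi> N X)" if "X \<in> \<A>" for X
  proof (rule adj_eqI [symmetric, OF _ ops_on_subset_UNIV [OF ops [OF that]]])
    fix x y
    have "cinner (blinfun_apply (\<pi> X) (blinfun_apply (proj N) x)) y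
        = cinner (blinfun_apply (proj N) x) (blinfun_apply (\<pi> (adj X)) y)"
      by (simp add: p(9) that cinner_adj [OF p(3)])
    also have "\<dots> = cinner x (blinfun_apply (proj N) (blinfun_apply (\<pi> (adj X)) y))"
      using cinner_proj_left [OF N(1)] pm by (metis cinner_commute)
    finally show "cinner (blinfun_apply (restrict_rep \<pi> N X) x) y
        = cinner x (blinfun_apply (restrict_rep \<pi> N (adj X)) y)"
      by (simp add: commute c that)
  qed
  moreover have "restrict_rep \<pi> N id_blinfun = proj N"
    by (rule blinfun_eqI) (simp add: p(2))
  moreover have "restrict_rep \<pi> N (X + Y) = restrict_rep \<pi> N X + restrict_rep \<pi> N Y"
    "restrict_rep \<pi> N (X o\<^sub>L Y) = restrict_rep \<pi> N X o\<^sub>L restrict_rep \<pi> N Y"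
    "restrict_rep \<pi> N (cscale r X) = cscale r (restrict_rep \<pi> N X)" if "X \<in> \<A>" "Y \<in> \<A>" for X Y r
    using that by (auto intro!: blinfun_eqI simp: p blinfun.add_left proj_apply [OF N(1)] N(2) pm)
  ultimately show ?thesis using N(1) ops unfolding unital_star_rep_def by blast
qed

section \<open>Rank-one operators in the algebra of weighted creation operators\<close>

lemma norm_ell2_mono:
  assumes "\<And>\<alpha>. norm (coord f \<alpha>) \<le> norm (coord g \<alpha>)" shows "norm f \<le> norm g"
proof -
  have "(\<Sum>\<^sub>\<infinity>\<alpha>. (norm (coord f \<alpha>))\<^sup>2) \<le> (\<Sum>\<^sub>\<infinity>\<alpha>. (norm (coord g \<alpha>))\<^sup>2)"
    by (intro infsum_mono coord_summable power_mono assms) auto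
  then have "(norm f)\<^sup>2 \<le> (norm g)\<^sup>2" by (simp only: power2_norm_eq_inner inner_self_ell2_eq)
  then show ?thesis by (rule power2_le_imp_le) simp
qed

lemma coord_sum_ket:
  assumes "finite S"
  shows "coord (\<Sum>\<gamma>\<in>S. c \<gamma> *\<^sub>C ket \<gamma>) \<alpha> = (if \<alpha> \<in> S then c \<alpha> else 0)"
  using assms by (induction S rule: finite_induct)
    (auto simp: zero_ell2.rep_eq plus_ell2.rep_eq scaleC_ell2.rep_eq coord_ket scaleC_complex_def)

lemma closure_cspan_ket: "closure (cspan (range ket)) = UNIV"
proof -
  let ?M = "closure (cspan (range ket)) :: ('a, complex) ell2 set"
  have "f \<in> ?M" for f
  proof -
    obtain g where g: "g \<in> ?M" "f - g \<in> ocomp ?M"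
      using orth_decomp_exists [OF closed_csubspace_closure_cspan] by blast
    then have "cinner (f - g) (ket \<alpha>) = 0" for \<alpha> by (simp add: ocomp_closure_cspan_iff)
    then have "coord (f - g) \<alpha> = 0" for \<alpha>
      by (metis cinner_commute cinner_ket complex_cnj_cnj complex_cnj_zero)
    then have "f - g = 0" by (simp add: coord_inject [symmetric] fun_eq_iff zero_ell2.rep_eq)
    then show ?thesis using g by simp
  qed
  then show ?thesis by blast
qed

lemma finite_support_approx:
  fixes f :: "('a, complex) ell2"
  assumes "0 < e"
  obtains g where "norm (f - g) < e" "finite {\<alpha>. coord g \<alpha> \<noteq> 0}"
proof -
  have "csubspace {g :: ('a, complex) ell2. finite {\<alpha>. coord g \<alpha> \<noteq> 0}}"
    unfolding csubspace_def
  proof (intro conjI ballI allI)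
    fix g h :: "('a, complex) ell2"
    assume "g \<in> {g. finite {\<alpha>. coord g \<alpha> \<noteq> 0}}" "h \<in> {g. finite {\<alpha>. coord g \<alpha> \<noteq> 0}}"
    then show "g + h \<in> {g. finite {\<alpha>. coord g \<alpha> \<noteq> 0}}"
      by (auto simp: plus_ell2.rep_eq intro: finite_subset
            [of _ "{\<alpha>. coord g \<alpha> \<noteq> 0} \<union> {\<alpha>. coord h \<alpha> \<noteq> 0}"])
  qed
    (auto simp: zero_ell2.rep_eq scaleC_ell2.rep_eq scaleC_complex_def elim: finite_subset
        [rotated])
  moreover have "range ket \<subseteq> {g :: ('a, complex) ell2. finite {\<alpha>. coord g \<alpha> \<noteq> 0}}"
    by (auto simp: coord_ket)
  ultimately have sub: "cspan (range ket) \<subseteq> {g :: ('a, complex) ell2. finite {\<alpha>. coord g \<alpha> \<noteq> 0}}"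
    unfolding cspan_def by (intro hull_minimal)
  have "f \<in> closure (cspan (range ket))" by (simp add: closure_cspan_ket)
  then obtain g where "g \<in> cspan (range ket)" "dist g f < e"
    using assms closure_approachable by metis
  then show ?thesis using sub that by (auto simp: dist_norm norm_minus_commute)
qed

text \<open>Since \<open>coord f \<alpha>\<close> is the inner product of \<open>f\<close> with
  \<open>ket \<alpha>\<close>, the case \<open>\<alpha> = []\<close> is the operator
  \<open>E v\<close> of the overview.\<close>

definition rank_one :: "'a \<Rightarrow> ('a, complex) ell2 \<Rightarrow> (('a, complex) ell2 \<Rightarrow>\<^sub>L ('a, complex) ell2)" where
  "rank_one \<alpha> v = Blinfun (\<lambda>f. coord f \<alpha> *\<^sub>C v)"

lemma rank_one_apply [simp]: "blinfun_apply (rank_one \<alpha> v) f = coord f \<alpha> *\<^sub>C v"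
proof -
  have "bounded_linear (\<lambda>f :: ('a, complex) ell2. coord f \<alpha> *\<^sub>C v)"
  proof (rule bounded_linear_intro [where K = "norm v"])
    show "norm (coord f \<alpha> *\<^sub>C v) \<le> norm f * norm v" for f :: "('a, complex) ell2"
      using norm_coord_le [of f \<alpha>] by (simp add: mult_right_mono)
  qed (simp_all add: plus_ell2.rep_eq scaleR_ell2.rep_eq scaleC_add_left scaleC_scaleC [symmetric]
      scaleC_of_real scaleR_conv_of_real)
  then show ?thesis by (simp add: rank_one_def bounded_linear_Blinfun_apply)
qed

lemma rank_one_ops_on: "rank_one \<alpha> v \<in> ops_on UNIV"
  by (simp add: ops_on_UNIV_iff scaleC_ell2.rep_eq scaleC_scaleC scaleC_complex_def)

lemma rank_one_linear:
  "rank_one \<alpha> (v + w) = rank_one \<alpha> v + rank_one \<alpha> w"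
  "rank_one \<alpha> (c *\<^sub>C v) = cscale c (rank_one \<alpha> v)"
  "rank_one \<alpha> (r *\<^sub>R v) = r *\<^sub>R rank_one \<alpha> v"
  "rank_one \<alpha> 0 = 0"
  by (auto intro!: blinfun_eqI simp: blinfun.add_left scaleC_add_right scaleC_scaleC mult.commute
      blinfun.scaleR_left scaleC_scaleR)

lemma norm_rank_one_le: "norm (rank_one \<alpha> v) \<le> norm v"
proof (rule norm_blinfun_bound)
  show "norm (blinfun_apply (rank_one \<alpha> v) f) \<le> norm v * norm f" for f
    using mult_right_mono [OF norm_coord_le [of f \<alpha>], of "norm v"] by (simp add: mult.commute)
qed simp

lemma compose_rank_one: "X \<in> ops_on UNIV \<Longrightarrow> X o\<^sub>L rank_one \<alpha> v = rank_one \<alpha> (blinfun_apply X v)"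
  by (rule blinfun_eqI) (simp add: ops_on_UNIV_iff)

lemma adj_rank_one_apply: "blinfun_apply (adj (rank_one \<alpha> v)) f = cinner f v *\<^sub>C ket \<alpha>"
proof -
  have "cinner g (blinfun_apply (adj (rank_one \<alpha> v)) f) = cinner g (cinner f v *\<^sub>C ket \<alpha>)" for g
  proof -
    have "cinner g (blinfun_apply (adj (rank_one \<alpha> v)) f) = coord g \<alpha> * cinner v f"
      by (simp add: cinner_adj [OF rank_one_ops_on, symmetric] cinner_scaleC_left)
    also have "\<dots> = cinner g (cinner f v *\<^sub>C ket \<alpha>)"
      by (simp add: cinner_scaleC_right cinner_commute [of g "ket \<alpha>"] cinner_ket
          cinner_commute [of v f])
    finally show ?thesis .
  qed
  then show ?thesis by (metis cinner_commute cinner_eqI)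
qed

lemma adj_rank_one_compose:
  "adj (rank_one \<alpha> v) o\<^sub>L rank_one \<alpha> w = cscale (cinner w v) (rank_one \<alpha> (ket \<alpha>))"
  by (rule blinfun_eqI) (simp add: adj_rank_one_apply cinner_scaleC_left scaleC_scaleC mult.commute)

lemma adj_vacuum: "adj (rank_one \<alpha> (ket \<alpha>)) = rank_one \<alpha> (ket \<alpha>)"
  by (rule blinfun_eqI) (metis adj_rank_one_apply cinner_commute cinner_ket complex_cnj_cnj
      rank_one_apply)

text \<open>A hull over an empty family would be the whole type, which also contains maps that are
  only real-linear. The complex-linear operators are a member of the family, and they bound the hull
  from above.\<close>

lemma ops_on_UNIV_cstar_subalgebra: "cstar_subalgebra (ops_on UNIV)"
proof -
  have "ops_on UNIV = (\<Inter>c. \<Inter>x. {A :: 'a \<Rightarrow>\<^sub>L 'a.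
      blinfun_apply A (c *\<^sub>C x) = blinfun_apply (cscale c id_blinfun o\<^sub>L A) x})"
    by (auto simp: ops_on_UNIV_iff)
  moreover have "closed {A :: 'a \<Rightarrow>\<^sub>L 'a.
      blinfun_apply A (c *\<^sub>C x) = blinfun_apply (cscale c id_blinfun o\<^sub>L A) x}" for c x
    by (intro closed_Collect_eq linear_continuous_on blinfun.bounded_linear_left
        bounded_linear_compose [OF blinfun.bounded_linear_left]
        bounded_bilinear.bounded_linear_right [OF bounded_bilinear_blinfun_compose])
  ultimately have "closed (ops_on UNIV :: ('a \<Rightarrow>\<^sub>L 'a) set)" by (simp add: closed_INT)
  then show ?thesis
    by (simp add: cstar_subalgebra_def ops_on_add ops_on_compose adj_ops_on)
      (simp add: ops_on_UNIV_iff scaleC_scaleC mult.commute)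
qed

lemma hull_cstar_subalgebra:
  assumes "S \<subseteq> ops_on UNIV" shows "cstar_subalgebra (cstar_subalgebra hull S)"
proof -
  have "cstar_subalgebra hull S \<subseteq> ops_on UNIV"
    using assms ops_on_UNIV_cstar_subalgebra by (rule hull_minimal)
  moreover have "closed (cstar_subalgebra hull S)"
    unfolding hull_def by (rule closed_Inter) (auto simp: cstar_subalgebra_def)
  ultimately show ?thesis unfolding cstar_subalgebra_def hull_def by (auto simp: Ball_def)
qed

section \<open>The vacuum projection and the columns over it\<close>

locale weighted_fock =
  fixes b :: "'n::finite list \<Rightarrow> real"
  assumes admissible: "admissible b"
    and summable_Delta: "summable (Delta_term UNIV (nc_inverse b) (wcreation b))"
begin

lemma b_pos: "b \<alpha> > 0" and b_Nil: "b [] = 1"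
  using admissible by (auto simp: admissible_def)

lemma wcreation_ops_on: "wcreation b i \<in> ops_on UNIV"
  and wcreation_ket': "blinfun_apply (wcreation b i) (ket \<alpha>)
      = sqrt (b \<alpha> / b (i # \<alpha>)) *\<^sub>R ket (i # \<alpha>)"
  using admissible wcreation_in_ops_on [of b] wcreation_ket [of b] by (auto simp: admissible_def)

lemma cstar_W: "cstar_subalgebra (cstar_W b)"
  unfolding cstar_W_def using wcreation_ops_on
  by (intro hull_cstar_subalgebra) (auto simp: ops_on_UNIV_iff)

lemma id_in_cstar_W: "id_blinfun \<in> cstar_W b"
  and wcreation_in_cstar_W: "wcreation b i \<in> cstar_W b"
  unfolding cstar_W_def by (rule subsetD [OF hull_subset]; simp)+

lemma cstar_W_ops_on: "X \<in> cstar_W b \<Longrightarrow> X \<in> ops_on UNIV"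
  by (rule cstar_subalgebraD(1) [OF cstar_W])

text \<open>With the inclusion regarded as a representation, the membership statements proved for
  representations hold for the algebra itself before any \<open>\<pi>\<close> is given.\<close>

lemma identity_rep: "unital_star_rep (cstar_W b) UNIV (\<lambda>X. X)"
  using cstar_W_ops_on by (simp add: unital_star_rep_def closed_csubspace_UNIV)

lemmas word_in_cstar_W = rep_word_op(1) [OF cstar_W id_in_cstar_W identity_rep wcreation_in_cstar_W]

lemmas Delta_in_cstar_W = rep_Delta_term(1)
    [OF cstar_W id_in_cstar_W identity_rep wcreation_in_cstar_W]

text \<open>The quotients under the square roots telescope along the word, leaving only the first
  and the last coefficient.\<close>

lemma word_op_ket:
  "blinfun_apply (word_op UNIV (wcreation b) \<alpha>) (ket \<beta>) = sqrt (b \<beta> / b (\<alpha> @ \<beta>)) *\<^sub>R ket (\<alpha> @ \<beta>)"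
proof (induction \<alpha>)
  case Nil
  then show ?case using b_pos [of \<beta>] by (simp add: word_op_def)
next
  case (Cons i \<alpha>)
  then show ?case using b_pos [of "\<alpha> @ \<beta>"]
    by (simp add: word_op_Cons blinfun.scaleR_right wcreation_ket' flip: real_sqrt_mult)
qed

text \<open>The condition says that \<open>\<alpha>\<close> is a prefix of \<open>\<gamma>\<close>.
  Writing it with \<open>take\<close> and \<open>drop\<close> prepares for the factorisations in
  \<open>nc_mult\<close>.\<close>

lemma adj_word_op_ket:
  "blinfun_apply (adj (word_op UNIV (wcreation b) \<alpha>)) (ket \<gamma>) =
    (if take (length \<alpha>) \<gamma> = \<alpha>
     then sqrt (b (drop (length \<alpha>) \<gamma>) / b \<gamma>) *\<^sub>R ket (drop (length \<alpha>) \<gamma>) else 0)"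
proof -
  let ?W = "word_op UNIV (wcreation b) \<alpha>"
  have "coord (blinfun_apply (adj ?W) (ket \<gamma>)) \<beta> =
      (if \<alpha> @ \<beta> = \<gamma> then complex_of_real (sqrt (b \<beta> / b (\<alpha> @ \<beta>))) else 0)" for \<beta>
  proof -
    have "coord (blinfun_apply (adj ?W) (ket \<gamma>)) \<beta>
        = cnj (cinner (ket \<beta>) (blinfun_apply (adj ?W) (ket \<gamma>)))"
      by (simp add: cinner_ket)
    also have "\<dots> = cnj (cinner (blinfun_apply ?W (ket \<beta>)) (ket \<gamma>))"
      by (simp add: cinner_adj [OF cstar_W_ops_on [OF word_in_cstar_W]])
    also have "\<dots> = (if \<alpha> @ \<beta> = \<gamma> then complex_of_real (sqrt (b \<beta> / b (\<alpha> @ \<beta>))) else 0)"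
      by (auto simp: word_op_ket cinner_scaleR_left cinner_ket coord_ket)
    finally show ?thesis .
  qed
  moreover have "(if \<alpha> @ \<beta> = \<gamma> then complex_of_real (sqrt (b \<beta> / b (\<alpha> @ \<beta>))) else 0) =
      (if take (length \<alpha>) \<gamma> = \<alpha> \<and> \<beta> = drop (length \<alpha>) \<gamma>
       then complex_of_real (sqrt (b \<beta> / b \<gamma>)) else 0)" for \<beta>
    by (metis append_eq_conv_conj append_take_drop_id)
  ultimately show ?thesis
    by (auto simp: coord_inject [symmetric] fun_eq_iff scaleR_ell2.rep_eq coord_ket zero_ell2.rep_eq
        scaleR_conv_of_real)
qed

lemma word_op_adj_ket:
  "blinfun_apply (word_op UNIV (wcreation b) \<alpha> o\<^sub>L adj (word_op UNIV (wcreation b) \<alpha>)) (ket \<gamma>) =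
    (if take (length \<alpha>) \<gamma> = \<alpha> then (b (drop (length \<alpha>) \<gamma>) / b \<gamma>) *\<^sub>R ket \<gamma> else 0)"
proof (cases "take (length \<alpha>) \<gamma> = \<alpha>")
  case True
  then have "\<alpha> @ drop (length \<alpha>) \<gamma> = \<gamma>" by (metis append_take_drop_id)
  with True show ?thesis using b_pos [of "drop (length \<alpha>) \<gamma>"] b_pos [of \<gamma>]
    by (simp add: adj_word_op_ket word_op_ket blinfun.scaleR_right)
qed (simp add: adj_word_op_ket blinfun.zero_right)

text \<open>Of all words of length \<open>k\<close> only the prefix of \<open>\<gamma>\<close>
  contributes, and its factor is the \<open>k\<close>-th summand of
  \<open>nc_mult a b \<gamma>\<close> divided by \<open>b \<gamma>\<close>. A word has no prefix
  longer than itself, so on each basis vector the series is a finite sum.\<close>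

lemma Delta_term_ket:
  "blinfun_apply (Delta_term UNIV a (wcreation b) k) (ket \<gamma>) =
    (if k \<le> length \<gamma> then (a (take k \<gamma>) * b (drop k \<gamma>) / b \<gamma>) *\<^sub>R ket \<gamma> else 0)"
proof -
  have "blinfun_apply (Delta_term UNIV a (wcreation b) k) (ket \<gamma>) =
      (\<Sum>\<alpha> | length \<alpha> = k. if take k \<gamma> = \<alpha> then (a \<alpha> * (b (drop k \<gamma>) / b \<gamma>)) *\<^sub>R ket \<gamma> else 0)"
    unfolding Delta_term_def blinfun.sum_left blinfun.scaleR_left word_op_adj_ket
    by (rule sum.cong) auto
  then show ?thesis by (simp add: finite_words)
qed

lemma Delta_sums_vacuum:
  "Delta_term UNIV (nc_inverse b) (wcreation b) sums rank_one [] (ket [])"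
proof -
  let ?\<Delta> = "Delta_term UNIV (nc_inverse b) (wcreation b)"
  have s: "?\<Delta> sums suminf ?\<Delta>" by (rule summable_sums [OF summable_Delta])
  \<comment> \<open>Membership of the limit in the algebra yields its complex linearity, without
    which values on the basis vectors would not determine it.\<close>
  have "(\<Sum>i<n. ?\<Delta> i) \<in> cstar_W b" for n
    by (rule rep_sum(1) [OF cstar_W identity_rep Delta_in_cstar_W])
  then have "suminf ?\<Delta> \<in> cstar_W b"
    using s closed_sequentially [OF cstar_subalgebraD(2) [OF cstar_W], of "\<lambda>n. \<Sum>i<n. ?\<Delta> i"]
    by (auto simp: sums_def)
  then have "suminf ?\<Delta> \<in> ops_on UNIV" by (rule cstar_W_ops_on)
  moreover have "blinfun_apply (suminf ?\<Delta>) (ket \<gamma>) = blinfun_apply (rank_one [] (ket [])) (ket \<gamma>)"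
    for \<gamma>
  proof -
    have "(\<lambda>k. blinfun_apply (?\<Delta> k) (ket \<gamma>)) sums blinfun_apply (suminf ?\<Delta>) (ket \<gamma>)"
      by (rule bounded_linear.sums [OF blinfun.bounded_linear_left s])
    moreover have "(\<lambda>k. blinfun_apply (?\<Delta> k) (ket \<gamma>)) sums
        (\<Sum>k\<le>length \<gamma>. blinfun_apply (?\<Delta> k) (ket \<gamma>))"
      by (rule sums_finite) (auto simp: Delta_term_ket)
    moreover have "(\<Sum>k\<le>length \<gamma>. blinfun_apply (?\<Delta> k) (ket \<gamma>)) =
        (nc_mult (nc_inverse b) b \<gamma> / b \<gamma>) *\<^sub>R ket \<gamma>"
      by (simp add: Delta_term_ket nc_mult_def sum_divide_distrib flip: scaleR_sum_left)
    ultimately have "blinfun_apply (suminf ?\<Delta>) (ket \<gamma>) = (nc_one \<gamma> / b \<gamma>) *\<^sub>R ket \<gamma>"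
      using sums_unique2 by (metis nc_mult_inverse_left b_Nil)
    then show ?thesis by (auto simp: nc_one_def b_Nil coord_ket)
  qed
  ultimately have "suminf ?\<Delta> = rank_one [] (ket [])" by (rule ops_eqI_ket [OF _ rank_one_ops_on])
  then show ?thesis using s by simp
qed

lemma vacuum_in_cstar_W: "rank_one [] (ket []) \<in> cstar_W b"
proof -
  have "(\<Sum>i<n. Delta_term UNIV (nc_inverse b) (wcreation b) i) \<in> cstar_W b" for n
    by (rule rep_sum(1) [OF cstar_W identity_rep Delta_in_cstar_W])
  then show ?thesis
    using Delta_sums_vacuum closed_sequentially [OF cstar_subalgebraD(2) [OF cstar_W],
        of "\<lambda>n. \<Sum>i<n. Delta_term UNIV (nc_inverse b) (wcreation b) i"]
    by (auto simp: sums_def)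
qed

lemma ket_eq_word: "ket \<beta> = sqrt (b \<beta>) *\<^sub>R blinfun_apply (word_op UNIV (wcreation b) \<beta>) (ket [])"
  using b_pos [of \<beta>] by (simp add: word_op_ket b_Nil flip: real_sqrt_mult)

lemma rank_one_in_cstar_W: "rank_one [] v \<in> cstar_W b"
proof -
  note c = cstar_subalgebraD [OF cstar_W]
  \<comment> \<open>As \<open>v \<mapsto> E v\<close> is continuous and the algebra is closed, the
    admissible \<open>v\<close> form a closed set; it is a subspace, so the basis vectors
    suffice.\<close>
  have "bounded_linear (\<lambda>v. rank_one ([] :: 'n list) v)"
    by (rule bounded_linear_intro [where K = 1]) (simp_all add: rank_one_linear norm_rank_one_le)
  then have "closed {v. rank_one [] v \<in> cstar_W b}"
    using closed_vimage [OF c(2) linear_continuous_on, of "rank_one []"]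
    by (simp add: vimage_def)
  then have "closed_csubspace {v. rank_one [] v \<in> cstar_W b}"
    by (simp add: closed_csubspace_def csubspace_def rank_one_linear c)
  moreover have "rank_one [] (ket \<beta>) \<in> cstar_W b" for \<beta>
  proof -
    have "rank_one [] (ket \<beta>) = sqrt (b \<beta>) *\<^sub>R (word_op UNIV (wcreation b) \<beta>
        o\<^sub>L rank_one [] (ket []))"
      by (subst ket_eq_word)
        (simp only: rank_one_linear compose_rank_one [OF cstar_W_ops_on [OF word_in_cstar_W]])
    also have "\<dots> \<in> cstar_W b" by (intro c word_in_cstar_W vacuum_in_cstar_W)
    finally show ?thesis .
  qed
  ultimately have "closure (cspan (range ket)) \<subseteq> {v. rank_one [] v \<in> cstar_W b}"
    by (intro closure_cspan_minimal) auto
  then show ?thesis by (auto simp: closure_cspan_ket)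
qed

end

text \<open>
  The coordinate projections onto finite sets of words form an approximate unit for the compact
  operators.
\<close>

lemma compact_op_approx:
  fixes X :: "('a, complex) ell2 \<Rightarrow>\<^sub>L ('a, complex) ell2"
  assumes X: "compact_op X" and e: "0 < e"
  obtains S where "finite S"
    "norm (X - ((\<Sum>\<gamma>\<in>S. rank_one \<alpha> (ket \<gamma>) o\<^sub>L adj (rank_one \<alpha> (ket \<gamma>))) o\<^sub>L X)) \<le> e"
proof -
  have "compact (closure (blinfun_apply X ` cball 0 1))" using X by (simp add: compact_op_def)
  moreover have e3: "0 < e / 3" using e by simp
  ultimately obtain k where k: "finite k" "closure (blinfun_apply X ` cball 0 1)
      \<subseteq> (\<Union>f\<in>k. ball f (e/3))"
    unfolding compact_eq_totally_bounded by blast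
  obtain g where g: "\<And>f :: ('a, complex) ell2. norm (f - g f) < e / 3"
      "\<And>f. finite {\<alpha>. coord (g f) \<alpha> \<noteq> 0}"
    using finite_support_approx [OF e3] by metis
  \<comment> \<open>\<open>S\<close> contains the support of the approximation \<open>g h\<close>
    for each point \<open>h\<close> of a finite e/3-net of the image of the unit ball. All these
    vectors are fixed by \<open>F\<close>, and the two errors of e/3 add up to less than
    \<open>e\<close>.\<close>
  define S where "S = (\<Union>f\<in>k. {\<alpha>. coord (g f) \<alpha> \<noteq> 0})"
  have S: "finite S" unfolding S_def using k(1) g(2) by blast
  \<comment> \<open>Each summand is the projection onto \<open>ket \<gamma>\<close>, whatever
    \<open>\<alpha>\<close> is. The factorised form lets a representation act on the left
    factor.\<close>
  define F where "F = (\<Sum>\<gamma>\<in>S. rank_one \<alpha> (ket \<gamma>) o\<^sub>L adj (rank_one \<alpha> (ket \<gamma>)))"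
  have cF: "coord (f - blinfun_apply F f) \<beta> = (if \<beta> \<in> S then 0 else coord f \<beta>)" for f \<beta>
  proof -
    have "cinner f (ket \<gamma>) = coord f \<gamma>" for \<gamma> by (metis cinner_commute cinner_ket complex_cnj_cnj)
    then have "blinfun_apply F f = (\<Sum>\<gamma>\<in>S. coord f \<gamma> *\<^sub>C ket \<gamma>)"
      by (simp add: F_def blinfun.sum_left adj_rank_one_apply scaleC_ell2.rep_eq coord_ket
            scaleC_complex_def)
    then show ?thesis by (simp add: minus_ell2.rep_eq coord_sum_ket [OF S])
  qed
  have contr: "norm (f - blinfun_apply F f) \<le> norm f" for f
    by (rule norm_ell2_mono) (simp add: cF)
  have "norm (X - (F o\<^sub>L X)) \<le> e"
  proof (rule norm_blinfun_bound)
    fix x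
    have unit: "norm (blinfun_apply (X - (F o\<^sub>L X)) y) \<le> e" if y: "norm y \<le> 1" for y
    proof -
      let ?f = "blinfun_apply X y"
      have "?f \<in> closure (blinfun_apply X ` cball 0 1)"
        using y by (intro subsetD [OF closure_subset]) auto
      then obtain h where h: "h \<in> k" "dist h ?f < e / 3" using k(2) by auto
      have "g h - blinfun_apply F (g h) = 0"
        using h(1) by (auto simp: coord_inject [symmetric] fun_eq_iff cF zero_ell2.rep_eq S_def)
      then have "?f - blinfun_apply F ?f = (?f - g h) - blinfun_apply F (?f - g h)"
        by (simp add: blinfun.diff_right)
      then have "norm (?f - blinfun_apply F ?f) \<le> norm (?f - g h)" using contr by metis
      also have "\<dots> \<le> norm (?f - h) + norm (h - g h)"
        by (metis norm_triangle_ineq diff_add_cancel add_diff_eq)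
      also have "\<dots> \<le> e" using h(2) g(1) [of h] e by (simp add: dist_norm norm_minus_commute)
      finally show ?thesis by (simp add: blinfun.diff_left)
    qed
    show "norm (blinfun_apply (X - (F o\<^sub>L X)) x) \<le> e * norm x"
    proof (cases "x = 0")
      case False
      have "norm (blinfun_apply (X - (F o\<^sub>L X)) (inverse (norm x) *\<^sub>R x)) \<le> e"
        by (rule unit) (use False in simp)
      then have "inverse (norm x) * norm (blinfun_apply (X - (F o\<^sub>L X)) x) \<le> e"
        by (simp only: blinfun.scaleR_right norm_scaleR abs_inverse abs_norm_cancel)
      then show ?thesis using False by (simp add: field_simps)
    qed (simp add: blinfun.zero_right)
  qed (use e in simp)
  with S show ?thesis unfolding F_def by (rule that)
qed

section \<open>Intertwining unitaries\<close>

text \<open>With \<open>U\<close> extended to a bounded operator \<open>T\<close>, the relation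
  \<open>T A = B T\<close> holds on a closed subspace, so generators decide it.\<close>

lemma intertwine_closure_cspan:
  assumes M: "closed_csubspace M" "M = closure (cspan S)" and U: "unitary_between M N U"
    and A: "\<And>c x. blinfun_apply A (c *\<^sub>C x) = c *\<^sub>C blinfun_apply A x"
      "\<And>x. x \<in> M \<Longrightarrow> blinfun_apply A x \<in> M"
    and B: "\<And>c x. blinfun_apply B (c *\<^sub>C x) = c *\<^sub>C blinfun_apply B x"
    and S: "\<And>x. x \<in> S \<Longrightarrow> U (blinfun_apply A x) = blinfun_apply B (U x)"
    and x: "x \<in> M"
  shows "U (blinfun_apply A x) = blinfun_apply B (U x)"
proof -
  obtain T where T: "\<And>c x. blinfun_apply T (c *\<^sub>C x) = c *\<^sub>C blinfun_apply T x"
    "\<And>x. x \<in> M \<Longrightarrow> blinfun_apply T x = U x" by (rule unitary_between_blinfun [OF M(1) U]) blast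
  have SM: "S \<subseteq> M" unfolding M(2) by (rule cspan_closure_superset)
  have "closure (cspan S) \<subseteq> {x. blinfun_apply (T o\<^sub>L A) x = blinfun_apply (B o\<^sub>L T) x}"
    using SM S A(2)
    by (intro closure_cspan_minimal closed_csubspace_eq) (auto simp: T A(1) B subset_iff)
  then show ?thesis using x A(2) M(2) by (auto simp: T)
qed

text \<open>Invariance of \<open>M\<close> is required because \<open>inv_into\<close> undoes
  \<open>U\<close> only on vectors of \<open>M\<close>.\<close>

lemma unitarily_equivalent_sym:
  assumes M: "csubspace M" and inv: "\<And>X x. X \<in> \<A> \<Longrightarrow> x \<in> M \<Longrightarrow> blinfun_apply (\<pi> X) x \<in> M"
    and "unitarily_equivalent \<A> M \<pi> N \<rho>"
  shows "unitarily_equivalent \<A> N \<rho> M \<pi>"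
proof -
  obtain U where U: "unitary_between M N U"
    "\<And>X x. X \<in> \<A> \<Longrightarrow> x \<in> M \<Longrightarrow> U (blinfun_apply (\<pi> X) x) = blinfun_apply (\<rho> X) (U x)"
    using assms(3) unfolding unitarily_equivalent_def by blast
  have "inv_into M U (blinfun_apply (\<rho> X) y) = blinfun_apply (\<pi> X) (inv_into M U y)"
    if X: "X \<in> \<A>" and y: "y \<in> N" for X y
  proof -
    obtain x where "x \<in> M" "y = U x" using y U(1) by (auto simp: unitary_between_def)
    then show ?thesis
      using U(2) [OF X] inv [OF X] inv_into_f_f [OF unitary_between_inj_on [OF M U(1)]] by metis
  qed
  then show ?thesis unfolding unitarily_equivalent_def
    using unitary_between_inverse [OF M U(1)] by blast
qed

lemma unitarily_equivalent_trans:
  assumes "unitarily_equivalent \<A> M \<pi> N \<rho>" "unitarily_equivalent \<A> N \<rho> L \<sigma>"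
  shows "unitarily_equivalent \<A> M \<pi> L \<sigma>"
proof -
  obtain U V where "unitary_between M N U" "unitary_between N L V"
    "\<forall>X\<in>\<A>. \<forall>x\<in>M. U (blinfun_apply (\<pi> X) x) = blinfun_apply (\<rho> X) (U x)"
    "\<forall>X\<in>\<A>. \<forall>x\<in>N. V (blinfun_apply (\<rho> X) x) = blinfun_apply (\<sigma> X) (V x)"
    using assms unfolding unitarily_equivalent_def by blast
  then show ?thesis unfolding unitarily_equivalent_def
    by (intro exI [of _ "\<lambda>x. V (U x)"])
      (auto intro: unitary_between_compose simp: unitary_between_def)
qed

section \<open>The Wold decomposition\<close>

locale wold_rep = weighted_fock b for b :: "'n::finite list \<Rightarrow> real" +
  fixes \<pi> :: "('n fock \<Rightarrow>\<^sub>L 'n fock) \<Rightarrow> ('k::complex_hilbert \<Rightarrow>\<^sub>L 'k)"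
  assumes rep: "unital_star_rep (cstar_W b) UNIV \<pi>"
begin

text \<open>The image of the vacuum projection is easier to compute with than the series;
  \<open>rep_defect_eq\<close> identifies the two.\<close>

definition defect :: "'k \<Rightarrow>\<^sub>L 'k" where "defect = \<pi> (rank_one [] (ket []))"

definition defect_space :: "'k set" where "defect_space = range (blinfun_apply defect)"

text \<open>For \<open>y\<close> in \<open>defect_space\<close>, the vector
  \<open>rep_col v y\<close> plays the part of the elementary tensor of \<open>v\<close> and
  \<open>y\<close> inside the representation space.\<close>

definition rep_col :: "'n fock \<Rightarrow> 'k \<Rightarrow>\<^sub>L 'k" where "rep_col v = \<pi> (rank_one [] v)"

lemmas alg = cstar_subalgebraD [OF cstar_W]
lemmas repD = unital_star_repD [OF rep]

lemma rep_scaleC: "X \<in> cstar_W b \<Longrightarrow> blinfun_apply (\<pi> X) (c *\<^sub>C x) = c *\<^sub>C blinfun_apply (\<pi> X) x"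
  by (rule ops_on_scaleC [OF repD(3)])

lemma Delta_rep_sums: "Delta_term UNIV (nc_inverse b) (\<lambda>i. \<pi> (wcreation b i)) sums defect"
  unfolding defect_def rep_Delta_term(2) [OF cstar_W id_in_cstar_W rep wcreation_in_cstar_W]
  by (rule rep_sums [OF cstar_W id_in_cstar_W rep Delta_in_cstar_W Delta_sums_vacuum])

lemma rep_defect_eq: "rep_defect b \<pi> = defect"
  unfolding rep_defect_def Delta_def using Delta_rep_sums by (rule sums_unique [symmetric])

lemma defect_scaleC: "blinfun_apply defect (c *\<^sub>C x) = c *\<^sub>C blinfun_apply defect x"
  unfolding defect_def by (rule rep_scaleC [OF vacuum_in_cstar_W])

lemma rep_col_ket_Nil: "rep_col (ket []) = defect"
  by (simp add: rep_col_def defect_def)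

lemma rep_rep_col:
  "X \<in> cstar_W b \<Longrightarrow> blinfun_apply (\<pi> X) (blinfun_apply (rep_col v) y)
      = blinfun_apply (rep_col (blinfun_apply X v)) y"
  unfolding rep_col_def
  by (simp add: compose_rank_one [OF cstar_W_ops_on, symmetric] repD rank_one_in_cstar_W)

text \<open>\<open>E v\<close> does not change when the vacuum projection is applied first, so only
  the component of \<open>x\<close> in the defect space matters.\<close>

lemma rep_col_defect: "blinfun_apply (rep_col v) (blinfun_apply defect x)
    = blinfun_apply (rep_col v) x"
  unfolding defect_def rep_col_def
  using rep_rep_col [OF rank_one_in_cstar_W, of v "ket []" x] by (simp add: rep_col_def coord_ket)

lemma defect_idem: "blinfun_apply defect (blinfun_apply defect x) = blinfun_apply defect x"
  using rep_col_defect [of "ket []"] by (simp add: rep_col_ket_Nil)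

lemma mem_defect_space_iff: "y \<in> defect_space \<longleftrightarrow> blinfun_apply defect y = y"
  unfolding defect_space_def by (metis defect_idem rangeE rangeI)

text \<open>The range of an idempotent is the set of its fixed points, which is an equaliser of
  bounded operators.\<close>

lemma closed_csubspace_defect_space: "closed_csubspace defect_space"
proof -
  have "defect_space = {y. blinfun_apply defect y = blinfun_apply id_blinfun y}"
    by (auto simp: mem_defect_space_iff)
  then show ?thesis by (simp only:) (intro closed_csubspace_eq defect_scaleC, simp)
qed

lemma adj_defect: "adj defect = defect"
  unfolding defect_def by (simp add: repD(9) [OF vacuum_in_cstar_W, symmetric] adj_vacuum)

lemma cinner_defect: "cinner (blinfun_apply defect x) y = cinner x (blinfun_apply defect y)"
  using cinner_adj [OF repD(3) [OF vacuum_in_cstar_W]] adj_defect by (simp add: defect_def)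

lemma cinner_rep_col:
  assumes "y \<in> defect_space" "z \<in> defect_space"
  shows "cinner (blinfun_apply (rep_col v) y) (blinfun_apply (rep_col w) z)
      = cinner v w * cinner y z"
proof -
  note v = rank_one_in_cstar_W [of v] and w = rank_one_in_cstar_W [of w]
  have "cinner (blinfun_apply (rep_col v) y) (blinfun_apply (rep_col w) z) =
      cinner y (blinfun_apply (\<pi> (adj (rank_one [] v)) o\<^sub>L \<pi> (rank_one [] w)) z)"
    by (simp add: rep_col_def cinner_adj [OF repD(3) [OF v]] repD(9) [OF v])
  also have "\<dots> = cinner y (blinfun_apply (cscale (cinner w v) defect) z)"
    by (simp only: repD(6) [OF alg(6) [OF v] w, symmetric] adj_rank_one_compose defect_def
        repD(7) [OF vacuum_in_cstar_W])
  also have "\<dots> = cinner v w * cinner y z"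
    using assms by (simp add: mem_defect_space_iff cinner_scaleC_right cinner_commute [of w v])
  finally show ?thesis .
qed

text \<open>Continuity is in \<open>v\<close> for fixed \<open>y\<close>: it carries statements from
  basis vectors to arbitrary Fock space vectors. The constant 2 comes from
  \<open>norm_rep_le\<close>.\<close>

lemma bounded_linear_rep_col: "bounded_linear (\<lambda>v. blinfun_apply (rep_col v) y)"
proof (rule bounded_linear_intro [where K = "2 * norm y"])
  note r = rank_one_in_cstar_W
  fix v w :: "'n fock" and c :: real
  show "blinfun_apply (rep_col (v + w)) y = blinfun_apply (rep_col v) y
      + blinfun_apply (rep_col w) y"
    by (simp add: rep_col_def rank_one_linear repD r blinfun.add_left)
  show "blinfun_apply (rep_col (c *\<^sub>R v)) y = c *\<^sub>R blinfun_apply (rep_col v) y"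
    by (simp add: rep_col_def rank_one_linear repD r blinfun.scaleR_left)
  have "norm (rep_col v) \<le> 2 * norm v"
    unfolding rep_col_def
    using norm_rep_le [OF cstar_W id_in_cstar_W rep r [of v]] norm_rank_one_le
        [of "[] :: 'n list" v]
    by linarith
  then have "norm (blinfun_apply (rep_col v) y) \<le> 2 * norm v * norm y"
    by (meson norm_blinfun mult_right_mono norm_ge_zero order_trans)
  then show "norm (blinfun_apply (rep_col v) y) \<le> norm v * (2 * norm y)" by (simp add: mult_ac)
qed

lemma rep_col_scaleC_left: "blinfun_apply (rep_col (c *\<^sub>C v)) y = c *\<^sub>C blinfun_apply (rep_col v) y"
  by (simp add: rep_col_def rank_one_linear repD rank_one_in_cstar_W)

text \<open>The vectors defining \<open>K0\<close> are the columns with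
  \<open>v = W\<beta> e0\<close>, a multiple of a basis vector, and continuity in \<open>v\<close>
  adds the remaining columns. In this description invariance under the whole algebra is evident,
  because an element of the algebra acts on \<open>v\<close> alone.\<close>

lemma K0_eq: "K0 b \<pi> = closure (cspan ((\<lambda>(v, y). blinfun_apply (rep_col v) y) ` (UNIV \<times> defect_space)))"
  (is "_ = closure (cspan ?G)")
proof (rule antisym)
  note w = word_in_cstar_W
  have K0: "K0 b \<pi> = closure (cspan {blinfun_apply (\<pi> (word_op UNIV (wcreation b) \<beta>))
      (blinfun_apply defect x) | \<beta> x. True})"
    by (simp add: K0_def rep_defect_eq)
  have gen: "blinfun_apply (\<pi> (word_op UNIV (wcreation b) \<beta>)) (blinfun_apply defect x)
      = blinfun_apply (rep_col (blinfun_apply (word_op UNIV (wcreation b) \<beta>) (ket []))) x" for \<beta> x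
    by (simp add: rep_rep_col [OF w, symmetric] rep_col_ket_Nil)
  have RQ: "blinfun_apply defect x \<in> defect_space" for x by (simp add: defect_space_def)
  show "K0 b \<pi> \<subseteq> closure (cspan ?G)" unfolding K0 gen
  proof (intro closure_cspan_minimal closed_csubspace_closure_cspan subsetI)
    fix z assume "z \<in> {blinfun_apply
      (rep_col (blinfun_apply (word_op UNIV (wcreation b) \<beta>) (ket []))) x | \<beta> x. True}"
    then obtain v x where "z = blinfun_apply (rep_col v) x" by blast
    then have "z = blinfun_apply (rep_col v) (blinfun_apply defect x)" by (simp add: rep_col_defect)
    then have "z \<in> ?G" using RQ by force
    then show "z \<in> closure (cspan ?G)" using cspan_closure_superset [of ?G] by blast
  qed
  show "closure (cspan ?G) \<subseteq> K0 b \<pi>"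
  proof (intro closure_cspan_minimal)
    show K: "closed_csubspace (K0 b \<pi>)" unfolding K0 by (rule closed_csubspace_closure_cspan)
    have "blinfun_apply (rep_col v) y \<in> K0 b \<pi>" if y: "y \<in> defect_space" for v y
    proof -
      let ?L = "Blinfun (\<lambda>v. blinfun_apply (rep_col v) y)"
      have L: "blinfun_apply ?L v = blinfun_apply (rep_col v) y" for v
        using bounded_linear_rep_col by (simp add: bounded_linear_Blinfun_apply)
      have "range ket \<subseteq> {v. blinfun_apply ?L v \<in> K0 b \<pi>}"
      proof (intro subsetI CollectI, unfold L)
        fix v :: "'n fock" assume "v \<in> range ket"
        then obtain \<beta> where v: "v = ket \<beta>" by blast
        have "blinfun_apply (rep_col (blinfun_apply (word_op UNIV (wcreation b) \<beta>) (ket []))) y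
            \<in> K0 b \<pi>"
          unfolding gen [symmetric] K0 by (rule subsetD [OF cspan_closure_superset]) blast
        moreover have "blinfun_apply (rep_col v) y = sqrt (b \<beta>) *\<^sub>R
            blinfun_apply (rep_col (blinfun_apply (word_op UNIV (wcreation b) \<beta>) (ket []))) y"
          unfolding v by (subst ket_eq_word) (rule linear_simps(5) [OF bounded_linear_rep_col])
        ultimately show "blinfun_apply (rep_col v) y \<in> K0 b \<pi>"
          using K by (simp add: closed_csubspace_def csubspace_scaleR)
      qed
      moreover have "closed_csubspace {v. blinfun_apply ?L v \<in> K0 b \<pi>}"
        by (rule closed_csubspace_vimage [OF _ K]) (simp add: L rep_col_scaleC_left)
      ultimately have "closure (cspan (range ket)) \<subseteq> {v. blinfun_apply ?L v \<in> K0 b \<pi>}"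
        by (rule closure_cspan_minimal)
      then show ?thesis by (auto simp: closure_cspan_ket L)
    qed
    then show "?G \<subseteq> K0 b \<pi>" by auto
  qed
qed

section \<open>The two summands\<close>

lemma closed_csubspace_K0: "closed_csubspace (K0 b \<pi>)"
  unfolding K0_eq by (rule closed_csubspace_closure_cspan)

lemma closed_csubspace_K1: "closed_csubspace (K1 b \<pi>)"
  unfolding K1_def by (rule closed_csubspace_ocomp)

lemma rep_col_in_K0: "blinfun_apply (rep_col v) y \<in> K0 b \<pi>"
proof -
  have "blinfun_apply (rep_col v) (blinfun_apply defect y)
      \<in> (\<lambda>(v, y). blinfun_apply (rep_col v) y) ` (UNIV \<times> defect_space)"
    by (force simp: defect_space_def)
  from subsetD [OF cspan_closure_superset this] show ?thesis by (simp only: K0_eq rep_col_defect)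
qed

lemma K0_invariant:
  assumes X: "X \<in> cstar_W b" and x: "x \<in> K0 b \<pi>"
  shows "blinfun_apply (\<pi> X) x \<in> K0 b \<pi>"
proof -
  have "K0 b \<pi> \<subseteq> {x. blinfun_apply (\<pi> X) x \<in> K0 b \<pi>}"
    by (subst K0_eq, intro closure_cspan_minimal closed_csubspace_vimage closed_csubspace_K0
        rep_scaleC [OF X]) (auto simp: rep_rep_col [OF X] rep_col_in_K0)
  then show ?thesis using x by blast
qed

lemma K1_invariant: "X \<in> cstar_W b \<Longrightarrow> x \<in> K1 b \<pi> \<Longrightarrow> blinfun_apply (\<pi> X) x \<in> K1 b \<pi>"
  unfolding K1_def by (rule ocomp_invariant [OF cstar_W rep K0_invariant])

lemma defect_K1: "x \<in> K1 b \<pi> \<Longrightarrow> blinfun_apply defect x = 0"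
proof -
  assume x: "x \<in> K1 b \<pi>"
  have "blinfun_apply defect (blinfun_apply defect x) \<in> K0 b \<pi>" using rep_col_in_K0 [of "ket []"]
    by (simp add: rep_col_ket_Nil)
  then have "cinner x (blinfun_apply defect (blinfun_apply defect x)) = 0" using x
    by (simp add: K1_def ocomp_def)
  then have "cinner (blinfun_apply defect x) (blinfun_apply defect x) = 0"
    by (simp add: cinner_defect)
  then show ?thesis by (simp add: cinner_self)
qed

lemma rep_col_K1: "x \<in> K1 b \<pi> \<Longrightarrow> blinfun_apply (rep_col v) x = 0"
  by (metis rep_col_defect defect_K1 blinfun.zero_right)

lemma rep_K0: "unital_star_rep (cstar_W b) (K0 b \<pi>) (restrict_rep \<pi> (K0 b \<pi>))"
  by (rule restrict_rep_unital_star_rep [OF cstar_W rep closed_csubspace_K0 K0_invariant])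

lemma rep_K1: "unital_star_rep (cstar_W b) (K1 b \<pi>) (restrict_rep \<pi> (K1 b \<pi>))"
  by (rule restrict_rep_unital_star_rep [OF cstar_W rep closed_csubspace_K1 K1_invariant])

lemma K0_K1_sum:
  "x = blinfun_apply (proj (K0 b \<pi>)) x + blinfun_apply (proj (K1 b \<pi>)) x"
  by (simp add: K1_def proj_ocomp_eq [OF closed_csubspace_K0])

lemma direct_sum:
  "is_direct_sum_rep (cstar_W b) UNIV \<pi> (K0 b \<pi>) (restrict_rep \<pi> (K0 b \<pi>))
    (K1 b \<pi>) (restrict_rep \<pi> (K1 b \<pi>))"
  unfolding is_direct_sum_rep_def
proof (intro conjI ballI)
  show "cinner x y = 0" if "x \<in> K0 b \<pi>" "y \<in> K1 b \<pi>" for x y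
    using that unfolding K1_def by (rule ocomp_orthogonal)
  show "UNIV = {x + y |x y. x \<in> K0 b \<pi> \<and> y \<in> K1 b \<pi>}"
    using K0_K1_sum proj_mem [OF closed_csubspace_K0] proj_mem [OF closed_csubspace_K1] by blast
  show "\<pi> X = restrict_rep \<pi> (K0 b \<pi>) X + restrict_rep \<pi> (K1 b \<pi>) X" for X
    by (rule blinfun_eqI) (simp add: blinfun.add_left flip: blinfun.add_right K0_K1_sum)
qed

text \<open>Each term is the corresponding term for \<open>\<pi>\<close> followed on the right by
  the projection onto \<open>K1\<close>, so convergence is inherited and the sum is the defect
  restricted to \<open>K1\<close>, which is zero.\<close>

lemma Delta_K1_sums:
  "Delta_term (K1 b \<pi>) (nc_inverse b) (\<lambda>i. restrict_rep \<pi> (K1 b \<pi>) (wcreation b i)) sums 0"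
proof -
  let ?P = "proj (K1 b \<pi>)"
  have eq: "Delta_term (K1 b \<pi>) (nc_inverse b) (\<lambda>i. restrict_rep \<pi> (K1 b \<pi>) (wcreation b i)) k
      = Delta_term UNIV (nc_inverse b) (\<lambda>i. \<pi> (wcreation b i)) k o\<^sub>L ?P" for k
    unfolding rep_Delta_term(2) [OF cstar_W id_in_cstar_W rep_K1 wcreation_in_cstar_W]
      rep_Delta_term(2) [OF cstar_W id_in_cstar_W rep wcreation_in_cstar_W]
    by (rule restrict_rep_def)
  have "(\<lambda>k. Delta_term UNIV (nc_inverse b) (\<lambda>i. \<pi> (wcreation b i)) k o\<^sub>L ?P) sums (defect o\<^sub>L ?P)"
    by (rule bounded_linear.sums [OF bounded_bilinear.bounded_linear_left
          [OF bounded_bilinear_blinfun_compose] Delta_rep_sums])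
  moreover have "defect o\<^sub>L ?P = 0"
    by (rule blinfun_eqI) (simp add: defect_K1 proj_mem [OF closed_csubspace_K1])
  ultimately show ?thesis unfolding sums_cong [OF eq] by (simp only:)
qed

text \<open>\<open>X\<close> is within \<open>e\<close> of \<open>F X\<close>, where
  \<open>F\<close> is a finite sum of products \<open>E v (E v)*\<close>. On \<open>K1\<close> the
  inner factors stay in this invariant subspace and the outer factor \<open>\<pi> (E v)\<close>
  kills it, so only the error of norm at most \<open>2 e\<close> is left.\<close>

lemma compact_K1:
  assumes X: "X \<in> cstar_W b" "compact_op X"
  shows "restrict_rep \<pi> (K1 b \<pi>) X = 0"
proof (rule blinfun_eqI)
  fix u
  define x where "x = blinfun_apply (proj (K1 b \<pi>)) u"
  have x: "x \<in> K1 b \<pi>" unfolding x_def by (rule proj_mem [OF closed_csubspace_K1])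
  have "norm (blinfun_apply (\<pi> X) x) \<le> 2 * e * norm x" if e: "0 < e" for e :: real
  proof -
    obtain S where S: "finite S"
      "norm (X - ((\<Sum>\<gamma>\<in>S. rank_one [] (ket \<gamma>) o\<^sub>L adj (rank_one [] (ket \<gamma>))) o\<^sub>L X)) \<le> e"
      by (rule compact_op_approx [OF X(2) e])
    define F where "F = (\<Sum>\<gamma>\<in>S. rank_one [] (ket \<gamma>) o\<^sub>L adj (rank_one ([] :: 'n list) (ket \<gamma>)))"
    note r = rank_one_in_cstar_W
    have t: "rank_one [] (ket \<gamma>) o\<^sub>L adj (rank_one [] (ket \<gamma>)) \<in> cstar_W b" for \<gamma> by (intro alg r)
    have F: "F \<in> cstar_W b" unfolding F_def by (rule rep_sum(1) [OF cstar_W rep t])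
    have "blinfun_apply (\<pi> (rank_one [] (ket \<gamma>) o\<^sub>L adj (rank_one [] (ket \<gamma>)))) y = 0"
      if y: "y \<in> K1 b \<pi>" for y \<gamma>
      using rep_col_K1 [OF K1_invariant [OF alg(6) [OF r] y]]
      by (simp add: repD(6) alg r rep_col_def)
    then have "blinfun_apply (\<pi> F) (blinfun_apply (\<pi> X) x) = 0"
      unfolding F_def rep_sum(2) [OF cstar_W rep t] blinfun.sum_left
      using K1_invariant [OF X(1) x] by simp
    then have "blinfun_apply (\<pi> X) x = blinfun_apply (\<pi> (X - (F o\<^sub>L X))) x"
      by (simp add: rep_diff(1) [OF cstar_W rep X(1) alg(5) [OF F X(1)]] repD(6) F X(1)
            blinfun.diff_left)
    also have "norm \<dots> \<le> norm (\<pi> (X - (F o\<^sub>L X))) * norm x" by (rule norm_blinfun)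
    also have "\<dots> \<le> (2 * norm (X - (F o\<^sub>L X))) * norm x"
      by (intro mult_right_mono norm_rep_le [OF cstar_W id_in_cstar_W rep]
          rep_diff(2) [OF cstar_W rep X(1) alg(5) [OF F X(1)]]) simp
    also have "\<dots> \<le> 2 * e * norm x" using S(2) by (intro mult_right_mono) (simp_all add: F_def)
    finally show ?thesis .
  qed
  note b = this
  have "norm (blinfun_apply (\<pi> X) x) \<le> 0"
  proof (rule field_le_epsilon)
    fix e :: real assume "0 < e"
    \<comment> \<open>The denominator turns the bound into at most \<open>e\<close>; adding 1 keeps
      it positive when \<open>x = 0\<close>.\<close>
    then have "norm (blinfun_apply (\<pi> X) x) \<le> 2 * (e / (2 * (norm x + 1))) * norm x"
      by (intro b) (simp add: add_nonneg_pos)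
    also have "\<dots> = e * (norm x / (norm x + 1))" by (simp add: field_simps add_nonneg_eq_0_iff)
    also have "\<dots> \<le> e * 1" using \<open>0 < e\<close>
      by (intro mult_left_mono) (simp_all add: divide_le_eq add_nonneg_pos)
    finally show "norm (blinfun_apply (\<pi> X) x) \<le> 0 + e" by simp
  qed
  then show "blinfun_apply (restrict_rep \<pi> (K1 b \<pi>) X) u = blinfun_apply 0 u" by (simp add: x_def)
qed

lemma disjoint:
  "disjoint_reps (cstar_W b) (K0 b \<pi>) (restrict_rep \<pi> (K0 b \<pi>)) (K1 b \<pi>) (restrict_rep \<pi> (K1 b \<pi>))"
  unfolding disjoint_reps_def
proof (intro notI, elim exE conjE)
  fix M N
  let ?\<pi>0 = "restrict_rep \<pi> (K0 b \<pi>)" and ?\<pi>1 = "restrict_rep \<pi> (K1 b \<pi>)"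
  assume M: "subrep_space (cstar_W b) (K0 b \<pi>) ?\<pi>0 M" "M \<noteq> {0}"
    and N: "subrep_space (cstar_W b) (K1 b \<pi>) ?\<pi>1 N"
    and eq: "unitarily_equivalent (cstar_W b) M (restrict_rep ?\<pi>0 M) N (restrict_rep ?\<pi>1 N)"
  obtain U where U: "unitary_between M N U" and tw: "\<And>X x. X \<in> cstar_W b \<Longrightarrow> x \<in> M \<Longrightarrow>
      U (blinfun_apply (restrict_rep ?\<pi>0 M X) x) = blinfun_apply (restrict_rep ?\<pi>1 N X) (U x)"
    using eq unfolding unitarily_equivalent_def by blast
  have Mc: "closed_csubspace M" "M \<subseteq> K0 b \<pi>" using M by (auto simp: subrep_space_def)
  have Nc: "closed_csubspace N" "N \<subseteq> K1 b \<pi>" using N by (auto simp: subrep_space_def)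
  have pM: "blinfun_apply (restrict_rep ?\<pi>0 M X) x = blinfun_apply (\<pi> X) x" if "x \<in> M" for X x
    using that Mc by (auto simp: proj_apply [OF Mc(1)] proj_apply [OF closed_csubspace_K0])
  have pN: "blinfun_apply (restrict_rep ?\<pi>1 N X) x = blinfun_apply (\<pi> X) x" if "x \<in> N" for X x
    using that Nc by (auto simp: proj_apply [OF Nc(1)] proj_apply [OF closed_csubspace_K1])
  have Minv: "blinfun_apply (\<pi> X) x \<in> M" if "X \<in> cstar_W b" "x \<in> M" for X x
  proof -
    have "blinfun_apply (?\<pi>0 X) x \<in> M" using M(1) that by (simp add: subrep_space_def)
    then show ?thesis using that Mc by (auto simp: proj_apply [OF closed_csubspace_K0])
  qed
  have QM: "blinfun_apply defect x = 0" if x: "x \<in> M" for x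
  proof -
    have UN: "U x \<in> N" using unitary_betweenD(4) [OF U x x] .
    have "U (blinfun_apply defect x) = blinfun_apply defect (U x)"
      using tw [OF vacuum_in_cstar_W x] by (simp only: pM [OF x] pN [OF UN] defect_def)
    also have "\<dots> = 0" using UN Nc by (intro defect_K1) auto
    finally have "norm (U (blinfun_apply defect x)) = 0" by simp
    moreover have "blinfun_apply defect x \<in> M" unfolding defect_def
      by (rule Minv [OF vacuum_in_cstar_W x])
    ultimately show ?thesis by (simp add: unitary_between_norm [OF U])
  qed
  have "x = 0" if x: "x \<in> M" for x
  proof (rule ocomp_Int)
    show "x \<in> K0 b \<pi>" using x Mc by auto
    have "cinner x (blinfun_apply (rep_col v) y) = 0" if "y \<in> defect_space" for v y
    proof -
      have "cinner x (blinfun_apply (rep_col v) y)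
          = cinner (blinfun_apply (\<pi> (adj (rank_one [] v))) x) (blinfun_apply defect y)"
        using that unfolding mem_defect_space_iff rep_col_def
        by (simp add: repD(9) rank_one_in_cstar_W cinner_adj_left [OF repD(4)])
      also have "\<dots> = cinner (blinfun_apply defect (blinfun_apply (\<pi> (adj (rank_one [] v))) x)) y"
        by (simp add: cinner_defect)
      also have "\<dots> = 0" using QM Minv [OF alg(6) [OF rank_one_in_cstar_W] x] by simp
      finally show ?thesis .
    qed
    then show "x \<in> ocomp (K0 b \<pi>)" by (auto simp: K0_eq ocomp_closure_cspan_iff)
  qed
  moreover have "0 \<in> M" using Mc by (auto simp: closed_csubspace_def csubspace_def)
  ultimately show False using M(2) by blast
qed

text \<open>The defect space itself is a multiplicity space: by \<open>cinner_rep_col\<close> the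
  columns have the Gram matrix of the elementary tensors.\<close>

lemma multiplicity_space_defect_space: "multiplicity_space b \<pi> defect_space"
proof -
  let ?T = "ell2_tensor defect_space :: ('n list, 'k) ell2 set"
  let ?g = "\<lambda>(v, y). blinfun_apply (rep_col v) y" and ?f = "\<lambda>(v, y). tens v y :: ('n list, 'k) ell2"
  have "cinner (?g i) (?g j) = cinner (?f i) (?f j)"
    if "i \<in> UNIV \<times> defect_space" "j \<in> UNIV \<times> defect_space" for i j
    using that by (auto simp: cinner_rep_col cinner_tens)
  then obtain U where U0: "unitary_between (closure (cspan (?f ` (UNIV \<times> defect_space))))
      (closure (cspan (?g ` (UNIV \<times> defect_space)))) U"
    and Ut: "\<And>i. i \<in> UNIV \<times> defect_space \<Longrightarrow> U (?f i) = ?g i"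
    by (rule unitary_between_extend) blast+
  have "?f ` (UNIV \<times> defect_space) = {tens x y |x y. y \<in> defect_space}" by auto
  then have U: "unitary_between ?T (K0 b \<pi>) U"
    using U0 unfolding K0_eq by (simp add: ell2_tensor_eq [OF closed_csubspace_defect_space])
  have cT: "closed_csubspace ?T" by (rule closed_ell2_tensor [OF closed_csubspace_defect_space])
  then have sT: "csubspace ?T" by (simp add: closed_csubspace_def)
  define V where "V = inv_into ?T U"
  have V: "unitary_between (K0 b \<pi>) ?T V" unfolding V_def
    by (rule unitary_between_inverse [OF sT U])
  have VU: "V (U t) = t" if "t \<in> ?T" for t
    unfolding V_def by (rule inv_into_f_f [OF unitary_between_inj_on [OF sT U] that])
  have UV: "U (V x) = x" if "x \<in> K0 b \<pi>" for x
    unfolding V_def by (rule f_inv_into_f) (use that U in \<open>simp add: unitary_between_def\<close>)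
  obtain BU where BU: "\<And>x. blinfun_apply BU x = U (blinfun_apply (proj ?T) x)"
    "\<And>c x. blinfun_apply BU (c *\<^sub>C x) = c *\<^sub>C blinfun_apply BU x"
    "\<And>x. x \<in> ?T \<Longrightarrow> blinfun_apply BU x = U x" by (rule unitary_between_blinfun [OF cT U]) blast
  obtain BV where BV: "\<And>x. blinfun_apply BV x = V (blinfun_apply (proj (K0 b \<pi>)) x)"
    "\<And>c x. blinfun_apply BV (c *\<^sub>C x) = c *\<^sub>C blinfun_apply BV x"
    "\<And>x. x \<in> K0 b \<pi> \<Longrightarrow> blinfun_apply BV x = V x"
      by (rule unitary_between_blinfun [OF closed_csubspace_K0 V]) blast
  \<comment> \<open>Transporting \<open>\<pi>\<close> with the extended operators, rather than with
    \<open>U\<close> and \<open>V\<close>, makes \<open>\<rho> X\<close> vanish on the complement of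
    the tensor product, as the encoding of operators on a subspace demands.\<close>
  define \<rho> where "\<rho> X = BV o\<^sub>L \<pi> X o\<^sub>L BU" for X
  have UK: "blinfun_apply BU x \<in> K0 b \<pi>" for x
    unfolding BU(1) by (rule unitary_betweenD(4) [OF U]) (rule proj_mem [OF cT])+
  have amp: "is_ampliation defect_space X (\<rho> X)" if X: "X \<in> cstar_W b" for X
    unfolding is_ampliation_def
  proof (intro conjI allI ballI)
    have "blinfun_apply BU x = 0" if "x \<in> ocomp ?T" for x
    proof -
      have "norm (blinfun_apply BU x) = norm (blinfun_apply (proj ?T) x)"
        unfolding BU(1) by (rule unitary_between_norm [OF U proj_mem [OF cT]])
      then show ?thesis by (simp add: proj_ocomp [OF cT that])
    qed
    moreover have "blinfun_apply BV x \<in> ?T" for x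
      unfolding BV(1) by (rule unitary_betweenD(4) [OF V]) (rule proj_mem [OF closed_csubspace_K0])+
    ultimately show "\<rho> X \<in> ops_on ?T"
      by (simp add: ops_on_def \<rho>_def BU(2) BV(2) rep_scaleC [OF X] blinfun.zero_right)
  next
    fix x y assume y: "y \<in> defect_space"
    have tT: "tens z y \<in> ?T" for z :: "'n fock"
      using y closed_csubspace_defect_space
      by (auto simp: ell2_tensor_def tens.rep_eq closed_csubspace_def csubspace_def)
    have Uz: "U (tens z y) = blinfun_apply (rep_col z) y" for z using Ut [of "(z, y)"] y by simp
    have "blinfun_apply (\<rho> X) (tens x y) = blinfun_apply BV (blinfun_apply (rep_col (blinfun_apply X x)) y)"
      by (simp add: \<rho>_def BU(3) [OF tT] Uz rep_rep_col [OF X])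
    also have "\<dots> = V (U (tens (blinfun_apply X x) y))" by (simp add: BV(3) [OF rep_col_in_K0] Uz)
    finally show "blinfun_apply (\<rho> X) (tens x y) = tens (blinfun_apply X x) y"
      by (simp add: VU [OF tT])
  qed
  have "unitarily_equivalent (cstar_W b) (K0 b \<pi>) (restrict_rep \<pi> (K0 b \<pi>)) ?T \<rho>"
    unfolding unitarily_equivalent_def
  proof (intro exI [of _ V] conjI ballI V)
    fix X x assume X: "X \<in> cstar_W b" and x: "x \<in> K0 b \<pi>"
    have "V x \<in> ?T" by (rule unitary_betweenD(4) [OF V x x])
    then show "V (blinfun_apply (restrict_rep \<pi> (K0 b \<pi>) X) x) = blinfun_apply (\<rho> X) (V x)"
      by (simp add: \<rho>_def BU(3) UV [OF x] BV(3) [OF K0_invariant [OF X x]] proj_apply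
            [OF closed_csubspace_K0 x])
  qed
  moreover have "closure (range (blinfun_apply (rep_defect b \<pi>))) = defect_space"
    using closed_csubspace_defect_space
    by (simp add: rep_defect_eq defect_space_def [symmetric] closed_csubspace_def)
  moreover have "same_dim defect_space defect_space"
    unfolding same_dim_iff_unitary [OF closed_csubspace_defect_space]
    by (intro exI [of _ "\<lambda>x. x"]) (simp add: unitary_between_def)
  ultimately show ?thesis
    unfolding multiplicity_space_def using amp closed_csubspace_defect_space by auto
qed

end

section \<open>Classification up to unitary equivalence\<close>

lemma unitary_between_sym:
  assumes "closed_csubspace M" "unitary_between M N U"
  obtains V where "unitary_between N M V"
  using unitary_between_inverse assms by (auto simp: closed_csubspace_def)

text \<open>An intertwiner carries defect operators, hence both summands, into each other.\<close>

lemma unitarily_equivalent_parts: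
  assumes "wold_rep b \<pi>" "wold_rep b \<pi>'"
    and eq: "unitarily_equivalent (cstar_W b) UNIV \<pi> UNIV \<pi>'"
  obtains J where "unitary_between (wold_rep.defect_space \<pi>) (wold_rep.defect_space \<pi>') J"
    and "unitarily_equivalent (cstar_W b) (K1 b \<pi>) (restrict_rep \<pi> (K1 b \<pi>))
             (K1 b \<pi>') (restrict_rep \<pi>' (K1 b \<pi>'))"
proof -
  interpret P: wold_rep b \<pi> by fact
  interpret P': wold_rep b \<pi>' by fact
  obtain U where U: "unitary_between UNIV UNIV U"
    and tw: "\<And>X x. X \<in> cstar_W b \<Longrightarrow> U (blinfun_apply (\<pi> X) x) = blinfun_apply (\<pi>' X) (U x)"
    using eq unfolding unitarily_equivalent_def by blast
  have surj: "\<exists>x. y = U x" for y using U by (auto simp: unitary_between_def)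
  have UQ: "U (blinfun_apply P.defect x) = blinfun_apply P'.defect (U x)" for x
    unfolding P.defect_def P'.defect_def by (rule tw [OF P.vacuum_in_cstar_W])
  have UT: "U (blinfun_apply (P.rep_col v) x) = blinfun_apply (P'.rep_col v) (U x)" for v x
    unfolding P.rep_col_def P'.rep_col_def by (rule tw [OF P.rank_one_in_cstar_W])
  have UR: "U ` P.defect_space = P'.defect_space"
    unfolding P.defect_space_def P'.defect_space_def using surj UQ by (auto simp: image_iff) metis
  then have J: "unitary_between P.defect_space P'.defect_space U" using U
    by (simp add: unitary_between_def)
  have cU: "cinner (U x) (U y) = cinner x y" for x y using unitary_betweenD(3) [OF U] by simp
  \<comment> \<open>Membership in \<open>K1\<close> means orthogonality to all
    \<open>rep_col v y\<close>, and \<open>U\<close> carries these vectors to those of the second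
    representation because it maps one defect space onto the other.\<close>
  have K1: "U x \<in> K1 b \<pi>' \<longleftrightarrow> x \<in> K1 b \<pi>" for x
  proof -
    have "x \<in> K1 b \<pi> \<longleftrightarrow> (\<forall>v. \<forall>y\<in>P.defect_space. cinner x (blinfun_apply (P.rep_col v) y) = 0)"
      by (auto simp: K1_def P.K0_eq ocomp_closure_cspan_iff)
    also have "\<dots> \<longleftrightarrow> (\<forall>v. \<forall>y\<in>P.defect_space. cinner (U x) (blinfun_apply (P'.rep_col v) (U y)) = 0)"
      by (simp add: UT [symmetric] cU)
    also have "\<dots> \<longleftrightarrow> U x \<in> K1 b \<pi>'"
      by (auto simp: K1_def P'.K0_eq ocomp_closure_cspan_iff UR [symmetric])
    finally show ?thesis by blast
  qed
  have "U ` K1 b \<pi> = K1 b \<pi>'"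
  proof
    show "U ` K1 b \<pi> \<subseteq> K1 b \<pi>'" using K1 by blast
    show "K1 b \<pi>' \<subseteq> U ` K1 b \<pi>" using K1 surj by (metis image_eqI subsetI)
  qed
  then have UK1: "unitary_between (K1 b \<pi>) (K1 b \<pi>') U" using U by (simp add: unitary_between_def)
  have "unitarily_equivalent (cstar_W b) (K1 b \<pi>) (restrict_rep \<pi> (K1 b \<pi>))
      (K1 b \<pi>') (restrict_rep \<pi>' (K1 b \<pi>'))"
    unfolding unitarily_equivalent_def
    by (intro exI [of _ U] conjI UK1)
      (simp add: proj_apply [OF P.closed_csubspace_K1] proj_apply [OF P'.closed_csubspace_K1] K1 tw)
  then show ?thesis by (rule that [OF J])
qed

text \<open>The unitary is \<open>I \<otimes> J\<close>. An ampliation is prescribed on elementary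
  tensors only, which span a dense subspace, so the intertwining relation is checked there.\<close>

lemma ampliation_equivalent:
  fixes G :: "'g::complex_hilbert set" and G' :: "'h::complex_hilbert set"
    and \<rho> :: "(('a, complex) ell2 \<Rightarrow>\<^sub>L ('a, complex) ell2) \<Rightarrow> (('a, 'g) ell2 \<Rightarrow>\<^sub>L ('a, 'g) ell2)"
    and \<rho>' :: "(('a, complex) ell2 \<Rightarrow>\<^sub>L ('a, complex) ell2) \<Rightarrow> (('a, 'h) ell2 \<Rightarrow>\<^sub>L ('a, 'h) ell2)"
  assumes G: "closed_csubspace G" and G': "closed_csubspace G'" and J: "unitary_between G G' J"
    and \<rho>: "\<And>X. X \<in> \<A> \<Longrightarrow> is_ampliation G X (\<rho> X)"
    and \<rho>': "\<And>X. X \<in> \<A> \<Longrightarrow> is_ampliation G' X (\<rho>' X)"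
  shows "unitarily_equivalent \<A> (ell2_tensor G) \<rho> (ell2_tensor G') \<rho>'"
proof -
  let ?I = "UNIV \<times> G :: (('a, complex) ell2 \<times> 'g) set"
  let ?f = "\<lambda>(v, y). tens v y :: ('a, 'g) ell2" and ?g = "\<lambda>(v, y). tens v (J y) :: ('a, 'h) ell2"
  have "cinner (?g i) (?g j) = cinner (?f i) (?f j)" if "i \<in> ?I" "j \<in> ?I" for i j
    using that by (auto simp: cinner_tens unitary_betweenD(3) [OF J])
  then obtain U where U0: "unitary_between (closure (cspan (?f ` ?I))) (closure (cspan (?g ` ?I))) U"
    and Ut: "\<And>i. i \<in> ?I \<Longrightarrow> U (?f i) = ?g i"
    by (rule unitary_between_extend) blast+
  have f: "closure (cspan (?f ` ?I)) = ell2_tensor G"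
  proof -
    have "?f ` ?I = {tens x y |x y. y \<in> G}" by auto
    then show ?thesis by (simp add: ell2_tensor_eq [OF G])
  qed
  have g: "closure (cspan (?g ` ?I)) = ell2_tensor G'"
  proof -
    have "?g ` ?I = {tens x y |x y. y \<in> J ` G}" by auto
    then show ?thesis using J by (simp add: ell2_tensor_eq [OF G'] unitary_between_def)
  qed
  have U: "unitary_between (ell2_tensor G) (ell2_tensor G') U" using U0 by (simp only: f g)
  have "U (blinfun_apply (\<rho> X) x) = blinfun_apply (\<rho>' X) (U x)" if X: "X \<in> \<A>"
    and x: "x \<in> ell2_tensor G" for X x
  proof (rule intertwine_closure_cspan [OF closed_ell2_tensor [OF G] f [symmetric] U _ _ _ _ x])
    have amp: "\<rho> X \<in> ops_on (ell2_tensor G)" "\<rho>' X \<in> ops_on (ell2_tensor G')"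
      "\<And>v y. y \<in> G \<Longrightarrow> blinfun_apply (\<rho> X) (tens v y) = tens (blinfun_apply X v) y"
      "\<And>v y. y \<in> G' \<Longrightarrow> blinfun_apply (\<rho>' X) (tens v y) = tens (blinfun_apply X v) y"
      using \<rho> [OF X] \<rho>' [OF X] by (auto simp: is_ampliation_def)
    show "blinfun_apply (\<rho> X) (c *\<^sub>C x) = c *\<^sub>C blinfun_apply (\<rho> X) x"
      "blinfun_apply (\<rho>' X) (c *\<^sub>C y) = c *\<^sub>C blinfun_apply (\<rho>' X) y" for c x y
      using amp by (simp_all add: ops_on_scaleC)
    show "blinfun_apply (\<rho> X) x \<in> ell2_tensor G" for x using amp(1) by (simp add: ops_on_def)
    show "U (blinfun_apply (\<rho> X) z) = blinfun_apply (\<rho>' X) (U z)" if z: "z \<in> ?f ` ?I" for z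
    proof -
      obtain v y where z: "z = tens v y" "y \<in> G" using z by auto
      have Uv: "U (tens w y) = tens w (J y)" for w :: "('a, complex) ell2"
        using Ut [of "(w, y)"] z(2) by simp
      have "J y \<in> G'" using unitary_betweenD(4) [OF J z(2) z(2)] .
      then show ?thesis by (simp add: z amp Uv)
    qed
  qed
  then show ?thesis unfolding unitarily_equivalent_def using U by blast
qed

text \<open>The two unitaries are glued to their orthogonal sum \<open>W\<close>; the cross terms
  vanish because their ranges are orthogonal.\<close>

lemma unitarily_equivalent_ocomp:
  fixes M :: "'k::complex_hilbert set" and N :: "'l::complex_hilbert set"
  assumes M: "closed_csubspace M" and N: "closed_csubspace N"
    and inv: "\<And>X x. X \<in> \<A> \<Longrightarrow> x \<in> M \<Longrightarrow> blinfun_apply (\<pi> X) x \<in> M"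
      "\<And>X x. X \<in> \<A> \<Longrightarrow> x \<in> ocomp M \<Longrightarrow> blinfun_apply (\<pi> X) x \<in> ocomp M"
    and eq0: "unitarily_equivalent \<A> M (restrict_rep \<pi> M) N (restrict_rep \<rho> N)"
    and eq1: "unitarily_equivalent \<A> (ocomp M) (restrict_rep \<pi> (ocomp M)) (ocomp N) (restrict_rep \<rho> (ocomp N))"
  shows "unitarily_equivalent \<A> UNIV \<pi> UNIV \<rho>"
proof -
  note M1 = closed_csubspace_ocomp [of M] and N1 = closed_csubspace_ocomp [of N]
  let ?p = "blinfun_apply (proj M)" and ?q = "blinfun_apply (proj (ocomp M))"
  obtain U where U: "unitary_between M N U"
    "\<And>X x. X \<in> \<A> \<Longrightarrow> x \<in> M \<Longrightarrow> U (blinfun_apply (restrict_rep \<pi> M X) x)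
        = blinfun_apply (restrict_rep \<rho> N X) (U x)"
    using eq0 unfolding unitarily_equivalent_def by blast
  obtain V where V: "unitary_between (ocomp M) (ocomp N) V"
    "\<And>X x. X \<in> \<A> \<Longrightarrow> x \<in> ocomp M \<Longrightarrow> V (blinfun_apply (restrict_rep \<pi> (ocomp M) X) x)
      = blinfun_apply (restrict_rep \<rho> (ocomp N) X) (V x)"
    using eq1 unfolding unitarily_equivalent_def by blast
  note p = proj_mem [OF M] and q = proj_mem [OF M1]
  note Up = unitary_betweenD [OF U(1) p p] and Vq = unitary_betweenD [OF V(1) q q]
  have split: "x = ?p x + ?q x" for x by (simp add: proj_ocomp_eq [OF M])
  have pq: "?p (x + y) = x" "?q (x + y) = y" if "x \<in> M" "y \<in> ocomp M" for x y
    using that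
    by (simp_all add: blinfun.add_right proj_apply [OF M] proj_ocomp [OF M] proj_ocomp_eq [OF M])
  define W where "W x = U (?p x) + V (?q x)" for x
  have orth: "cinner (U (?p x)) (V (?q y)) = 0" "cinner (V (?q y)) (U (?p x)) = 0" for x y
  proof -
    show "cinner (U (?p x)) (V (?q y)) = 0" by (rule ocomp_orthogonal [OF Up(4) Vq(4)])
    then show "cinner (V (?q y)) (U (?p x)) = 0" by (metis cinner_commute complex_cnj_zero)
  qed
  have orth': "cinner (?p x) (?q y) = 0" "cinner (?q y) (?p x) = 0" for x y
  proof -
    show "cinner (?p x) (?q y) = 0" by (rule ocomp_orthogonal [OF p q])
    then show "cinner (?q y) (?p x) = 0" by (metis cinner_commute complex_cnj_zero)
  qed
  have "cinner (W x) (W y) = cinner x y" for x y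
  proof -
    have "cinner (W x) (W y) = cinner (?p x) (?p y) + cinner (?q x) (?q y)"
      by (simp add: W_def cinner_add_left cinner_add_right orth Up(3) Vq(3))
    also have "\<dots> = cinner (?p x + ?q x) (?p y + ?q y)"
      by (simp add: cinner_add_left cinner_add_right orth')
    finally show ?thesis by (simp flip: split)
  qed
  moreover have "W (x + y) = W x + W y" "W (c *\<^sub>C x) = c *\<^sub>C W x" for x y c
    by (simp_all add: W_def blinfun.add_right Up(1) Vq(1) proj_scaleC [OF M] proj_scaleC [OF M1]
        Up(2) Vq(2) scaleC_add_right)
  moreover have "y \<in> range W" for y
  proof -
    have "blinfun_apply (proj N) y \<in> U ` M" "blinfun_apply (proj (ocomp N)) y \<in> V ` ocomp M"
      using proj_mem [OF N] proj_mem [OF N1] U(1) V(1) by (simp_all add: unitary_between_def)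
    then obtain u v where "u \<in> M" "blinfun_apply (proj N) y = U u"
      "v \<in> ocomp M" "blinfun_apply (proj (ocomp N)) y = V v" by blast
    then have "y = W (u + v)" by (simp add: W_def pq proj_ocomp_eq [OF N, symmetric])
      (metis add_diff_cancel_left' diff_add_cancel add.commute proj_ocomp_eq [OF N])
    then show ?thesis by blast
  qed
  ultimately have W: "unitary_between UNIV UNIV W" by (auto simp: unitary_between_def)
  have "W (blinfun_apply (\<pi> X) x) = blinfun_apply (\<rho> X) (W x)" if X: "X \<in> \<A>" for X x
  proof -
    have "blinfun_apply (\<pi> X) x = blinfun_apply (\<pi> X) (?p x) + blinfun_apply (\<pi> X) (?q x)"
      by (simp flip: blinfun.add_right split)
    then have "W (blinfun_apply (\<pi> X) x) = U (blinfun_apply (\<pi> X) (?p x))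
        + V (blinfun_apply (\<pi> X) (?q x))"
      by (simp add: W_def pq inv [OF X] p q)
    also have "\<dots> = blinfun_apply (\<rho> X) (U (?p x)) + blinfun_apply (\<rho> X) (V (?q x))"
      using U(2) [OF X p] V(2) [OF X q]
      by (simp add: proj_apply [OF M p] proj_apply [OF M1 q] proj_apply [OF N Up(4)] proj_apply
            [OF N1 Vq(4)])
    finally show ?thesis by (simp add: W_def blinfun.add_right)
  qed
  then show ?thesis unfolding unitarily_equivalent_def using W by blast
qed

context wold_rep
begin

text \<open>The range of the defect is closed, so the dimension condition amounts to a unitary from
  \<open>G\<close> onto \<open>defect_space\<close>. The equivalence is recorded in both directions
  for later composition.\<close>

lemma multiplicity_spaceD:
  assumes "multiplicity_space b \<pi> G"
  obtains J \<rho> where "closed_csubspace G" "unitary_between G defect_space J"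
    "\<And>X. X \<in> cstar_W b \<Longrightarrow> is_ampliation G X (\<rho> X)"
    "unitarily_equivalent (cstar_W b) (K0 b \<pi>) (restrict_rep \<pi> (K0 b \<pi>)) (ell2_tensor G) \<rho>"
    "unitarily_equivalent (cstar_W b) (ell2_tensor G) \<rho> (K0 b \<pi>) (restrict_rep \<pi> (K0 b \<pi>))"
proof -
  have "closure (range (blinfun_apply (rep_defect b \<pi>))) = defect_space"
    using closed_csubspace_defect_space
    by (simp add: rep_defect_eq defect_space_def [symmetric] closed_csubspace_def)
  then obtain J \<rho> where *: "closed_csubspace G" "unitary_between G defect_space J"
    "\<forall>X\<in>cstar_W b. is_ampliation G X (\<rho> X)"
    "unitarily_equivalent (cstar_W b) (K0 b \<pi>) (restrict_rep \<pi> (K0 b \<pi>)) (ell2_tensor G) \<rho>"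
    using assms unfolding multiplicity_space_def by (auto simp: same_dim_iff_unitary)
  have "unitarily_equivalent (cstar_W b) (ell2_tensor G) \<rho> (K0 b \<pi>) (restrict_rep \<pi> (K0 b \<pi>))"
    by (rule unitarily_equivalent_sym [OF _ _ *(4)])
      (use closed_csubspace_K0 K0_invariant in \<open>auto simp: closed_csubspace_def proj_apply
          [OF closed_csubspace_K0]\<close>)
  with * show ?thesis using that by blast
qed

end

text \<open>Forwards, \<open>G\<close> and \<open>G'\<close> are linked through the two defect
  spaces. Backwards, a unitary from \<open>G\<close> to \<open>G'\<close> links the two spaces
  \<open>K0\<close> through the ampliations, and the result is glued to the given equivalence on
  \<open>K1\<close>.\<close>

lemma unitarily_equivalent_iff:
  assumes "wold_rep b \<pi>" "wold_rep b \<pi>'"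
    and G: "multiplicity_space b \<pi> G" and G': "multiplicity_space b \<pi>' G'"
  shows "unitarily_equivalent (cstar_W b) UNIV \<pi> UNIV \<pi>' \<longleftrightarrow>
    same_dim G G' \<and> unitarily_equivalent (cstar_W b) (K1 b \<pi>) (restrict_rep \<pi> (K1 b \<pi>))
      (K1 b \<pi>') (restrict_rep \<pi>' (K1 b \<pi>'))"
proof -
  interpret P: wold_rep b \<pi> by fact
  interpret P': wold_rep b \<pi>' by fact
  obtain J \<rho> where J: "closed_csubspace G" "unitary_between G P.defect_space J"
    "\<And>X. X \<in> cstar_W b \<Longrightarrow> is_ampliation G X (\<rho> X)"
    "unitarily_equivalent (cstar_W b) (K0 b \<pi>) (restrict_rep \<pi> (K0 b \<pi>)) (ell2_tensor G) \<rho>"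
    by (rule P.multiplicity_spaceD [OF G]) blast
  obtain J' \<rho>' where J': "closed_csubspace G'" "unitary_between G' P'.defect_space J'"
    "\<And>X. X \<in> cstar_W b \<Longrightarrow> is_ampliation G' X (\<rho>' X)"
    "unitarily_equivalent (cstar_W b) (ell2_tensor G') \<rho>' (K0 b \<pi>') (restrict_rep \<pi>' (K0 b \<pi>'))"
    by (rule P'.multiplicity_spaceD [OF G']) blast
  show ?thesis
  proof
    assume "unitarily_equivalent (cstar_W b) UNIV \<pi> UNIV \<pi>'"
    then obtain L where L: "unitary_between P.defect_space P'.defect_space L" and
      K1: "unitarily_equivalent (cstar_W b) (K1 b \<pi>) (restrict_rep \<pi> (K1 b \<pi>))
        (K1 b \<pi>') (restrict_rep \<pi>' (K1 b \<pi>'))"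
      by (rule unitarily_equivalent_parts [OF assms(1,2)])
    obtain V where "unitary_between P'.defect_space G' V" by (rule unitary_between_sym [OF J'(1,2)])
    then have "same_dim G G'"
      unfolding same_dim_iff_unitary [OF J(1)] using J(2) L
      by (blast intro: unitary_between_compose)
    with K1 show "same_dim G G' \<and> unitarily_equivalent (cstar_W b) (K1 b \<pi>) (restrict_rep \<pi> (K1 b \<pi>))
      (K1 b \<pi>') (restrict_rep \<pi>' (K1 b \<pi>'))" by blast
  next
    assume asm: "same_dim G G' \<and> unitarily_equivalent (cstar_W b) (K1 b \<pi>) (restrict_rep \<pi> (K1 b \<pi>))
      (K1 b \<pi>') (restrict_rep \<pi>' (K1 b \<pi>'))"
    then obtain L where L: "unitary_between G G' L" by (auto simp: same_dim_iff_unitary [OF J(1)])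
    have "unitarily_equivalent (cstar_W b) (ell2_tensor G) \<rho> (ell2_tensor G') \<rho>'"
      by (rule ampliation_equivalent [OF J(1) J'(1) L J(3) J'(3)])
    then have "unitarily_equivalent (cstar_W b) (K0 b \<pi>) (restrict_rep \<pi> (K0 b \<pi>))
        (K0 b \<pi>') (restrict_rep \<pi>' (K0 b \<pi>'))"
      using J(4) J'(4) by (blast intro: unitarily_equivalent_trans)
    then show "unitarily_equivalent (cstar_W b) UNIV \<pi> UNIV \<pi>'"
      using asm P.K1_invariant
      by (intro unitarily_equivalent_ocomp
          [OF P.closed_csubspace_K0 P'.closed_csubspace_K0 P.K0_invariant])
        (simp_all add: K1_def)
  qed
qed

theorem theorem5p6:
  fixes b :: "'n::finite list \<Rightarrow> real"
    and \<pi> :: "('n fock \<Rightarrow>\<^sub>L 'n fock) \<Rightarrow> ('k::complex_hilbert \<Rightarrow>\<^sub>L 'k)"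
  assumes "admissible b"
    and "summable (Delta_term UNIV (nc_inverse b) (wcreation b))"
    and "separable_space (euclidean :: 'k topology)"
    and "unital_star_rep (cstar_W b) UNIV \<pi>"
  shows
    "(let \<A> = cstar_W b; \<pi>\<^sub>0 = restrict_rep \<pi> (K0 b \<pi>); \<pi>\<^sub>1 = restrict_rep \<pi> (K1 b \<pi>) in
      summable (Delta_term UNIV (nc_inverse b) (\<lambda>i. \<pi> (wcreation b i))) \<and>
      unital_star_rep \<A> (K0 b \<pi>) \<pi>\<^sub>0 \<and>
      unital_star_rep \<A> (K1 b \<pi>) \<pi>\<^sub>1 \<and>
      is_direct_sum_rep \<A> UNIV \<pi> (K0 b \<pi>) \<pi>\<^sub>0 (K1 b \<pi>) \<pi>\<^sub>1 \<and>
      disjoint_reps \<A> (K0 b \<pi>) \<pi>\<^sub>0 (K1 b \<pi>) \<pi>\<^sub>1 \<and>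
      (\<exists>G :: 'k set. multiplicity_space b \<pi> G) \<and>
      (\<forall>X\<in>\<A>. compact_op X \<longrightarrow> \<pi>\<^sub>1 X = 0) \<and>
      Delta_term (K1 b \<pi>) (nc_inverse b) (\<lambda>i. \<pi>\<^sub>1 (wcreation b i)) sums 0)
     \<and>
     (\<forall>(\<pi>' :: ('n fock \<Rightarrow>\<^sub>L 'n fock) \<Rightarrow> ('l::complex_hilbert \<Rightarrow>\<^sub>L 'l))
        (G :: 'g::complex_hilbert set) (G' :: 'h::complex_hilbert set).
        separable_space (euclidean :: 'l topology) \<longrightarrow>
        unital_star_rep (cstar_W b) UNIV \<pi>' \<longrightarrow>
        multiplicity_space b \<pi> G \<longrightarrow> multiplicity_space b \<pi>' G' \<longrightarrow>
        (unitarily_equivalent (cstar_W b) UNIV \<pi> UNIV \<pi>' \<longleftrightarrow>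
           same_dim G G' \<and>
           unitarily_equivalent (cstar_W b) (K1 b \<pi>) (restrict_rep \<pi> (K1 b \<pi>))
             (K1 b \<pi>') (restrict_rep \<pi>' (K1 b \<pi>'))))"
proof -
  interpret weighted_fock b by standard (fact assms)+
  interpret wold_rep b \<pi> by standard (fact assms)
  have "unitarily_equivalent (cstar_W b) UNIV \<pi> UNIV \<pi>' \<longleftrightarrow>
      same_dim G G' \<and> unitarily_equivalent (cstar_W b) (K1 b \<pi>) (restrict_rep \<pi> (K1 b \<pi>))
        (K1 b \<pi>') (restrict_rep \<pi>' (K1 b \<pi>'))"
    if \<pi>': "unital_star_rep (cstar_W b) UNIV \<pi>'"
      and "multiplicity_space b \<pi> G" "multiplicity_space b \<pi>' G'"
    for \<pi>' :: "('n fock \<Rightarrow>\<^sub>L 'n fock) \<Rightarrow> ('l \<Rightarrow>\<^sub>L 'l)" and G :: "'g set" and G' :: "'h set"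
  proof (rule unitarily_equivalent_iff [OF wold_rep_axioms _ that(2,3)])
    show "wold_rep b \<pi>'" by standard (fact \<pi>')
  qed
  then show ?thesis
    unfolding Let_def
    using sums_summable [OF Delta_rep_sums] rep_K0 rep_K1 direct_sum disjoint
        multiplicity_space_defect_space
      compact_K1 Delta_K1_sums
    by blast
qed

end
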